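(* Let $R$ be a prime ring. Then $R$ is a right $a$-ring if and only if $R$ is a simple artinian ring.
   Context: Rings are associative with identity. A right module $M$ is automorphism-invariant if $\varphi(M)\subseteq M$ for every automorphism $\varphi$ of its injective envelope $E(M)$. A ring $R$ is a right $a$-ring if every right ideal of $R$ is automorphism-invariant as a right $R$-module. A (nonzero) ring is prime if the product of any two nonzero two-sided ideals is nonzero. *)

theory Defs
  imports Complex_Main "HOL-Algebra.Module" "HOL-Algebra.Ideal_Product"
begin

section \<open>One-sided ideals, prime rings, simple artinian rings\<close>

locale right_ideal = additive_subgroup I R + ring R for I and R (structure) +
  assumes I_r_closed: "\<lbrakk>x \<in> I; a \<in> carrier R\<rbrakk> \<Longrightarrow> x \<otimes> a \<in> I"

locale left_ideal = additive_subgroup I R + ring R for I and R (structure) +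
  assumes I_l_closed: "\<lbrakk>x \<in> I; a \<in> carrier R\<rbrakk> \<Longrightarrow> a \<otimes> x \<in> I"

locale prime_ring = ring R for R (structure) +
  assumes nontrivial: "carrier R \<noteq> {\<zero>}"
    and prime: "\<lbrakk>ideal I R; ideal J R; I \<noteq> {\<zero>}; J \<noteq> {\<zero>}\<rbrakk> \<Longrightarrow> ideal_prod R I J \<noteq> {\<zero>}"

locale simple_ring = ring R for R (structure) +
  assumes nontrivial: "carrier R \<noteq> {\<zero>}"
    and simple: "ideal I R \<Longrightarrow> I = {\<zero>} \<or> I = carrier R"

definition right_artinian :: "('a, 'b) ring_scheme \<Rightarrow> bool" where
  "right_artinian R \<longleftrightarrow> ring R \<and>
    (\<forall>I :: nat \<Rightarrow> 'a set. (\<forall>n. right_ideal (I n) R \<and> I (Suc n) \<subseteq> I n) \<longrightarrow>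
      (\<exists>n. \<forall>m\<ge>n. I m = I n))"

definition left_artinian :: "('a, 'b) ring_scheme \<Rightarrow> bool" where
  "left_artinian R \<longleftrightarrow> ring R \<and>
    (\<forall>I :: nat \<Rightarrow> 'a set. (\<forall>n. left_ideal (I n) R \<and> I (Suc n) \<subseteq> I n) \<longrightarrow>
      (\<exists>n. \<forall>m\<ge>n. I m = I n))"

definition artinian :: "('a, 'b) ring_scheme \<Rightarrow> bool" where
  "artinian R \<longleftrightarrow> right_artinian R \<and> left_artinian R"

definition simple_artinian_ring :: "('a, 'b) ring_scheme \<Rightarrow> bool" where
  "simple_artinian_ring R \<longleftrightarrow> simple_ring R \<and> artinian R"


section \<open>Right modules\<close>

text \<open>
  We reuse the record type of HOL-Algebra modules (whose locale requires a commutative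
  ring of scalars). The term \<open>a \<odot>\<^bsub>M\<^esub> x\<close> stands for the right action of \<open>a\<close> on \<open>x\<close>,
  usually written \<open>x a\<close>; this is why the associativity law reverses the factors.
  The library notion \<open>submodule\<close> does not depend on the side and is used as it is.
\<close>

locale right_module = R?: ring R + M?: abelian_group M for R (structure) and M (structure) +
  assumes smult_closed: "\<lbrakk>a \<in> carrier R; x \<in> carrier M\<rbrakk> \<Longrightarrow> a \<odot>\<^bsub>M\<^esub> x \<in> carrier M"
    and smult_l_distr: "\<lbrakk>a \<in> carrier R; b \<in> carrier R; x \<in> carrier M\<rbrakk> \<Longrightarrow>
      (a \<oplus>\<^bsub>R\<^esub> b) \<odot>\<^bsub>M\<^esub> x = a \<odot>\<^bsub>M\<^esub> x \<oplus>\<^bsub>M\<^esub> b \<odot>\<^bsub>M\<^esub> x"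
    and smult_r_distr: "\<lbrakk>a \<in> carrier R; x \<in> carrier M; y \<in> carrier M\<rbrakk> \<Longrightarrow>
      a \<odot>\<^bsub>M\<^esub> (x \<oplus>\<^bsub>M\<^esub> y) = a \<odot>\<^bsub>M\<^esub> x \<oplus>\<^bsub>M\<^esub> a \<odot>\<^bsub>M\<^esub> y"
    and smult_assoc: "\<lbrakk>a \<in> carrier R; b \<in> carrier R; x \<in> carrier M\<rbrakk> \<Longrightarrow>
      (a \<otimes>\<^bsub>R\<^esub> b) \<odot>\<^bsub>M\<^esub> x = b \<odot>\<^bsub>M\<^esub> (a \<odot>\<^bsub>M\<^esub> x)"
    and smult_one: "x \<in> carrier M \<Longrightarrow> \<one>\<^bsub>R\<^esub> \<odot>\<^bsub>M\<^esub> x = x"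

definition right_ideal_module :: "('a, 'b) ring_scheme \<Rightarrow> 'a set \<Rightarrow> ('a, 'a) module" where
  "right_ideal_module R I =
    \<lparr>carrier = I, mult = mult R, one = \<one>\<^bsub>R\<^esub>, zero = \<zero>\<^bsub>R\<^esub>, add = add R,
     smult = (\<lambda>a x. x \<otimes>\<^bsub>R\<^esub> a)\<rparr>"

lemma right_module_right_ideal_module:
  assumes "right_ideal I R"
  shows "right_module R (right_ideal_module R I)"
proof -
  interpret right_ideal I R by fact
  have "abelian_group (right_ideal_module R I)"
  proof (rule abelian_groupI)
    fix x assume "x \<in> carrier (right_ideal_module R I)"
    then show "\<exists>y\<in>carrier (right_ideal_module R I).
        y \<oplus>\<^bsub>right_ideal_module R I\<^esub> x = \<zero>\<^bsub>right_ideal_module R I\<^esub>"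
      by (auto simp: right_ideal_module_def intro!: bexI[of _ "\<ominus>\<^bsub>R\<^esub> x"] l_neg)
  qed (auto simp: right_ideal_module_def a_ac)
  then show ?thesis
    using ring_axioms
    by (intro right_module.intro right_module_axioms.intro)
       (auto simp: right_ideal_module_def I_r_closed l_distr r_distr m_assoc)
qed

definition module_hom ::
  "('a, 'b) ring_scheme \<Rightarrow> ('a, 'm, 'c) module_scheme \<Rightarrow> ('a, 'n, 'd) module_scheme \<Rightarrow> ('m \<Rightarrow> 'n) set"
  where
  "module_hom R M N = {f \<in> carrier M \<rightarrow> carrier N.
    (\<forall>x\<in>carrier M. \<forall>y\<in>carrier M. f (x \<oplus>\<^bsub>M\<^esub> y) = f x \<oplus>\<^bsub>N\<^esub> f y) \<and>
    (\<forall>a\<in>carrier R. \<forall>x\<in>carrier M. f (a \<odot>\<^bsub>M\<^esub> x) = a \<odot>\<^bsub>N\<^esub> f x)}"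

definition module_auto :: "('a, 'b) ring_scheme \<Rightarrow> ('a, 'm, 'c) module_scheme \<Rightarrow> ('m \<Rightarrow> 'm) set" where
  "module_auto R M = {f \<in> module_hom R M M. bij_betw f (carrier M) (carrier M)}"


section \<open>Injective envelopes and automorphism-invariance\<close>

text \<open>
  Homomorphisms into \<open>E\<close> have to extend along monomorphisms \<open>A \<rightarrow> B\<close>. A formula can
  quantify only over modules on a fixed type; \<open>'a + 'e\<close> contains copies of \<open>R\<close> (with all its
  right ideals) and of \<open>E\<close>. By Baer's criterion, the inclusions of right ideals into \<open>R\<close> already
  detect injectivity, so this is injectivity with respect to modules of any size.
\<close>

definition injective_module :: "('a, 'b) ring_scheme \<Rightarrow> ('a, 'e) module \<Rightarrow> bool" where
  "injective_module R E \<longleftrightarrow> right_module R E \<and>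
    (\<forall>(A :: ('a, 'a + 'e) module) (B :: ('a, 'a + 'e) module) i f.
      right_module R A \<and> right_module R B \<and>
      i \<in> module_hom R A B \<and> inj_on i (carrier A) \<and> f \<in> module_hom R A E \<longrightarrow>
      (\<exists>g \<in> module_hom R B E. \<forall>x\<in>carrier A. g (i x) = f x))"

definition essential_submodule ::
  "('a, 'b) ring_scheme \<Rightarrow> 'e set \<Rightarrow> ('a, 'e) module \<Rightarrow> bool" where
  "essential_submodule R N E \<longleftrightarrow> submodule N R E \<and>
    (\<forall>K. submodule K R E \<and> K \<noteq> {\<zero>\<^bsub>E\<^esub>} \<longrightarrow> K \<inter> N \<noteq> {\<zero>\<^bsub>E\<^esub>})"

definition injective_envelope ::
  "('a, 'b) ring_scheme \<Rightarrow> ('a, 'm, 'c) module_scheme \<Rightarrow> ('a, 'e) module \<Rightarrow> ('m \<Rightarrow> 'e) \<Rightarrow> bool" where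
  "injective_envelope R M E \<iota> \<longleftrightarrow> injective_module R E \<and>
    \<iota> \<in> module_hom R M E \<and> inj_on \<iota> (carrier M) \<and> essential_submodule R (\<iota> ` carrier M) E"

text \<open>
  The type \<open>'m \<Rightarrow> 'a \<Rightarrow> rat\<close> is large enough to carry an injective envelope of every right
  module \<open>M\<close> on \<open>'m\<close>, so the quantification over envelopes is not vacuous: choosing for each
  \<open>m \<noteq> 0\<close> in \<open>M\<close> an additive character \<open>\<chi>\<^sub>m : M \<rightarrow> \<rat>/\<int>\<close> with \<open>\<chi>\<^sub>m(m) \<noteq> 0\<close>, the map
  \<open>x \<mapsto> (m \<mapsto> (a \<mapsto> \<chi>\<^sub>m(x a)))\<close> embeds \<open>M\<close> into a power of the injective module
  \<open>Hom\<^sub>\<int>(R, \<rat>/\<int>)\<close>, in which an envelope of \<open>M\<close> can be found; here \<open>\<rat>/\<int>\<close> is represented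
  by the rationals in \<open>[0, 1)\<close>. Since any two envelopes of \<open>M\<close> are isomorphic over \<open>M\<close>, all
  envelopes on this type impose the same condition.
\<close>

definition automorphism_invariant ::
  "('a, 'b) ring_scheme \<Rightarrow> ('a, 'm, 'c) module_scheme \<Rightarrow> bool" where
  "automorphism_invariant R M \<longleftrightarrow> right_module R M \<and>
    (\<forall>(E :: ('a, 'm \<Rightarrow> 'a \<Rightarrow> rat) module) \<iota>. injective_envelope R M E \<iota> \<longrightarrow>
      (\<forall>\<phi> \<in> module_auto R E. \<phi> ` (\<iota> ` carrier M) \<subseteq> \<iota> ` carrier M))"

definition right_a_ring :: "('a, 'b) ring_scheme \<Rightarrow> bool" where
  "right_a_ring R \<longleftrightarrow> ring R \<and>
    (\<forall>I. right_ideal I R \<longrightarrow> automorphism_invariant R (right_ideal_module R I))"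

end

theory Submission
  imports Defs
begin

text \<open>
  Suppose first that \<open>R\<close> is simple artinian. The socle \<open>S\<close> is the smallest essential right ideal by
  the chain condition and a nonzero two-sided ideal, so it is \<open>R\<close>: there is no proper essential right
  ideal. Hence no right module \<open>M\<close> has a proper essential extension \<open>E\<close>, because the elements \<open>a\<close> with
  \<open>x a \<in> M\<close> form an essential right ideal for each \<open>x \<in> E\<close>. Thus \<open>M\<close> is all of its injective envelope,
  and automorphism-invariant.

  Conversely, let \<open>R\<close> be a prime right a-ring with injective envelope \<open>E\<close>. An isomorphism between two
  essential right ideals extends to an automorphism of \<open>E\<close>. Since \<open>E\<close> is also an envelope of each
  essential right ideal, the isomorphism is left multiplication by an element of \<open>R\<close> that maps every
  essential right ideal into itself (\<open>right_a_ring_partial_iso\<close>). Everything else is deduced from this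
  property inside \<open>R\<close>; it has content only because envelopes exist (\<open>exists_injective_envelope\<close>), on the
  type that the definition of automorphism-invariance provides. They are cut out of a power of
  \<open>Hom\<^sub>\<int>(R, \<rat>/\<int>)\<close>.

  The aim is that \<open>R\<close> has no proper essential right ideal. If \<open>R\<close> is uniform, the property makes
  every right ideal two-sided, and \<open>R\<close> is a division ring (\<open>essential_eq_carrier_if_uniform\<close>). Otherwise
  there are nonzero right ideals \<open>I\<close> and \<open>C\<close> with \<open>I \<inter> C = 0\<close>. Left multiplications from \<open>I\<close> to \<open>C\<close>
  give rise to automorphisms of essential right ideals, and these show that \<open>C I\<close> lies in every essential
  right ideal (\<open>mult_in_essential_right_ideal\<close>). So the socle \<open>S\<close> is nonzero, hence essential. Zorn's lemma
  gives a decomposition \<open>S = X \<oplus> Y \<oplus> Z\<close> with an isomorphism \<open>f : X \<rightarrow> Y\<close>, in which \<open>X\<close> and \<open>Y\<close> cannot be enlarged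
  and therefore \<open>Z\<close> is zero or minimal. A shear and a swap of \<open>X\<close> and \<open>Y\<close> are automorphisms of \<open>S\<close>, hence
  elements of \<open>R\<close>, and their stabilizing the essential right ideal \<open>e R + S\<close>, for \<open>e\<close> the projection to
  \<open>X\<close>, forces \<open>e\<close> into \<open>S\<close>. The other two projections are in \<open>S\<close> as well, so \<open>1 \<in> S\<close> (\<open>one_in_S\<close>).

  Finally, without proper essential right ideals every right ideal is a direct summand of \<open>R\<close>, and the
  chain conditions on both sides and simplicity follow as for semisimple rings.
\<close>

section \<open>Submodules and essential submodules\<close>

context right_module
begin

lemma smult_zero_left: "x \<in> carrier M \<Longrightarrow> \<zero>\<^bsub>R\<^esub> \<odot>\<^bsub>M\<^esub> x = \<zero>\<^bsub>M\<^esub>"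
  using smult_l_distr[of "\<zero>\<^bsub>R\<^esub>" "\<zero>\<^bsub>R\<^esub>" x] smult_closed[of "\<zero>\<^bsub>R\<^esub>" x]
  by (metis M.add.r_cancel_one R.zero_closed R.l_zero)

lemma smult_zero_right: "a \<in> carrier R \<Longrightarrow> a \<odot>\<^bsub>M\<^esub> \<zero>\<^bsub>M\<^esub> = \<zero>\<^bsub>M\<^esub>"
  using smult_r_distr[of a "\<zero>\<^bsub>M\<^esub>" "\<zero>\<^bsub>M\<^esub>"] smult_closed[of a "\<zero>\<^bsub>M\<^esub>"]
  by (metis M.add.r_cancel_one M.zero_closed M.l_zero)

lemma smult_minus_one: "x \<in> carrier M \<Longrightarrow> (\<ominus>\<^bsub>R\<^esub> \<one>\<^bsub>R\<^esub>) \<odot>\<^bsub>M\<^esub> x = \<ominus>\<^bsub>M\<^esub> x"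
  using smult_l_distr[of "\<ominus>\<^bsub>R\<^esub> \<one>\<^bsub>R\<^esub>" "\<one>\<^bsub>R\<^esub>" x] smult_one[of x] smult_zero_left[of x]
    smult_closed[of "\<ominus>\<^bsub>R\<^esub> \<one>\<^bsub>R\<^esub>" x] R.l_neg[of "\<one>\<^bsub>R\<^esub>"] M.minus_equality[of "(\<ominus>\<^bsub>R\<^esub> \<one>\<^bsub>R\<^esub>) \<odot>\<^bsub>M\<^esub> x" x]
  by simp

lemma submoduleI:
  assumes "N \<subseteq> carrier M" "\<zero>\<^bsub>M\<^esub> \<in> N"
    and "\<And>x y. \<lbrakk>x \<in> N; y \<in> N\<rbrakk> \<Longrightarrow> x \<oplus>\<^bsub>M\<^esub> y \<in> N"
    and smult: "\<And>a x. \<lbrakk>a \<in> carrier R; x \<in> N\<rbrakk> \<Longrightarrow> a \<odot>\<^bsub>M\<^esub> x \<in> N"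
  shows "submodule N R M"
proof -
  have "\<ominus>\<^bsub>M\<^esub> x \<in> N" if "x \<in> N" for x
    using smult[of "\<ominus>\<^bsub>R\<^esub> \<one>\<^bsub>R\<^esub>" x] smult_minus_one[of x] that assms(1) by auto
  then show ?thesis
    using assms by (auto intro!: submodule.intro subgroup.intro submodule_axioms.intro simp: a_inv_def[symmetric])
qed

lemma submoduleD:
  assumes "submodule N R M"
  shows "N \<subseteq> carrier M" "\<zero>\<^bsub>M\<^esub> \<in> N"
    and "\<And>x y. \<lbrakk>x \<in> N; y \<in> N\<rbrakk> \<Longrightarrow> x \<oplus>\<^bsub>M\<^esub> y \<in> N"
    and "\<And>a x. \<lbrakk>a \<in> carrier R; x \<in> N\<rbrakk> \<Longrightarrow> a \<odot>\<^bsub>M\<^esub> x \<in> N"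
    and "\<And>x. x \<in> N \<Longrightarrow> \<ominus>\<^bsub>M\<^esub> x \<in> N"
    and "\<And>x y. \<lbrakk>x \<in> N; y \<in> N\<rbrakk> \<Longrightarrow> x \<ominus>\<^bsub>M\<^esub> y \<in> N"
proof -
  interpret N: submodule N R M by fact
  show 1: "N \<subseteq> carrier M" "\<zero>\<^bsub>M\<^esub> \<in> N"
    "\<And>x y. \<lbrakk>x \<in> N; y \<in> N\<rbrakk> \<Longrightarrow> x \<oplus>\<^bsub>M\<^esub> y \<in> N"
    "\<And>x. x \<in> N \<Longrightarrow> \<ominus>\<^bsub>M\<^esub> x \<in> N"
    using N.subset N.one_closed N.m_closed N.m_inv_closed by (auto simp: a_inv_def)
  show "\<And>a x. \<lbrakk>a \<in> carrier R; x \<in> N\<rbrakk> \<Longrightarrow> a \<odot>\<^bsub>M\<^esub> x \<in> N"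
    by (rule N.smult_closed)
  show "\<And>x y. \<lbrakk>x \<in> N; y \<in> N\<rbrakk> \<Longrightarrow> x \<ominus>\<^bsub>M\<^esub> y \<in> N"
    using 1 by (auto simp: a_minus_def)
qed

lemma submodule_Union_chain:
  assumes "\<C> \<noteq> {}" "subset.chain {N. submodule N R M \<and> P N} \<C>"
  shows "submodule (\<Union>\<C>) R M"
proof (rule submoduleI)
  have sub: "submodule N R M" if "N \<in> \<C>" for N
    using assms that by (auto simp: subset_chain_def)
  show "\<Union>\<C> \<subseteq> carrier M" "\<zero>\<^bsub>M\<^esub> \<in> \<Union>\<C>"
    using sub submoduleD assms(1) by blast+
  show "a \<odot>\<^bsub>M\<^esub> x \<in> \<Union>\<C>" if "a \<in> carrier R" "x \<in> \<Union>\<C>" for a x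
    using that sub submoduleD(4) by blast
  show "x \<oplus>\<^bsub>M\<^esub> y \<in> \<Union>\<C>" if xy: "x \<in> \<Union>\<C>" "y \<in> \<Union>\<C>" for x y
  proof -
    obtain N N' where N: "x \<in> N" "N \<in> \<C>" "y \<in> N'" "N' \<in> \<C>" using xy by auto
    have "N \<subseteq> N' \<or> N' \<subseteq> N"
      using assms(2) N(2,4) by (auto simp: subset_chain_def)
    then show ?thesis
      using N sub submoduleD(3) by blast
  qed
qed

text \<open>
  By Zorn's lemma. The last clause is the form in which the maximality of \<open>K\<close> gets used: adjoining
  any further element \<open>x\<close> produces a nonzero element of \<open>N\<close>.
\<close>

lemma exists_complement:
  assumes N: "submodule N R M" and C: "submodule C R M" and CN: "C \<inter> N \<subseteq> {\<zero>\<^bsub>M\<^esub>}"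
  obtains K where "submodule K R M" "C \<subseteq> K" "K \<inter> N \<subseteq> {\<zero>\<^bsub>M\<^esub>}"
    "\<And>x. \<lbrakk>x \<in> carrier M; x \<notin> K\<rbrakk> \<Longrightarrow>
      \<exists>k\<in>K. \<exists>a\<in>carrier R. k \<oplus>\<^bsub>M\<^esub> a \<odot>\<^bsub>M\<^esub> x \<in> N \<and> k \<oplus>\<^bsub>M\<^esub> a \<odot>\<^bsub>M\<^esub> x \<noteq> \<zero>\<^bsub>M\<^esub>"
proof -
  let ?A = "{K. submodule K R M \<and> C \<subseteq> K \<and> K \<inter> N \<subseteq> {\<zero>\<^bsub>M\<^esub>}}"
  have "\<exists>K\<in>?A. \<forall>X\<in>?A. K \<subseteq> X \<longrightarrow> X = K"
  proof (rule subset_Zorn_nonempty)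
    show "?A \<noteq> {}" using C CN by auto
    fix \<C> assume ne: "\<C> \<noteq> {}" and ch: "subset.chain ?A \<C>"
    have "submodule (\<Union>\<C>) R M" by (rule submodule_Union_chain[OF ne ch])
    then show "\<Union>\<C> \<in> ?A" using ne ch by (fastforce simp: subset_chain_def)
  qed
  then obtain K where K: "submodule K R M" "C \<subseteq> K" "K \<inter> N \<subseteq> {\<zero>\<^bsub>M\<^esub>}"
    and max: "\<And>X. \<lbrakk>submodule X R M; C \<subseteq> X; X \<inter> N \<subseteq> {\<zero>\<^bsub>M\<^esub>}; K \<subseteq> X\<rbrakk> \<Longrightarrow> X = K"
    by auto
  note Kc = submoduleD[OF K(1)]
  have "\<exists>k\<in>K. \<exists>a\<in>carrier R. k \<oplus>\<^bsub>M\<^esub> a \<odot>\<^bsub>M\<^esub> x \<in> N \<and> k \<oplus>\<^bsub>M\<^esub> a \<odot>\<^bsub>M\<^esub> x \<noteq> \<zero>\<^bsub>M\<^esub>"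
    if x: "x \<in> carrier M" "x \<notin> K" for x
  proof (rule ccontr)
    assume no: "\<not> ?thesis"
    let ?X = "{k \<oplus>\<^bsub>M\<^esub> a \<odot>\<^bsub>M\<^esub> x | k a. k \<in> K \<and> a \<in> carrier R}"
    have "submodule ?X R M"
    proof (rule submoduleI)
      show "?X \<subseteq> carrier M" using Kc x smult_closed by auto
      show "\<zero>\<^bsub>M\<^esub> \<in> ?X"
        using Kc(2) smult_zero_left[OF x(1)] by (auto intro!: exI[of _ "\<zero>\<^bsub>M\<^esub>"] exI[of _ "\<zero>\<^bsub>R\<^esub>"])
    next
      fix u v assume "u \<in> ?X" "v \<in> ?X"
      then obtain k a l b where *: "k \<in> K" "a \<in> carrier R" "u = k \<oplus>\<^bsub>M\<^esub> a \<odot>\<^bsub>M\<^esub> x"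
        "l \<in> K" "b \<in> carrier R" "v = l \<oplus>\<^bsub>M\<^esub> b \<odot>\<^bsub>M\<^esub> x" by auto
      have "u \<oplus>\<^bsub>M\<^esub> v = (k \<oplus>\<^bsub>M\<^esub> l) \<oplus>\<^bsub>M\<^esub> (a \<oplus>\<^bsub>R\<^esub> b) \<odot>\<^bsub>M\<^esub> x"
        using * x Kc(1) smult_closed by (simp add: smult_l_distr subset_iff M.a_ac)
      then show "u \<oplus>\<^bsub>M\<^esub> v \<in> ?X" using * Kc(3) R.a_closed by blast
    next
      fix b u assume b: "b \<in> carrier R" and "u \<in> ?X"
      then obtain k a where *: "k \<in> K" "a \<in> carrier R" "u = k \<oplus>\<^bsub>M\<^esub> a \<odot>\<^bsub>M\<^esub> x" by auto
      have "b \<odot>\<^bsub>M\<^esub> u = b \<odot>\<^bsub>M\<^esub> k \<oplus>\<^bsub>M\<^esub> (a \<otimes>\<^bsub>R\<^esub> b) \<odot>\<^bsub>M\<^esub> x"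
        using * b x Kc(1) smult_closed by (simp add: smult_r_distr smult_assoc subset_iff)
      then show "b \<odot>\<^bsub>M\<^esub> u \<in> ?X" using * b Kc(4) R.m_closed by blast
    qed
    moreover have "K \<subseteq> ?X"
    proof
      fix k assume "k \<in> K"
      then show "k \<in> ?X"
        using Kc(1) smult_zero_left[OF x(1)] by (auto intro!: exI[of _ k] exI[of _ "\<zero>\<^bsub>R\<^esub>"])
    qed
    moreover have "?X \<inter> N \<subseteq> {\<zero>\<^bsub>M\<^esub>}" using no by blast
    ultimately have "?X = K" using max K(2) by blast
    moreover have "x \<in> ?X"
      using Kc(2) x smult_one by (auto intro!: exI[of _ "\<zero>\<^bsub>M\<^esub>"] exI[of _ "\<one>\<^bsub>R\<^esub>"])
    ultimately show False using x by blast
  qed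
  then show thesis using that K by blast
qed

end

text \<open>
  It suffices to test essentiality on cyclic submodules.
\<close>

lemma essential_submodule_iff:
  fixes M :: "('a, 'e) module"
  assumes "right_module R M"
  shows "essential_submodule R N M \<longleftrightarrow> submodule N R M \<and>
    (\<forall>x\<in>carrier M. x \<noteq> \<zero>\<^bsub>M\<^esub> \<longrightarrow> (\<exists>a\<in>carrier R. a \<odot>\<^bsub>M\<^esub> x \<in> N \<and> a \<odot>\<^bsub>M\<^esub> x \<noteq> \<zero>\<^bsub>M\<^esub>))"
proof -
  interpret right_module R M by fact
  have "\<exists>a\<in>carrier R. a \<odot>\<^bsub>M\<^esub> x \<in> N \<and> a \<odot>\<^bsub>M\<^esub> x \<noteq> \<zero>\<^bsub>M\<^esub>"
    if ess: "essential_submodule R N M" and x: "x \<in> carrier M" "x \<noteq> \<zero>\<^bsub>M\<^esub>" for x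
  proof -
    let ?X = "{a \<odot>\<^bsub>M\<^esub> x | a. a \<in> carrier R}"
    have "submodule ?X R M"
    proof (rule submoduleI)
      show "?X \<subseteq> carrier M" using smult_closed x by auto
      show "\<zero>\<^bsub>M\<^esub> \<in> ?X" using smult_zero_left[OF x(1)] R.zero_closed by (metis (mono_tags, lifting) mem_Collect_eq)
      show "u \<oplus>\<^bsub>M\<^esub> v \<in> ?X" if "u \<in> ?X" "v \<in> ?X" for u v
        using that x by (auto simp: smult_l_distr[symmetric])
      show "b \<odot>\<^bsub>M\<^esub> u \<in> ?X" if "b \<in> carrier R" "u \<in> ?X" for b u
        using that x by (auto simp: smult_assoc[symmetric])
    qed
    moreover have "x \<in> ?X" using smult_one[OF x(1)] R.one_closed by (metis (mono_tags, lifting) mem_Collect_eq)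
    ultimately have "?X \<inter> N \<noteq> {\<zero>\<^bsub>M\<^esub>}" using ess x unfolding essential_submodule_def by blast
    moreover have "\<zero>\<^bsub>M\<^esub> \<in> ?X \<inter> N"
      using ess submoduleD(2)[OF \<open>submodule ?X R M\<close>] submoduleD(2)[of N]
      unfolding essential_submodule_def by blast
    ultimately show ?thesis by blast
  qed
  moreover have "K \<inter> N \<noteq> {\<zero>\<^bsub>M\<^esub>}"
    if ess: "\<forall>x\<in>carrier M. x \<noteq> \<zero>\<^bsub>M\<^esub> \<longrightarrow> (\<exists>a\<in>carrier R. a \<odot>\<^bsub>M\<^esub> x \<in> N \<and> a \<odot>\<^bsub>M\<^esub> x \<noteq> \<zero>\<^bsub>M\<^esub>)"
      and K: "submodule K R M" "K \<noteq> {\<zero>\<^bsub>M\<^esub>}" for K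
  proof -
    obtain x where "x \<in> K" "x \<noteq> \<zero>\<^bsub>M\<^esub>" using K submoduleD(2) by blast
    then obtain a where "a \<in> carrier R" "a \<odot>\<^bsub>M\<^esub> x \<in> N" "a \<odot>\<^bsub>M\<^esub> x \<noteq> \<zero>\<^bsub>M\<^esub>"
      using ess submoduleD(1)[OF K(1)] by blast
    moreover from this have "a \<odot>\<^bsub>M\<^esub> x \<in> K" using \<open>x \<in> K\<close> submoduleD(4)[OF K(1)] by blast
    ultimately show ?thesis by auto
  qed
  ultimately show ?thesis unfolding essential_submodule_def by blast
qed

section \<open>Essential right ideals and the socle\<close>

text \<open>
  Stated for elements, that is, tested on principal right ideals. This saves passing between right
  ideals and submodules of the right module \<open>R\<close>.
\<close>

definition essential_right_ideal :: "('a, 'b) ring_scheme \<Rightarrow> 'a set \<Rightarrow> bool" where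
  "essential_right_ideal R L \<longleftrightarrow> right_ideal L R \<and>
    (\<forall>x\<in>carrier R. x \<noteq> \<zero>\<^bsub>R\<^esub> \<longrightarrow> (\<exists>a\<in>carrier R. x \<otimes>\<^bsub>R\<^esub> a \<in> L \<and> x \<otimes>\<^bsub>R\<^esub> a \<noteq> \<zero>\<^bsub>R\<^esub>))"

lemma right_ideal_module_simps [simp]:
  "carrier (right_ideal_module R I) = I"
  "\<zero>\<^bsub>right_ideal_module R I\<^esub> = \<zero>\<^bsub>R\<^esub>"
  "x \<oplus>\<^bsub>right_ideal_module R I\<^esub> y = x \<oplus>\<^bsub>R\<^esub> y"
  "a \<odot>\<^bsub>right_ideal_module R I\<^esub> x = x \<otimes>\<^bsub>R\<^esub> a"
  by (simp_all add: right_ideal_module_def)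

context ring
begin

lemma right_idealI:
  assumes "I \<subseteq> carrier R" "\<zero> \<in> I" "\<And>x y. \<lbrakk>x \<in> I; y \<in> I\<rbrakk> \<Longrightarrow> x \<oplus> y \<in> I"
    and mult: "\<And>x a. \<lbrakk>x \<in> I; a \<in> carrier R\<rbrakk> \<Longrightarrow> x \<otimes> a \<in> I"
  shows "right_ideal I R"
proof -
  have "\<ominus> x \<in> I" if "x \<in> I" for x
    using mult[OF that, of "\<ominus> \<one>"] that assms(1) by (auto simp: r_minus subset_iff)
  then show ?thesis
    using assms ring_axioms
    by (auto intro!: right_ideal.intro additive_subgroup.intro subgroup.intro right_ideal_axioms.intro
        simp: a_inv_def[symmetric])
qed

lemma right_idealD:
  assumes "right_ideal I R"
  shows "I \<subseteq> carrier R" "\<zero> \<in> I" "\<And>x y. \<lbrakk>x \<in> I; y \<in> I\<rbrakk> \<Longrightarrow> x \<oplus> y \<in> I"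
    and "\<And>x a. \<lbrakk>x \<in> I; a \<in> carrier R\<rbrakk> \<Longrightarrow> x \<otimes> a \<in> I"
    and "\<And>x. x \<in> I \<Longrightarrow> x \<in> carrier R" "\<And>x y. \<lbrakk>x \<in> I; y \<in> I\<rbrakk> \<Longrightarrow> x \<ominus> y \<in> I"
proof -
  interpret I: right_ideal I R by fact
  show "I \<subseteq> carrier R" "\<zero> \<in> I" "\<And>x y. \<lbrakk>x \<in> I; y \<in> I\<rbrakk> \<Longrightarrow> x \<oplus> y \<in> I"
    "\<And>x a. \<lbrakk>x \<in> I; a \<in> carrier R\<rbrakk> \<Longrightarrow> x \<otimes> a \<in> I" "\<And>x. x \<in> I \<Longrightarrow> x \<in> carrier R"
    using I.a_subset I.I_r_closed by auto
  show "\<And>x y. \<lbrakk>x \<in> I; y \<in> I\<rbrakk> \<Longrightarrow> x \<ominus> y \<in> I"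
    by (simp add: a_minus_def)
qed

lemma right_ideal_carrier: "right_ideal (carrier R) R"
  by (rule right_idealI) auto

lemma right_ideal_zero: "right_ideal {\<zero>} R"
  by (rule right_idealI) auto

lemma right_ideal_Int:
  assumes "right_ideal I R" "right_ideal J R"
  shows "right_ideal (I \<inter> J) R"
proof (rule right_idealI)
  show "I \<inter> J \<subseteq> carrier R" using right_idealD(1)[OF assms(1)] by auto
qed (use right_idealD(2-4)[OF assms(1)] right_idealD(2-4)[OF assms(2)] in auto)

lemma right_ideal_principal:
  assumes "x \<in> carrier R"
  shows "right_ideal {x \<otimes> a | a. a \<in> carrier R} R"
proof (rule right_idealI)
  show "\<zero> \<in> {x \<otimes> a | a. a \<in> carrier R}" using assms by (auto intro!: exI[of _ \<zero>])
qed (use assms in \<open>auto simp: m_assoc simp flip: r_distr\<close>)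

lemma right_ideal_annihilator:
  assumes "x \<in> carrier R"
  shows "right_ideal {a \<in> carrier R. x \<otimes> a = \<zero>} R"
  using assms by (intro right_idealI) (auto simp: r_distr simp flip: m_assoc)

lemma right_ideal_sum:
  assumes "right_ideal I R" "right_ideal J R"
  shows "right_ideal {x \<oplus> y | x y. x \<in> I \<and> y \<in> J} R"
proof (rule right_idealI)
  note I = right_idealD[OF assms(1)] and J = right_idealD[OF assms(2)]
  show "{x \<oplus> y | x y. x \<in> I \<and> y \<in> J} \<subseteq> carrier R" using I(5) J(5) by auto
  show "\<zero> \<in> {x \<oplus> y | x y. x \<in> I \<and> y \<in> J}"
    using I(2) J(2) by (auto intro!: exI[of _ \<zero>])
  fix u assume u: "u \<in> {x \<oplus> y | x y. x \<in> I \<and> y \<in> J}"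
  then obtain x y where xy: "u = x \<oplus> y" "x \<in> I" "y \<in> J" by auto
  show "u \<oplus> v \<in> {x \<oplus> y | x y. x \<in> I \<and> y \<in> J}" if v: "v \<in> {x \<oplus> y | x y. x \<in> I \<and> y \<in> J}" for v
  proof -
    obtain x' y' where xy': "v = x' \<oplus> y'" "x' \<in> I" "y' \<in> J" using v by auto
    have "u \<oplus> v = (x \<oplus> x') \<oplus> (y \<oplus> y')" using xy xy' I(5) J(5) by (simp add: a_ac)
    then show ?thesis using xy xy' I(3) J(3) by blast
  qed
  show "u \<otimes> a \<in> {x \<oplus> y | x y. x \<in> I \<and> y \<in> J}" if "a \<in> carrier R" for a
    using xy I(4)[of x a] I(5)[of x] J(4)[of y a] J(5)[of y] that l_distr[of x y a] by auto
qed

lemma right_ideal_iff_submodule: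
  "right_ideal I R \<longleftrightarrow> submodule I R (right_ideal_module R (carrier R))"
proof -
  interpret M: right_module R "right_ideal_module R (carrier R)"
    by (rule right_module_right_ideal_module[OF right_ideal_carrier])
  show ?thesis
    using right_idealD[of I] M.submoduleD[of I]
    by (auto intro!: right_idealI M.submoduleI)
qed

text \<open>
  For \<open>x\<close> outside the maximal \<open>K\<close>, some \<open>k + x a\<close> is a nonzero element of \<open>I\<close>, so that \<open>x a\<close> is a nonzero
  element of \<open>I + K\<close>.
\<close>

lemma right_ideal_complement:
  assumes I: "right_ideal I R" and C: "right_ideal C R" "C \<inter> I \<subseteq> {\<zero>}"
  obtains K where "right_ideal K R" "C \<subseteq> K" "K \<inter> I \<subseteq> {\<zero>}"
    "essential_right_ideal R {x \<oplus> k | x k. x \<in> I \<and> k \<in> K}"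
proof -
  interpret M: right_module R "right_ideal_module R (carrier R)"
    by (rule right_module_right_ideal_module[OF right_ideal_carrier])
  obtain K where K: "right_ideal K R" "C \<subseteq> K" "K \<inter> I \<subseteq> {\<zero>}"
    and max: "\<And>x. \<lbrakk>x \<in> carrier R; x \<notin> K\<rbrakk> \<Longrightarrow> \<exists>k\<in>K. \<exists>a\<in>carrier R. k \<oplus> x \<otimes> a \<in> I \<and> k \<oplus> x \<otimes> a \<noteq> \<zero>"
    using M.exists_complement[of I C] I C by (auto simp: right_ideal_iff_submodule)
  have "\<exists>a\<in>carrier R. x \<otimes> a \<in> {x \<oplus> k | x k. x \<in> I \<and> k \<in> K} \<and> x \<otimes> a \<noteq> \<zero>"
    if x: "x \<in> carrier R" "x \<noteq> \<zero>" for x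
  proof (cases "x \<in> K")
    case True
    then show ?thesis
      using x right_idealD(2)[OF I] by (intro bexI[of _ \<one>] conjI CollectI exI[of _ \<zero>] exI[of _ x]) auto
  next
    case False
    then obtain k a where ka: "k \<in> K" "a \<in> carrier R" "k \<oplus> x \<otimes> a \<in> I" "k \<oplus> x \<otimes> a \<noteq> \<zero>"
      using max x by blast
    then have k: "k \<in> carrier R" "\<ominus> k \<in> K"
      using right_idealD(5)[OF K(1)] right_idealD(6)[OF K(1), of \<zero> k] right_idealD(2)[OF K(1)]
      by (auto simp: a_minus_def)
    have "x \<otimes> a = (k \<oplus> x \<otimes> a) \<oplus> \<ominus> k"
      using k ka x by (simp add: a_ac r_neg2)
    moreover have "x \<otimes> a \<noteq> \<zero>"
      using ka k K(3) by auto
    ultimately show ?thesis using ka k by blast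
  qed
  then show thesis
    using that K right_ideal_sum[OF I K(1)] by (auto simp: essential_right_ideal_def)
qed

lemma essential_right_ideal_Int:
  assumes "essential_right_ideal R I" "essential_right_ideal R J"
  shows "essential_right_ideal R (I \<inter> J)"
  unfolding essential_right_ideal_def
proof (intro conjI ballI impI)
  have I: "right_ideal I R" and J: "right_ideal J R"
    using assms by (auto simp: essential_right_ideal_def)
  then show "right_ideal (I \<inter> J) R" by (rule right_ideal_Int)
  fix x assume x: "x \<in> carrier R" "x \<noteq> \<zero>"
  then obtain a where a: "a \<in> carrier R" "x \<otimes> a \<in> I" "x \<otimes> a \<noteq> \<zero>"
    using assms(1) by (auto simp: essential_right_ideal_def)
  then obtain b where b: "b \<in> carrier R" "x \<otimes> a \<otimes> b \<in> J" "x \<otimes> a \<otimes> b \<noteq> \<zero>"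
    using assms(2) x by (metis essential_right_ideal_def m_closed)
  then show "\<exists>a\<in>carrier R. x \<otimes> a \<in> I \<inter> J \<and> x \<otimes> a \<noteq> \<zero>"
    using a x right_idealD(4)[OF I a(2) b(1)] by (intro bexI[of _ "a \<otimes> b"]) (auto simp: m_assoc)
qed

lemma essential_right_ideal_mono:
  assumes "essential_right_ideal R I" "I \<subseteq> J" "right_ideal J R"
  shows "essential_right_ideal R J"
  using assms by (meson essential_right_ideal_def subsetD)

lemma essential_right_ideal_carrier: "essential_right_ideal R (carrier R)"
  by (auto simp: essential_right_ideal_def right_ideal_carrier intro!: bexI[of _ \<one>])

lemma essential_right_ideal_colon:
  assumes L: "essential_right_ideal R L" and a: "a \<in> carrier R"
  shows "essential_right_ideal R {r \<in> carrier R. a \<otimes> r \<in> L}"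
  unfolding essential_right_ideal_def
proof (intro conjI ballI impI)
  have Lr: "right_ideal L R" using L by (simp add: essential_right_ideal_def)
  note L' = right_idealD[OF Lr]
  show "right_ideal {r \<in> carrier R. a \<otimes> r \<in> L} R"
    using a L' by (intro right_idealI) (auto simp: r_distr simp flip: m_assoc)
  fix x assume x: "x \<in> carrier R" "x \<noteq> \<zero>"
  show "\<exists>b\<in>carrier R. x \<otimes> b \<in> {r \<in> carrier R. a \<otimes> r \<in> L} \<and> x \<otimes> b \<noteq> \<zero>"
  proof (cases "a \<otimes> x = \<zero>")
    case True
    then show ?thesis using x L'(2) by (intro bexI[of _ \<one>]) auto
  next
    case False
    then obtain b where "b \<in> carrier R" "a \<otimes> x \<otimes> b \<in> L" "a \<otimes> x \<otimes> b \<noteq> \<zero>"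
      using L a x by (meson essential_right_ideal_def m_closed)
    then show ?thesis
      using a x by (intro bexI[of _ b]) (auto simp: m_assoc)
  qed
qed

end

text \<open>
  In every module, the intersection of the essential submodules is the sum of the simple
  submodules, so this is the usual socle.
\<close>

definition socle :: "('a, 'b) ring_scheme \<Rightarrow> 'a set" where
  "socle R = \<Inter>{L. essential_right_ideal R L}"

text \<open>
  If \<open>L\<close> is essential, so is \<open>{r. a r \<in> L}\<close>. The latter contains the socle \<open>S\<close>, that is, \<open>a S \<subseteq> L\<close>.
\<close>

lemma (in ring) ideal_socle: "ideal (socle R) R"
proof -
  have sub: "socle R \<subseteq> carrier R"
    using essential_right_ideal_carrier by (auto simp: socle_def)
  have r: "right_ideal (socle R) R"
    using right_idealD by (intro right_idealI sub) (auto simp: socle_def essential_right_ideal_def)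
  have l: "a \<otimes> x \<in> socle R" if "x \<in> socle R" "a \<in> carrier R" for x a
    using that essential_right_ideal_colon[of _ a] by (auto simp: socle_def)
  interpret right_ideal "socle R" R by fact
  show ?thesis
    by (intro ideal.intro ideal_axioms.intro additive_subgroup_axioms ring_axioms l I_r_closed)
qed

lemma (in ring) right_ideal_if_ideal: "ideal I R \<Longrightarrow> right_ideal I R"
  by (auto simp: ideal_def ideal_axioms_def right_ideal_def right_ideal_axioms_def)

lemma (in ring) socle_subset: "essential_right_ideal R L \<Longrightarrow> socle R \<subseteq> L"
  by (auto simp: socle_def)

section \<open>Characters of abelian groups\<close>

text \<open>
  Characters with values in \<open>\<rat>/\<int>\<close>, represented by the rationals in \<open>[0, 1)\<close>.
\<close>

definition rat_characters :: "('g, 'c) monoid_scheme \<Rightarrow> ('g \<Rightarrow> rat) set" where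
  "rat_characters G = {\<chi>. (\<forall>x\<in>carrier G. 0 \<le> \<chi> x \<and> \<chi> x < 1) \<and>
    (\<forall>x\<in>carrier G. \<forall>y\<in>carrier G. \<chi> (x \<otimes>\<^bsub>G\<^esub> y) = frac (\<chi> x + \<chi> y))}"

text \<open>
  A partial character, given by rational representatives of its values. Working with all of \<open>\<rat>\<close>
  avoids reductions modulo \<open>1\<close>; the last clause says that the values are well defined in \<open>\<rat>/\<int>\<close>.
\<close>

definition character_graph :: "('g, 'c) monoid_scheme \<Rightarrow> ('g \<times> rat) set \<Rightarrow> bool" where
  "character_graph G F \<longleftrightarrow> F \<subseteq> carrier G \<times> UNIV \<and> (\<one>\<^bsub>G\<^esub>, 0) \<in> F \<and>
    (\<forall>x p y q. (x, p) \<in> F \<longrightarrow> (y, q) \<in> F \<longrightarrow> (x \<otimes>\<^bsub>G\<^esub> y, p + q) \<in> F) \<and>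
    (\<forall>x p. (x, p) \<in> F \<longrightarrow> (inv\<^bsub>G\<^esub> x, - p) \<in> F) \<and>
    (\<forall>q. (\<one>\<^bsub>G\<^esub>, q) \<in> F \<longrightarrow> q \<in> \<int>)"

lemma character_graphD:
  assumes "character_graph G F"
  shows "\<And>x p. (x, p) \<in> F \<Longrightarrow> x \<in> carrier G" "(\<one>\<^bsub>G\<^esub>, 0) \<in> F"
    "\<And>x p y q. \<lbrakk>(x, p) \<in> F; (y, q) \<in> F\<rbrakk> \<Longrightarrow> (x \<otimes>\<^bsub>G\<^esub> y, p + q) \<in> F"
    "\<And>x p. (x, p) \<in> F \<Longrightarrow> (inv\<^bsub>G\<^esub> x, - p) \<in> F"
    "\<And>q. (\<one>\<^bsub>G\<^esub>, q) \<in> F \<Longrightarrow> q \<in> \<int>"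
  using assms by (auto simp: character_graph_def)

lemma int_subgroup_generator:
  fixes N :: "int set"
  assumes "0 \<in> N" and diff: "\<And>k l. \<lbrakk>k \<in> N; l \<in> N\<rbrakk> \<Longrightarrow> k - l \<in> N"
  shows "\<exists>n\<in>N. n \<ge> 0 \<and> (\<forall>k\<in>N. n dvd k)"
proof (cases "N = {0}")
  case True
  then show ?thesis by auto
next
  case False
  then obtain m where m: "m \<in> N" "m \<noteq> 0" using assms(1) by auto
  have neg: "- k \<in> N" if "k \<in> N" for k using diff[OF assms(1) that] by simp
  have "\<exists>n::nat. n > 0 \<and> int n \<in> N"
    using m neg[of m] by (intro exI[of _ "nat \<bar>m\<bar>"]) (auto simp: abs_if)
  then obtain n :: nat where n: "n > 0" "int n \<in> N" and least: "\<And>l. l < n \<Longrightarrow> \<not> (l > 0 \<and> int l \<in> N)"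
    using exists_least_iff[of "\<lambda>n::nat. n > 0 \<and> int n \<in> N"] by auto
  have mult: "int j * int n \<in> N" for j
  proof (induction j)
    case (Suc j)
    then show ?case using diff[OF Suc neg[OF n(2)]] by (simp add: algebra_simps)
  qed (simp add: assms(1))
  have multi: "j * int n \<in> N" for j
    using mult[of "nat j"] neg[OF mult[of "nat (- j)"]] by (cases "j \<ge> 0") auto
  have "int n dvd k" if k: "k \<in> N" for k
  proof -
    have "k mod int n = k - k div int n * int n" by (simp add: minus_div_mult_eq_mod)
    then have "k mod int n \<in> N" using diff[OF k multi] by simp
    moreover have "0 \<le> k mod int n" "k mod int n < int n" using n(1) by simp_all
    ultimately have "k mod int n = 0"
      using least[of "nat (k mod int n)"] by (cases "k mod int n = 0") (simp_all add: nat_less_iff)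
    then show ?thesis by (rule dvd_eq_mod_eq_0[THEN iffD2])
  qed
  then show ?thesis using n by (intro bexI[of _ "int n"]) auto
qed

context comm_group
begin

lemma character_graph_int_pow:
  assumes F: "character_graph G F" and x: "(x, q) \<in> F"
  shows "(x [^] (k::int), of_int k * q) \<in> F"
proof -
  note D = character_graphD[OF F]
  have nat: "(x [^] (n::nat), of_nat n * q) \<in> F" for n
  proof (induction n)
    case (Suc n)
    then show ?case using D(3)[OF Suc x] by (simp add: algebra_simps)
  qed (simp add: D(2))
  show ?thesis
  proof (cases "k \<ge> 0")
    case True
    then show ?thesis using nat[of "nat k"] by simp
  next
    case False
    define n where "n = nat (- k)"
    then have k: "k = - int n" using False by simp
    show ?thesis using D(4)[OF nat[of n]] D(1)[OF x] by (simp add: k int_pow_neg_int)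
  qed
qed

text \<open>
  Divisibility of \<open>\<rat>\<close> makes one-step extensions possible: if \<open>n\<close> generates the group of all \<open>k\<close>
  with \<open>b\<^sup>k\<close> in the domain, and \<open>q\<close> is a value at \<open>b\<^sup>n\<close>, then \<open>q / n\<close> is a consistent value at \<open>b\<close>.
\<close>

lemma character_graph_adjoin:
  assumes F: "character_graph G F" and b: "b \<in> carrier G"
  obtains F' where "character_graph G F'" "F \<subseteq> F'" "b \<in> Domain F'"
proof -
  note D = character_graphD[OF F]
  let ?N = "{k::int. b [^] k \<in> Domain F}"
  have "k - l \<in> ?N" if kl: "k \<in> ?N" "l \<in> ?N" for k l
  proof -
    obtain p q where "(b [^] k, p) \<in> F" "(b [^] l, q) \<in> F" using kl by auto
    then have "(b [^] k \<otimes> inv (b [^] l), p + - q) \<in> F" using D(3,4) by blast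
    then show ?thesis using b by (auto simp: int_pow_diff)
  qed
  moreover have "0 \<in> ?N" using D(2) by auto
  ultimately have "\<exists>n\<in>?N. n \<ge> 0 \<and> (\<forall>k\<in>?N. n dvd k)" by (intro int_subgroup_generator)
  then obtain n where n: "n \<in> ?N" and dvd: "\<forall>k\<in>?N. n dvd k" by auto
  obtain q where q: "(b [^] n, q) \<in> F" "n = 0 \<Longrightarrow> q = 0"
  proof (cases "n = 0")
    case True
    then show ?thesis using that[of 0] D(2) by auto
  next
    case False
    then show ?thesis using that n by auto
  qed
  define d where "d = q / of_int n"
  have consistent: "(b [^] k, of_int k * d) \<in> F" if k: "b [^] k \<in> Domain F" for k
  proof -
    obtain j where j: "k = n * j" using dvd k by auto
    have "((b [^] n) [^] j, of_int j * q) \<in> F" using character_graph_int_pow[OF F q(1)] .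
    moreover have "of_int k * d = of_int j * q" using j q(2) by (cases "n = 0") (auto simp: d_def)
    moreover have "(b [^] n) [^] j = b [^] k" using j b by (simp add: int_pow_pow)
    ultimately show ?thesis by simp
  qed
  define F' where "F' = {(x \<otimes> b [^] k, p + of_int k * d) | x p k. (x, p) \<in> F}"
  have F'I: "(x \<otimes> b [^] k, p + of_int k * d) \<in> F'" if "(x, p) \<in> F" for x p k
    using that by (auto simp: F'_def)
  have sub: "F \<subseteq> F'"
  proof
    fix z assume "z \<in> F"
    then show "z \<in> F'" using F'I[of "fst z" "snd z" 0] D(1)[of "fst z" "snd z"] by simp
  qed
  have "character_graph G F'"
    unfolding character_graph_def
  proof (intro conjI allI impI)
    show "F' \<subseteq> carrier G \<times> UNIV" using D(1) b by (auto simp: F'_def)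
    show "(\<one>, 0) \<in> F'" using sub D(2) by auto
  next
    fix x p y q assume "(x, p) \<in> F'" "(y, q) \<in> F'"
    then obtain x' p' k y' q' l where *: "x = x' \<otimes> b [^] k" "p = p' + of_int k * d" "(x', p') \<in> F"
      "y = y' \<otimes> b [^] l" "q = q' + of_int l * d" "(y', q') \<in> F"
      by (auto simp: F'_def)
    have "x \<otimes> y = (x' \<otimes> y') \<otimes> b [^] (k + l)"
      using * b D(1) by (simp add: m_ac int_pow_mult)
    moreover have "p + q = (p' + q') + of_int (k + l) * d" using * by (simp add: algebra_simps)
    ultimately show "(x \<otimes> y, p + q) \<in> F'" using F'I[OF D(3)[OF *(3,6)], of "k + l"] by simp
  next
    fix x p assume "(x, p) \<in> F'"
    then obtain x' p' k where *: "x = x' \<otimes> b [^] k" "p = p' + of_int k * d" "(x', p') \<in> F"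
      by (auto simp: F'_def)
    have "inv x = inv x' \<otimes> b [^] (- k)"
      using * b D(1)[OF *(3)] by (simp add: inv_mult int_pow_neg)
    then show "(inv x, - p) \<in> F'" using F'I[OF D(4)[OF *(3)], of "- k"] * by simp
  next
    fix r assume "(\<one>, r) \<in> F'"
    then obtain x p k where *: "\<one> = x \<otimes> b [^] k" "r = p + of_int k * d" "(x, p) \<in> F"
      by (auto simp: F'_def)
    have "b [^] k = inv x" using *(1) b D(1)[OF *(3)] by (metis inv_char int_pow_closed m_comm)
    then have "b [^] k \<in> Domain F" using D(4)[OF *(3)] by auto
    then have "(b [^] k, of_int k * d) \<in> F" by (rule consistent)
    then show "r \<in> \<int>" using D(5) D(3)[OF *(3)] *(1,2) by metis
  qed
  moreover have "b \<in> Domain F'"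
    using F'I[OF D(2), of 1] b by auto
  ultimately show thesis using that sub by blast
qed

text \<open>
  A maximal extension of the graph is defined everywhere, as otherwise a further element could be adjoined.
\<close>

lemma character_graph_extends:
  assumes F0: "character_graph G F0"
  shows "\<exists>\<chi>\<in>rat_characters G. \<forall>(x, q)\<in>F0. \<chi> x = frac q"
proof -
  let ?A = "{F. character_graph G F \<and> F0 \<subseteq> F}"
  have "\<exists>F\<in>?A. \<forall>X\<in>?A. F \<subseteq> X \<longrightarrow> X = F"
  proof (rule subset_Zorn_nonempty)
    show "?A \<noteq> {}" using F0 by auto
    fix \<C> assume ne: "\<C> \<noteq> {}" and ch: "subset.chain ?A \<C>"
    have gr: "character_graph G F" if "F \<in> \<C>" for F using ch that by (auto simp: subset_chain_def)
    note D = character_graphD[OF gr]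
    have "character_graph G (\<Union>\<C>)"
      unfolding character_graph_def
    proof (intro conjI allI impI)
      show "\<Union>\<C> \<subseteq> carrier G \<times> UNIV" using D(1) by auto
      show "(\<one>, 0) \<in> \<Union>\<C>" using D(2) ne by auto
      show "(inv x, - p) \<in> \<Union>\<C>" if "(x, p) \<in> \<Union>\<C>" for x p using that D(4) by auto
      show "q \<in> \<int>" if "(\<one>, q) \<in> \<Union>\<C>" for q using that D(5) by auto
      fix x p y q assume "(x, p) \<in> \<Union>\<C>" "(y, q) \<in> \<Union>\<C>"
      then obtain F F' where F: "F \<in> \<C>" "F' \<in> \<C>" "(x, p) \<in> F" "(y, q) \<in> F'" by auto
      then have "F \<subseteq> F' \<or> F' \<subseteq> F" using ch by (auto simp: subset_chain_def)
      then show "(x \<otimes> y, p + q) \<in> \<Union>\<C>" using F D(3) by blast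
    qed
    moreover have "F0 \<subseteq> \<Union>\<C>"
    proof -
      obtain F where "F \<in> \<C>" "F0 \<subseteq> F" using ne ch by (auto simp: subset_chain_def)
      then show ?thesis by blast
    qed
    ultimately show "\<Union>\<C> \<in> ?A" by auto
  qed
  then obtain F where FA: "F \<in> ?A" and mA: "\<forall>X\<in>?A. F \<subseteq> X \<longrightarrow> X = F" by (rule bexE)
  from FA have F: "character_graph G F" "F0 \<subseteq> F" by simp_all
  have max: "X = F" if X: "character_graph G X" "F \<subseteq> X" for X
  proof -
    have "X \<in> ?A" using X(1) order_trans[OF F(2) X(2)] by simp
    from bspec[OF mA this] X(2) show ?thesis by (rule mp)
  qed
  note D = character_graphD[OF F(1)]
  have dom: "\<exists>q. (x, q) \<in> F" if x: "x \<in> carrier G" for x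
  proof -
    obtain F' where F': "character_graph G F'" "F \<subseteq> F'" "x \<in> Domain F'"
      using character_graph_adjoin[OF F(1) x] .
    have "F' = F" using max[OF F'(1,2)] .
    then show ?thesis using F'(3) by (simp add: Domain_iff)
  qed
  define \<chi> where "\<chi> x = frac (SOME q. (x, q) \<in> F)" for x
  have \<chi>: "\<chi> x = frac q" if "(x, q) \<in> F" for x q
  proof -
    have "(x, SOME q. (x, q) \<in> F) \<in> F" using that by (rule someI)
    then have "(x \<otimes> inv x, (SOME q. (x, q) \<in> F) + - q) \<in> F" using that D(3,4) by blast
    then have "(SOME q. (x, q) \<in> F) - q \<in> \<int>" using D(5) D(1)[OF that] by simp
    then have "frac ((SOME q. (x, q) \<in> F) - q + q) = frac q" by (rule frac_add_int_left)
    then show ?thesis by (simp add: \<chi>_def)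
  qed
  have "\<chi> \<in> rat_characters G"
    unfolding rat_characters_def
  proof (intro CollectI conjI ballI)
    show "0 \<le> \<chi> x" "\<chi> x < 1" for x by (simp_all add: \<chi>_def frac_lt_1)
    fix x y assume "x \<in> carrier G" "y \<in> carrier G"
    then obtain p q where "(x, p) \<in> F" "(y, q) \<in> F" using dom by blast
    then show "\<chi> (x \<otimes> y) = frac (\<chi> x + \<chi> y)" using \<chi> D(3) by simp
  qed
  then show ?thesis using \<chi> F(2) by blast
qed

lemma rat_character_one:
  assumes "\<chi> \<in> rat_characters G"
  shows "\<chi> \<one> = 0"
proof -
  have "\<chi> \<one> = frac (\<chi> \<one> + \<chi> \<one>)" "0 \<le> \<chi> \<one>" "\<chi> \<one> < 1"
    using assms by (auto simp: rat_characters_def dest!: bspec[of _ _ \<one>])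
  then have "\<chi> \<one> \<in> \<int>" using frac_unique_iff[of "\<chi> \<one> + \<chi> \<one>" "\<chi> \<one>"] by simp
  then have "frac (\<chi> \<one>) = 0" by simp
  then show ?thesis using \<open>0 \<le> \<chi> \<one>\<close> \<open>\<chi> \<one> < 1\<close> by (simp add: frac_eq)
qed

lemma rat_character_inv:
  assumes "\<chi> \<in> rat_characters G" "x \<in> carrier G"
  shows "\<chi> (inv x) = frac (- \<chi> x)"
proof -
  have "\<chi> (x \<otimes> inv x) = frac (\<chi> x + \<chi> (inv x))"
    using assms inv_closed[of x] unfolding rat_characters_def by blast
  then have "\<chi> x + \<chi> (inv x) \<in> \<int>"
    using assms rat_character_one[OF assms(1)] by simp
  then have "frac (\<chi> x + \<chi> (inv x) + - \<chi> x) = frac (- \<chi> x)" by (rule frac_add_int_left)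
  moreover have "frac (\<chi> (inv x)) = \<chi> (inv x)"
    using assms by (auto simp: rat_characters_def frac_eq)
  ultimately show ?thesis by simp
qed

text \<open>
  If \<open>n \<ge> 2\<close> divides every \<open>k\<close> with \<open>b\<^sup>k = 1\<close>, then \<open>b\<^sup>k \<mapsto> k / n\<close> is a well-defined partial character.
  For \<open>n\<close> one takes the order of \<open>b\<close>, or \<open>2\<close> if the order is infinite.
\<close>

lemma rat_characters_separate:
  assumes b: "b \<in> carrier G" "b \<noteq> \<one>"
  shows "\<exists>\<chi>\<in>rat_characters G. \<chi> b \<noteq> 0"
proof -
  obtain n :: int where n: "n \<ge> 2" "\<And>k. b [^] k = \<one> \<Longrightarrow> n dvd k"
  proof -
    let ?N = "{k::int. b [^] k = \<one>}"
    have "\<exists>n\<in>?N. n \<ge> 0 \<and> (\<forall>k\<in>?N. n dvd k)"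
      using b by (intro int_subgroup_generator) (auto simp: int_pow_diff)
    then obtain n where n: "n \<in> ?N" "n \<ge> 0" "\<forall>k\<in>?N. n dvd k" by auto
    show thesis
    proof (cases "n = 0")
      case True
      then show thesis using that[of 2] n(3) by force
    next
      case False
      then have "n \<ge> 2" using n(1,2) b by (cases "n = 1") auto
      then show thesis using that n(3) by auto
    qed
  qed
  let ?F = "{(b [^] (k::int), rat_of_int k / rat_of_int n) | k. True}"
  have "character_graph G ?F"
    unfolding character_graph_def
  proof (intro conjI allI impI)
    show "?F \<subseteq> carrier G \<times> UNIV" using b by auto
    show "(\<one>, 0) \<in> ?F" by (auto intro!: exI[of _ 0])
    show "(x \<otimes> y, p + q) \<in> ?F" if xy: "(x, p) \<in> ?F" "(y, q) \<in> ?F" for x p y q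
    proof -
      obtain k l :: int where "x = b [^] k" "p = of_int k / of_int n" "y = b [^] l" "q = of_int l / of_int n"
        using xy by auto
      then have "x \<otimes> y = b [^] (k + l)" "p + q = of_int (k + l) / of_int n"
        using b by (auto simp: int_pow_mult add_divide_distrib)
      then show ?thesis by blast
    qed
    show "(inv x, - p) \<in> ?F" if x: "(x, p) \<in> ?F" for x p
    proof -
      obtain k :: int where "x = b [^] k" "p = of_int k / of_int n" using x by auto
      then have "inv x = b [^] (- k)" "- p = of_int (- k) / of_int n"
        using b by (auto simp: int_pow_neg)
      then show ?thesis by blast
    qed
    show "q \<in> \<int>" if q: "(\<one>, q) \<in> ?F" for q
    proof -
      obtain k :: int where k: "\<one> = b [^] k" "q = of_int k / of_int n" using q by auto
      then have "n dvd k" using n(2)[of k] by simp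
      then show ?thesis using n(1) k(2) by auto
    qed
  qed
  then obtain \<chi> where \<chi>: "\<chi> \<in> rat_characters G" "\<forall>(x, q)\<in>?F. \<chi> x = frac q"
    using character_graph_extends by blast
  have "(b [^] (1::int), 1 / of_int n) \<in> ?F" by (auto intro!: exI[of _ 1])
  then have "\<chi> b = frac (1 / of_int n)" using \<chi>(2) b by auto
  moreover have "frac (1 / rat_of_int n) = 1 / of_int n" using n(1) by (simp add: frac_eq)
  ultimately show ?thesis using \<chi>(1) n(1) by (intro bexI[of _ \<chi>]) auto
qed

end

lemma rat_character_extends:
  assumes A: "comm_group A" and B: "comm_group B"
    and i: "i \<in> hom A B" "inj_on i (carrier A)" and \<chi>: "\<chi> \<in> rat_characters A"
  obtains \<chi>' where "\<chi>' \<in> rat_characters B" "\<And>x. x \<in> carrier A \<Longrightarrow> \<chi>' (i x) = \<chi> x"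
proof -
  interpret A: comm_group A by fact
  interpret B: comm_group B by fact
  interpret i: group_hom A B i using i by unfold_locales
  have range: "0 \<le> \<chi> x" "\<chi> x < 1" if "x \<in> carrier A" for x
    using \<chi> that by (auto simp: rat_characters_def)
  have add: "\<chi> (x \<otimes>\<^bsub>A\<^esub> y) = frac (\<chi> x + \<chi> y)" if "x \<in> carrier A" "y \<in> carrier A" for x y
    using \<chi> that by (auto simp: rat_characters_def)
  let ?F = "{(i x, q) | x q. x \<in> carrier A \<and> frac q = \<chi> x}"
  have "character_graph B ?F"
    unfolding character_graph_def
  proof (intro conjI allI impI)
    show "?F \<subseteq> carrier B \<times> UNIV" by auto
    show "(\<one>\<^bsub>B\<^esub>, 0) \<in> ?F"
      using A.rat_character_one[OF \<chi>] by (auto intro!: exI[of _ "\<one>\<^bsub>A\<^esub>"])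
    show "(u \<otimes>\<^bsub>B\<^esub> v, p + q) \<in> ?F" if uv: "(u, p) \<in> ?F" "(v, q) \<in> ?F" for u p v q
    proof -
      obtain x y where "u = i x" "x \<in> carrier A" "frac p = \<chi> x" "v = i y" "y \<in> carrier A" "frac q = \<chi> y"
        using uv by auto
      moreover from this have "frac (p + q) = \<chi> (x \<otimes>\<^bsub>A\<^esub> y)"
        using add[of x y] by (metis frac_add_simps)
      ultimately show ?thesis by (auto intro!: exI[of _ "x \<otimes>\<^bsub>A\<^esub> y"])
    qed
    show "(inv\<^bsub>B\<^esub> u, - p) \<in> ?F" if u: "(u, p) \<in> ?F" for u p
    proof -
      obtain x where "u = i x" "x \<in> carrier A" "frac p = \<chi> x" using u by auto
      then show ?thesis
        using A.rat_character_inv[OF \<chi>, of x] by (auto intro!: exI[of _ "inv\<^bsub>A\<^esub> x"] simp: frac_neg_frac simp flip: \<open>frac p = \<chi> x\<close>)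
    qed
    show "q \<in> \<int>" if q: "(\<one>\<^bsub>B\<^esub>, q) \<in> ?F" for q
    proof -
      obtain x where x: "i x = \<one>\<^bsub>B\<^esub>" "x \<in> carrier A" "frac q = \<chi> x" using q by auto
      then have "x = \<one>\<^bsub>A\<^esub>" using i(2) by (metis A.one_closed i.hom_one inj_onD)
      then show ?thesis using x(3) A.rat_character_one[OF \<chi>] by simp
    qed
  qed
  then obtain \<chi>' where \<chi>': "\<chi>' \<in> rat_characters B" "\<forall>(x, q)\<in>?F. \<chi>' x = frac q"
    using B.character_graph_extends by blast
  have "\<chi>' (i x) = \<chi> x" if "x \<in> carrier A" for x
  proof -
    have "frac (\<chi> x) = \<chi> x" using range[OF that] by (simp add: frac_eq)
    then have "(i x, \<chi> x) \<in> ?F" using that by blast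
    from bspec[OF \<chi>'(2) this] show ?thesis using \<open>frac (\<chi> x) = \<chi> x\<close> by simp
  qed
  then show thesis using that \<chi>'(1) by blast
qed

section \<open>Injective envelopes\<close>

lemma module_homD:
  assumes "f \<in> module_hom R M N"
  shows "\<And>x. x \<in> carrier M \<Longrightarrow> f x \<in> carrier N"
    "\<And>x y. \<lbrakk>x \<in> carrier M; y \<in> carrier M\<rbrakk> \<Longrightarrow> f (x \<oplus>\<^bsub>M\<^esub> y) = f x \<oplus>\<^bsub>N\<^esub> f y"
    "\<And>a x. \<lbrakk>a \<in> carrier R; x \<in> carrier M\<rbrakk> \<Longrightarrow> f (a \<odot>\<^bsub>M\<^esub> x) = a \<odot>\<^bsub>N\<^esub> f x"
  using assms by (auto simp: module_hom_def)

lemma module_homI: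
  assumes "\<And>x. x \<in> carrier M \<Longrightarrow> f x \<in> carrier N"
    "\<And>x y. \<lbrakk>x \<in> carrier M; y \<in> carrier M\<rbrakk> \<Longrightarrow> f (x \<oplus>\<^bsub>M\<^esub> y) = f x \<oplus>\<^bsub>N\<^esub> f y"
    "\<And>a x. \<lbrakk>a \<in> carrier R; x \<in> carrier M\<rbrakk> \<Longrightarrow> f (a \<odot>\<^bsub>M\<^esub> x) = a \<odot>\<^bsub>N\<^esub> f x"
  shows "f \<in> module_hom R M N"
  using assms by (auto simp: module_hom_def)

lemma module_hom_zero:
  assumes "right_module R M" "right_module R N" "f \<in> module_hom R M N"
  shows "f \<zero>\<^bsub>M\<^esub> = \<zero>\<^bsub>N\<^esub>"
proof -
  interpret M: right_module R M by fact
  interpret N: right_module R N by fact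
  have "f \<zero>\<^bsub>M\<^esub> = f (\<zero>\<^bsub>R\<^esub> \<odot>\<^bsub>M\<^esub> \<zero>\<^bsub>M\<^esub>)" by (simp add: M.smult_zero_left)
  also have "\<dots> = \<zero>\<^bsub>N\<^esub>"
    using module_homD[OF assms(3)] by (simp add: N.smult_zero_left)
  finally show ?thesis .
qed

lemma module_hom_minus:
  assumes "right_module R M" "right_module R N" "f \<in> module_hom R M N"
    and xy: "x \<in> carrier M" "y \<in> carrier M"
  shows "f (x \<ominus>\<^bsub>M\<^esub> y) = f x \<ominus>\<^bsub>N\<^esub> f y"
proof -
  interpret M: right_module R M by fact
  interpret N: right_module R N by fact
  have "f (\<ominus>\<^bsub>M\<^esub> y) = \<ominus>\<^bsub>N\<^esub> f y"
    using module_homD[OF assms(3)] xy by (simp flip: M.smult_minus_one N.smult_minus_one)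
  then show ?thesis using module_homD[OF assms(3)] xy by (simp add: a_minus_def)
qed

lemma module_hom_inj_onI:
  assumes "right_module R M" "right_module R N" "f \<in> module_hom R M N"
    and ker: "\<And>x. \<lbrakk>x \<in> carrier M; f x = \<zero>\<^bsub>N\<^esub>\<rbrakk> \<Longrightarrow> x = \<zero>\<^bsub>M\<^esub>"
  shows "inj_on f (carrier M)"
proof (rule inj_onI)
  interpret M: right_module R M by fact
  interpret N: right_module R N by fact
  fix x y assume xy: "x \<in> carrier M" "y \<in> carrier M" "f x = f y"
  then have "f (x \<ominus>\<^bsub>M\<^esub> y) = \<zero>\<^bsub>N\<^esub>"
    using module_hom_minus[OF assms(1-3)] module_homD(1)[OF assms(3)] by (simp add: a_minus_def N.M.r_neg)
  then have "x \<oplus>\<^bsub>M\<^esub> \<ominus>\<^bsub>M\<^esub> y = \<zero>\<^bsub>M\<^esub>" using ker[of "x \<ominus>\<^bsub>M\<^esub> y"] xy by (simp add: a_minus_def)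
  then show "x = y" using M.M.minus_equality[of x "\<ominus>\<^bsub>M\<^esub> y"] xy by simp
qed

lemma (in right_module) right_module_submodule:
  assumes "submodule N R M"
  shows "right_module R (M\<lparr>carrier := N\<rparr>)"
proof -
  note N = submoduleD[OF assms]
  have "abelian_group (M\<lparr>carrier := N\<rparr>)"
  proof (rule abelian_groupI)
    fix x assume "x \<in> carrier (M\<lparr>carrier := N\<rparr>)"
    then show "\<exists>y\<in>carrier (M\<lparr>carrier := N\<rparr>). y \<oplus>\<^bsub>M\<lparr>carrier := N\<rparr>\<^esub> x = \<zero>\<^bsub>M\<lparr>carrier := N\<rparr>\<^esub>"
      using N(1,5) by (auto intro!: bexI[of _ "\<ominus>\<^bsub>M\<^esub> x"] M.l_neg)
  qed (use N(1-3) in \<open>auto simp: subset_iff M.a_ac\<close>)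
  then show ?thesis
    using R.ring_axioms N(1,4)
    by (intro right_module.intro right_module_axioms.intro)
      (auto simp: subset_iff smult_l_distr smult_r_distr smult_assoc smult_one)
qed

text \<open>
  The power \<open>Hom\<^sub>\<int>(R, \<rat>/\<int>)\<^sup>'i\<close> as a right module, with \<open>(p a) m r = p m (a r)\<close>. Functions vanish
  outside the carrier of \<open>R\<close>, so that equality in the module is equality of functions.
\<close>

definition character_module :: "('a, 'b) ring_scheme \<Rightarrow> ('a, 'i \<Rightarrow> 'a \<Rightarrow> rat) module" where
  "character_module R = \<lparr>carrier = {p. \<forall>m. p m \<in> rat_characters (add_monoid R) \<and> (\<forall>r. r \<notin> carrier R \<longrightarrow> p m r = 0)},
     mult = undefined, one = undefined, zero = (\<lambda>_ _. 0), add = (\<lambda>p q m r. frac (p m r + q m r)),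
     smult = (\<lambda>a p m r. if r \<in> carrier R then p m (a \<otimes>\<^bsub>R\<^esub> r) else 0)\<rparr>"

lemma character_module_simps:
  "p \<in> carrier (character_module R) \<longleftrightarrow> (\<forall>m r. 0 \<le> p m r \<and> p m r < 1) \<and> (\<forall>m r. r \<notin> carrier R \<longrightarrow> p m r = 0) \<and>
    (\<forall>m. \<forall>r\<in>carrier R. \<forall>s\<in>carrier R. p m (r \<oplus>\<^bsub>R\<^esub> s) = frac (p m r + p m s))"
  "\<zero>\<^bsub>character_module R\<^esub> = (\<lambda>_ _. 0)"
  "p \<oplus>\<^bsub>character_module R\<^esub> q = (\<lambda>m r. frac (p m r + q m r))"
  "a \<odot>\<^bsub>character_module R\<^esub> p = (\<lambda>m r. if r \<in> carrier R then p m (a \<otimes>\<^bsub>R\<^esub> r) else 0)"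
proof -
  show "p \<in> carrier (character_module R) \<longleftrightarrow> (\<forall>m r. 0 \<le> p m r \<and> p m r < 1) \<and> (\<forall>m r. r \<notin> carrier R \<longrightarrow> p m r = 0) \<and>
    (\<forall>m. \<forall>r\<in>carrier R. \<forall>s\<in>carrier R. p m (r \<oplus>\<^bsub>R\<^esub> s) = frac (p m r + p m s))"
    by (auto simp: character_module_def rat_characters_def) (metis order.refl zero_less_one)+
qed (simp_all add: character_module_def)

lemma right_module_character_module:
  assumes "ring R"
  shows "right_module R (character_module R)"
proof -
  interpret R: ring R by fact
  have ac: "frac (frac (x + y) + frac (z + w)) = frac (frac (x + z) + frac (y + w))" for x y z w :: rat
  proof -
    have "frac (frac (u + v) + frac (u' + v')) = frac (u + u' + (v + v'))" for u v u' v' :: rat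
      by (metis add.assoc add.left_commute frac_add_simps)
    from this[of x y z w] this[of x z y w] show ?thesis by (simp add: add_ac)
  qed
  have "abelian_group (character_module R)"
  proof (rule abelian_groupI)
    fix p :: "'i \<Rightarrow> 'a \<Rightarrow> rat" assume p: "p \<in> carrier (character_module R)"
    have "frac (- p m (r \<oplus>\<^bsub>R\<^esub> s)) = frac (frac (- p m r) + frac (- p m s))"
      if "r \<in> carrier R" "s \<in> carrier R" for m r s
    proof -
      have "p m (r \<oplus>\<^bsub>R\<^esub> s) = frac (p m r + p m s)" using p that by (simp add: character_module_simps)
      then have "frac (- p m (r \<oplus>\<^bsub>R\<^esub> s)) = frac (- p m r + - p m s)" by (simp add: frac_neg_frac)
      then show ?thesis by (metis frac_add_simps)
    qed
    then have "(\<lambda>m r. frac (- p m r)) \<in> carrier (character_module R)"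
      using p by (auto simp: character_module_simps frac_lt_1)
    moreover have "frac (frac (- p m r) + p m r) = 0" for m r
      by (metis add.left_inverse frac_add_simps(1) frac_of_int of_int_0)
    then have "(\<lambda>m r. frac (- p m r)) \<oplus>\<^bsub>character_module R\<^esub> p = \<zero>\<^bsub>character_module R\<^esub>"
      unfolding character_module_simps by blast
    ultimately show "\<exists>q\<in>carrier (character_module R). q \<oplus>\<^bsub>character_module R\<^esub> p = \<zero>\<^bsub>character_module R\<^esub>"
      by blast
    show "\<zero>\<^bsub>character_module R\<^esub> \<oplus>\<^bsub>character_module R\<^esub> p = p"
      using p by (intro ext) (simp add: character_module_simps frac_eq)
    fix q :: "'i \<Rightarrow> 'a \<Rightarrow> rat" assume q: "q \<in> carrier (character_module R)"
    show "p \<oplus>\<^bsub>character_module R\<^esub> q \<in> carrier (character_module R)"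
      using p q ac by (auto simp: character_module_simps frac_lt_1)
    show "p \<oplus>\<^bsub>character_module R\<^esub> q = q \<oplus>\<^bsub>character_module R\<^esub> p"
      by (simp add: character_module_simps add.commute)
  qed (auto simp: character_module_simps add.assoc)
  then show ?thesis
    using R.ring_axioms
    by (intro right_module.intro right_module_axioms.intro)
      (auto simp: character_module_simps R.l_distr R.r_distr R.m_assoc frac_eq intro!: ext)
qed

text \<open>
  A homomorphism \<open>B \<rightarrow> Hom\<^sub>\<int>(R, \<rat>/\<int>)\<close> is determined by the character obtained by evaluating its
  values at \<open>1\<close>, and every character of \<open>B\<close> arises in this way. So extending homomorphisms
  amounts to extending characters.
\<close>

lemma character_module_injective:
  fixes A :: "('a, 'x, 'c) module_scheme" and B :: "('a, 'y, 'd) module_scheme"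
    and f :: "'x \<Rightarrow> 'i \<Rightarrow> 'a \<Rightarrow> rat"
  assumes A: "right_module R A" and B: "right_module R B"
    and i: "i \<in> module_hom R A B" "inj_on i (carrier A)" and f: "f \<in> module_hom R A (character_module R)"
  obtains g where "g \<in> module_hom R B (character_module R)" "\<And>x. x \<in> carrier A \<Longrightarrow> g (i x) = f x"
proof -
  interpret A: right_module R A by fact
  interpret B: right_module R B by fact
  note iD = module_homD[OF i(1)] and fD = module_homD[OF f]
  have i': "i \<in> hom (add_monoid A) (add_monoid B)" using iD by (auto simp: hom_def)
  have fadd: "f (x \<oplus>\<^bsub>A\<^esub> y) m r = frac (f x m r + f y m r)" if "x \<in> carrier A" "y \<in> carrier A" for x y m r
    using fD(2)[OF that] by (simp add: character_module_simps)
  have fsmult: "f (a \<odot>\<^bsub>A\<^esub> x) m r = f x m (a \<otimes>\<^bsub>R\<^esub> r)" if "a \<in> carrier R" "x \<in> carrier A" "r \<in> carrier R" for a x m r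
    using fD(3)[OF that(1,2)] that(3) by (simp add: character_module_simps)
  have frange: "0 \<le> f x m r" "f x m r < 1" "r \<notin> carrier R \<Longrightarrow> f x m r = 0" if "x \<in> carrier A" for x m r
    using fD(1)[OF that] by (simp_all add: character_module_simps)
  have "\<exists>\<chi>\<in>rat_characters (add_monoid B). \<forall>x\<in>carrier A. \<chi> (i x) = f x m \<one>\<^bsub>R\<^esub>" for m
  proof -
    have "(\<lambda>x. f x m \<one>\<^bsub>R\<^esub>) \<in> rat_characters (add_monoid A)"
      using fadd frange by (simp add: rat_characters_def)
    then obtain \<chi> where "\<chi> \<in> rat_characters (add_monoid B)"
      "\<And>x. x \<in> carrier (add_monoid A) \<Longrightarrow> \<chi> (i x) = f x m \<one>\<^bsub>R\<^esub>"
      using rat_character_extends[OF A.M.a_comm_group B.M.a_comm_group i' _ _] i(2) by (metis (no_types, lifting) partial_object.select_convs(1))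
    then show ?thesis by auto
  qed
  then obtain \<chi> where \<chi>: "\<And>m. \<chi> m \<in> rat_characters (add_monoid B)"
    "\<And>m x. x \<in> carrier A \<Longrightarrow> \<chi> m (i x) = f x m \<one>\<^bsub>R\<^esub>" by metis
  then have \<chi>D: "0 \<le> \<chi> m x" "\<chi> m x < 1" "y \<in> carrier B \<Longrightarrow> \<chi> m (x \<oplus>\<^bsub>B\<^esub> y) = frac (\<chi> m x + \<chi> m y)"
    if "x \<in> carrier B" for m x y
    using that \<chi>(1)[of m] by (auto simp: rat_characters_def)
  define g where "g b = (\<lambda>m r. if r \<in> carrier R then \<chi> m (r \<odot>\<^bsub>B\<^esub> b) else 0)" for b
  have "g \<in> module_hom R B (character_module R)"
  proof (rule module_homI)
    show "g b \<in> carrier (character_module R)" if "b \<in> carrier B" for b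
      using that \<chi>D B.smult_closed by (auto simp: g_def character_module_simps B.smult_l_distr)
    show "g (b \<oplus>\<^bsub>B\<^esub> c) = g b \<oplus>\<^bsub>character_module R\<^esub> g c" if "b \<in> carrier B" "c \<in> carrier B" for b c
      using that \<chi>D(3) B.smult_closed by (auto simp: g_def character_module_simps B.smult_r_distr intro!: ext)
    show "g (a \<odot>\<^bsub>B\<^esub> b) = a \<odot>\<^bsub>character_module R\<^esub> g b" if "a \<in> carrier R" "b \<in> carrier B" for a b
      using that by (auto simp: g_def character_module_simps B.smult_assoc intro!: ext)
  qed
  moreover have "g (i x) = f x" if "x \<in> carrier A" for x
  proof (intro ext)
    fix m r show "g (i x) m r = f x m r"
    proof (cases "r \<in> carrier R")
      case True
      then have "g (i x) m r = \<chi> m (i (r \<odot>\<^bsub>A\<^esub> x))" using iD that by (simp add: g_def)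
      then show ?thesis using True that \<chi>(2) A.smult_closed fsmult by simp
    qed (use that frange in \<open>simp add: g_def\<close>)
  qed
  ultimately show thesis using that by blast
qed

text \<open>
  The coordinate of index \<open>m \<noteq> 0\<close> comes from a character of \<open>M\<close> that does not vanish at \<open>m\<close>.
\<close>

lemma character_module_embeds:
  fixes M :: "('a, 'm, 'c) module_scheme"
  assumes "right_module R M"
  obtains j :: "'m \<Rightarrow> 'm \<Rightarrow> 'a \<Rightarrow> rat"
    where "j \<in> module_hom R M (character_module R)" "inj_on j (carrier M)"
proof -
  interpret M: right_module R M by fact
  have "\<exists>\<chi>\<in>rat_characters (add_monoid M). m \<in> carrier M \<longrightarrow> m \<noteq> \<zero>\<^bsub>M\<^esub> \<longrightarrow> \<chi> m \<noteq> 0" for m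
  proof (cases "m \<in> carrier M \<and> m \<noteq> \<zero>\<^bsub>M\<^esub>")
    case True
    then show ?thesis using comm_group.rat_characters_separate[OF M.M.a_comm_group, of m] by auto
  next
    case False
    have "(\<lambda>_. 0) \<in> rat_characters (add_monoid M)" by (simp add: rat_characters_def)
    then show ?thesis using False by blast
  qed
  then obtain \<chi> where \<chi>: "\<And>m. \<chi> m \<in> rat_characters (add_monoid M)"
    "\<And>m. \<lbrakk>m \<in> carrier M; m \<noteq> \<zero>\<^bsub>M\<^esub>\<rbrakk> \<Longrightarrow> \<chi> m m \<noteq> 0" by metis
  then have \<chi>D: "0 \<le> \<chi> m x" "\<chi> m x < 1" "y \<in> carrier M \<Longrightarrow> \<chi> m (x \<oplus>\<^bsub>M\<^esub> y) = frac (\<chi> m x + \<chi> m y)"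
    if "x \<in> carrier M" for m x y
    using that \<chi>(1)[of m] by (auto simp: rat_characters_def)
  define j where "j b = (\<lambda>m r. if r \<in> carrier R then \<chi> m (r \<odot>\<^bsub>M\<^esub> b) else 0)" for b
  have j: "j \<in> module_hom R M (character_module R)"
  proof (rule module_homI)
    show "j b \<in> carrier (character_module R)" if "b \<in> carrier M" for b
      using that \<chi>D M.smult_closed by (auto simp: j_def character_module_simps M.smult_l_distr)
    show "j (b \<oplus>\<^bsub>M\<^esub> c) = j b \<oplus>\<^bsub>character_module R\<^esub> j c" if "b \<in> carrier M" "c \<in> carrier M" for b c
      using that \<chi>D(3) M.smult_closed by (auto simp: j_def character_module_simps M.smult_r_distr intro!: ext)
    show "j (a \<odot>\<^bsub>M\<^esub> b) = a \<odot>\<^bsub>character_module R\<^esub> j b" if "a \<in> carrier R" "b \<in> carrier M" for a b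
      using that by (auto simp: j_def character_module_simps M.smult_assoc intro!: ext)
  qed
  moreover have "inj_on j (carrier M)"
  proof (rule module_hom_inj_onI[OF assms right_module_character_module[OF M.R.ring_axioms] j])
    fix x assume x: "x \<in> carrier M" "j x = \<zero>\<^bsub>character_module R\<^esub>"
    have "j x x \<one>\<^bsub>R\<^esub> = \<chi> x x" using x(1) by (simp add: j_def M.smult_one)
    then show "x = \<zero>\<^bsub>M\<^esub>" using x \<chi>(2)[of x] by (auto simp: character_module_simps)
  qed
  ultimately show thesis using that by blast
qed

lemma submodule_image:
  assumes M: "right_module R M" and N: "right_module R N" and f: "f \<in> module_hom R M N"
  shows "submodule (f ` carrier M) R N"
proof -
  interpret M: right_module R M by fact
  interpret N: right_module R N by fact
  note fD = module_homD[OF f]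
  show ?thesis
  proof (rule N.submoduleI)
    show "f ` carrier M \<subseteq> carrier N" using fD(1) by auto
    show "\<zero>\<^bsub>N\<^esub> \<in> f ` carrier M" using module_hom_zero[OF M N f] by (metis M.M.zero_closed imageI)
    show "x \<oplus>\<^bsub>N\<^esub> y \<in> f ` carrier M" if "x \<in> f ` carrier M" "y \<in> f ` carrier M" for x y
      using that by (auto simp flip: fD(2))
    show "a \<odot>\<^bsub>N\<^esub> x \<in> f ` carrier M" if "a \<in> carrier R" "x \<in> f ` carrier M" for a x
      using that by (auto simp: M.smult_closed simp flip: fD(3))
  qed
qed

context right_module
begin

definition essential_over :: "'c set \<Rightarrow> 'c set \<Rightarrow> bool" where
  "essential_over N E \<longleftrightarrow>
    (\<forall>x\<in>E. x \<noteq> \<zero>\<^bsub>M\<^esub> \<longrightarrow> (\<exists>a\<in>carrier R. a \<odot>\<^bsub>M\<^esub> x \<in> N \<and> a \<odot>\<^bsub>M\<^esub> x \<noteq> \<zero>\<^bsub>M\<^esub>))"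

lemma exists_maximal_essential_extension:
  assumes N: "submodule N R M"
  obtains E where "submodule E R M" "N \<subseteq> E" "essential_over N E"
    "\<And>E'. \<lbrakk>submodule E' R M; E \<subseteq> E'; essential_over N E'\<rbrakk> \<Longrightarrow> E' = E"
proof -
  let ?A = "{E. submodule E R M \<and> N \<subseteq> E \<and> essential_over N E}"
  have "\<exists>E\<in>?A. \<forall>X\<in>?A. E \<subseteq> X \<longrightarrow> X = E"
  proof (rule subset_Zorn_nonempty)
    have "essential_over N N"
      unfolding essential_over_def
      using submoduleD(1)[OF N] smult_one by (auto intro!: bexI[of _ "\<one>\<^bsub>R\<^esub>"])
    then show "?A \<noteq> {}" using N by auto
    fix \<C> assume ne: "\<C> \<noteq> {}" and ch: "subset.chain ?A \<C>"
    have mem: "X \<in> ?A" if "X \<in> \<C>" for X using ch that by (auto simp: subset_chain_def)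
    have "submodule (\<Union>\<C>) R M" by (rule submodule_Union_chain[OF ne ch])
    moreover have "N \<subseteq> \<Union>\<C>" using ne mem by auto
    moreover have "essential_over N (\<Union>\<C>)" using mem by (auto simp: essential_over_def)
    ultimately show "\<Union>\<C> \<in> ?A" by auto
  qed
  then obtain E where EA: "E \<in> ?A" and mA: "\<forall>X\<in>?A. E \<subseteq> X \<longrightarrow> X = E" by (rule bexE)
  show thesis
  proof (rule that)
    show "submodule E R M" "N \<subseteq> E" "essential_over N E" using EA by auto
    fix E' assume E': "submodule E' R M" "E \<subseteq> E'" "essential_over N E'"
    then have "E' \<in> ?A" using EA by auto
    from bspec[OF mA this] E'(2) show "E' = E" by (rule mp)
  qed
qed

end

text \<open>
  Let \<open>K\<close> be a complement of a maximal essential extension \<open>E\<close> of \<open>N\<close> inside the injective module \<open>P\<close>, and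
  extend the projection \<open>E + K \<rightarrow> E\<close> to \<open>g : P \<rightarrow> P\<close>. The image of \<open>g\<close> is essential over \<open>E\<close>: if \<open>g p \<noteq> 0\<close>,
  then \<open>p \<notin> K\<close>, so \<open>k + p a\<close> is a nonzero element of \<open>E\<close> for some \<open>k \<in> K\<close> and \<open>a \<in> R\<close> by the choice of
  \<open>K\<close>, and it equals \<open>(g p) a\<close>. By maximality the image is \<open>E\<close>.
\<close>

lemma maximal_essential_extension_retract:
  fixes R :: "('a, 'b) ring_scheme" and P :: "('a, 'i \<Rightarrow> 'a \<Rightarrow> rat) module"
  defines "P \<equiv> character_module R"
  assumes R: "ring R" and N: "submodule N R P"
  obtains E g where "submodule E R P" "N \<subseteq> E" "right_module.essential_over R P N E"
    "g \<in> module_hom R P (P\<lparr>carrier := E\<rparr>)" "\<And>x. x \<in> E \<Longrightarrow> g x = x"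
proof -
  have P: "right_module R P" unfolding P_def by (rule right_module_character_module[OF R])
  interpret P: right_module R P by fact
  obtain E where E: "submodule E R P" "N \<subseteq> E" "P.essential_over N E"
    and max: "\<And>E'. \<lbrakk>submodule E' R P; E \<subseteq> E'; P.essential_over N E'\<rbrakk> \<Longrightarrow> E' = E"
    using P.exists_maximal_essential_extension[OF N] by blast
  note ED = P.submoduleD[OF E(1)]
  have "submodule {\<zero>\<^bsub>P\<^esub>} R P" by (rule P.submoduleI) (auto simp: P.smult_zero_right)
  moreover have "{\<zero>\<^bsub>P\<^esub>} \<inter> E \<subseteq> {\<zero>\<^bsub>P\<^esub>}" by auto
  ultimately obtain K where K: "submodule K R P" "K \<inter> E \<subseteq> {\<zero>\<^bsub>P\<^esub>}"
    and Kmax: "\<And>x. \<lbrakk>x \<in> carrier P; x \<notin> K\<rbrakk> \<Longrightarrow>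
      \<exists>k\<in>K. \<exists>a\<in>carrier R. k \<oplus>\<^bsub>P\<^esub> a \<odot>\<^bsub>P\<^esub> x \<in> E \<and> k \<oplus>\<^bsub>P\<^esub> a \<odot>\<^bsub>P\<^esub> x \<noteq> \<zero>\<^bsub>P\<^esub>"
    by (rule P.exists_complement[OF E(1)]) (rule that)
  note KD = P.submoduleD[OF K(1)]
  have car [simp]: "e \<in> carrier P" if "e \<in> E" for e using ED(1) that by auto
  have car' [simp]: "k \<in> carrier P" if "k \<in> K" for k using KD(1) that by auto
  have swap: "(a \<oplus>\<^bsub>P\<^esub> b) \<oplus>\<^bsub>P\<^esub> (c \<oplus>\<^bsub>P\<^esub> d) = (a \<oplus>\<^bsub>P\<^esub> c) \<oplus>\<^bsub>P\<^esub> (b \<oplus>\<^bsub>P\<^esub> d)"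
    if "a \<in> carrier P" "b \<in> carrier P" "c \<in> carrier P" "d \<in> carrier P" for a b c d
    using that by (simp add: P.M.a_ac)
  have unique: "e = e'" if "e \<in> E" "e' \<in> E" "k \<in> K" "k' \<in> K" "e \<oplus>\<^bsub>P\<^esub> k = e' \<oplus>\<^bsub>P\<^esub> k'" for e e' k k'
  proof -
    have "e \<ominus>\<^bsub>P\<^esub> e' = (e \<oplus>\<^bsub>P\<^esub> k) \<oplus>\<^bsub>P\<^esub> (\<ominus>\<^bsub>P\<^esub> e' \<oplus>\<^bsub>P\<^esub> \<ominus>\<^bsub>P\<^esub> k)"
      using that(1-4) swap[of e k "\<ominus>\<^bsub>P\<^esub> e'" "\<ominus>\<^bsub>P\<^esub> k"] by (simp add: a_minus_def P.M.r_neg)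
    also have "\<dots> = (e' \<oplus>\<^bsub>P\<^esub> k') \<oplus>\<^bsub>P\<^esub> (\<ominus>\<^bsub>P\<^esub> e' \<oplus>\<^bsub>P\<^esub> \<ominus>\<^bsub>P\<^esub> k)"
      by (simp only: that(5))
    also have "\<dots> = k' \<ominus>\<^bsub>P\<^esub> k"
      using that(1-4) swap[of e' k' "\<ominus>\<^bsub>P\<^esub> e'" "\<ominus>\<^bsub>P\<^esub> k"] by (simp add: a_minus_def P.M.r_neg)
    finally have "e \<ominus>\<^bsub>P\<^esub> e' = \<zero>\<^bsub>P\<^esub>" using K(2) ED(6)[OF that(1,2)] KD(6)[OF that(4,3)] by auto
    then show ?thesis
      using P.M.minus_equality[of e "\<ominus>\<^bsub>P\<^esub> e'"] that by (simp add: a_minus_def)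
  qed
  define S where "S = {e \<oplus>\<^bsub>P\<^esub> k | e k. e \<in> E \<and> k \<in> K}"
  define h where "h x = (THE e. e \<in> E \<and> (\<exists>k\<in>K. x = e \<oplus>\<^bsub>P\<^esub> k))" for x
  have h: "h (e \<oplus>\<^bsub>P\<^esub> k) = e" if "e \<in> E" "k \<in> K" for e k
    unfolding h_def using that unique by (intro the_equality) blast+
  have add: "(e \<oplus>\<^bsub>P\<^esub> k) \<oplus>\<^bsub>P\<^esub> (e' \<oplus>\<^bsub>P\<^esub> k') = (e \<oplus>\<^bsub>P\<^esub> e') \<oplus>\<^bsub>P\<^esub> (k \<oplus>\<^bsub>P\<^esub> k')"
    if "e \<in> E" "e' \<in> E" "k \<in> K" "k' \<in> K" for e e' k k'
    using that swap by simp
  have smult: "a \<odot>\<^bsub>P\<^esub> (e \<oplus>\<^bsub>P\<^esub> k) = a \<odot>\<^bsub>P\<^esub> e \<oplus>\<^bsub>P\<^esub> a \<odot>\<^bsub>P\<^esub> k" if "a \<in> carrier R" "e \<in> E" "k \<in> K" for a e k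
    using that by (simp add: P.smult_r_distr)
  have SI: "e \<oplus>\<^bsub>P\<^esub> k \<in> S" if "e \<in> E" "k \<in> K" for e k using that by (auto simp: S_def)
  have S: "submodule S R P"
  proof (rule P.submoduleI)
    show "S \<subseteq> carrier P" by (auto simp: S_def)
    show "\<zero>\<^bsub>P\<^esub> \<in> S" using SI[OF ED(2) KD(2)] by simp
    show "x \<oplus>\<^bsub>P\<^esub> y \<in> S" if "x \<in> S" "y \<in> S" for x y
      using that SI ED(3) KD(3) by (auto simp: S_def add)
    show "a \<odot>\<^bsub>P\<^esub> x \<in> S" if "a \<in> carrier R" "x \<in> S" for a x
      using that SI ED(4) KD(4) by (auto simp: S_def smult)
  qed
  have "h \<in> module_hom R (P\<lparr>carrier := S\<rparr>) P"
  proof (rule module_homI)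
    show "h x \<in> carrier P" if "x \<in> carrier (P\<lparr>carrier := S\<rparr>)" for x
      using that h by (auto simp: S_def)
    show "h (x \<oplus>\<^bsub>P\<lparr>carrier := S\<rparr>\<^esub> y) = h x \<oplus>\<^bsub>P\<^esub> h y"
      if "x \<in> carrier (P\<lparr>carrier := S\<rparr>)" "y \<in> carrier (P\<lparr>carrier := S\<rparr>)" for x y
      using that h ED(3) KD(3) by (auto simp: S_def add)
    show "h (a \<odot>\<^bsub>P\<lparr>carrier := S\<rparr>\<^esub> x) = a \<odot>\<^bsub>P\<^esub> h x"
      if "a \<in> carrier R" "x \<in> carrier (P\<lparr>carrier := S\<rparr>)" for a x
      using that h ED(4) KD(4) by (auto simp: S_def smult)
  qed
  moreover have "id \<in> module_hom R (P\<lparr>carrier := S\<rparr>) P"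
    using P.submoduleD(1)[OF S] by (auto simp: module_hom_def)
  ultimately obtain g where g: "g \<in> module_hom R P P"
    "\<And>x. x \<in> carrier (P\<lparr>carrier := S\<rparr>) \<Longrightarrow> g (id x) = h x"
    using character_module_injective[of R "P\<lparr>carrier := S\<rparr>" P id h]
      P.right_module_submodule[OF S] P by (auto simp: P_def)
  note gD = module_homD[OF g(1)]
  have gE: "g e = e" if "e \<in> E" for e
    using g(2)[of e] SI[OF that KD(2)] h[OF that KD(2)] that by simp
  have gK: "g k = \<zero>\<^bsub>P\<^esub>" if "k \<in> K" for k
    using g(2)[of k] SI[OF ED(2) that] h[OF ED(2) that] that by simp
  have "P.essential_over N (g ` carrier P)"
    unfolding P.essential_over_def
  proof (intro ballI impI)
    fix y assume "y \<in> g ` carrier P" and y0: "y \<noteq> \<zero>\<^bsub>P\<^esub>"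
    then obtain p where p: "p \<in> carrier P" "y = g p" by auto
    then have "p \<notin> K" using gK y0 by auto
    then obtain k a where ka: "k \<in> K" "a \<in> carrier R" "k \<oplus>\<^bsub>P\<^esub> a \<odot>\<^bsub>P\<^esub> p \<in> E" "k \<oplus>\<^bsub>P\<^esub> a \<odot>\<^bsub>P\<^esub> p \<noteq> \<zero>\<^bsub>P\<^esub>"
      using Kmax p by blast
    have "a \<odot>\<^bsub>P\<^esub> y = g (k \<oplus>\<^bsub>P\<^esub> a \<odot>\<^bsub>P\<^esub> p)"
      using ka(1,2) p gD gK P.smult_closed by simp
    then have ay: "a \<odot>\<^bsub>P\<^esub> y \<in> E" "a \<odot>\<^bsub>P\<^esub> y \<noteq> \<zero>\<^bsub>P\<^esub>" using gE ka(3,4) by auto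
    then obtain b where "b \<in> carrier R" "b \<odot>\<^bsub>P\<^esub> (a \<odot>\<^bsub>P\<^esub> y) \<in> N" "b \<odot>\<^bsub>P\<^esub> (a \<odot>\<^bsub>P\<^esub> y) \<noteq> \<zero>\<^bsub>P\<^esub>"
      using E(3) by (auto simp: P.essential_over_def)
    then show "\<exists>a\<in>carrier R. a \<odot>\<^bsub>P\<^esub> y \<in> N \<and> a \<odot>\<^bsub>P\<^esub> y \<noteq> \<zero>\<^bsub>P\<^esub>"
      using ka(2) p gD(1) by (intro bexI[of _ "a \<otimes>\<^bsub>R\<^esub> b"]) (auto simp: P.smult_assoc)
  qed
  moreover have "E \<subseteq> g ` carrier P"
    using gE car by (metis image_eqI subsetI)
  ultimately have "g ` carrier P = E" using max[OF submodule_image[OF P P g(1)]] by simp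
  then have "g \<in> module_hom R P (P\<lparr>carrier := E\<rparr>)"
    using gD by (intro module_homI) auto
  then show thesis using that[OF E] gE by simp
qed

text \<open>
  A retract of an injective module is injective. The second property is injectivity of \<open>E\<close> with
  respect to the inclusions of its own submodules; these are modules on the type of \<open>E\<close>, whereas the
  definition of \<open>injective_module\<close> speaks of modules on a sum type.
\<close>

lemma exists_injective_envelope:
  fixes M :: "('a, 'm, 'c) module_scheme"
  assumes M: "right_module R M"
  obtains E :: "('a, 'm \<Rightarrow> 'a \<Rightarrow> rat) module" and \<iota>
  where "injective_envelope R M E \<iota>"
    "\<And>N f. \<lbrakk>submodule N R E; f \<in> module_hom R (E\<lparr>carrier := N\<rparr>) E\<rbrakk> \<Longrightarrow>
      \<exists>g\<in>module_hom R E E. \<forall>x\<in>N. g x = f x"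
proof -
  interpret M: right_module R M by fact
  define P where "P = (character_module R :: ('a, 'm \<Rightarrow> 'a \<Rightarrow> rat) module)"
  have P: "right_module R P" unfolding P_def by (rule right_module_character_module[OF M.R.ring_axioms])
  interpret P: right_module R P by fact
  obtain \<iota> where \<iota>: "\<iota> \<in> module_hom R M P" "inj_on \<iota> (carrier M)"
    using character_module_embeds[OF M] unfolding P_def by blast
  obtain E0 r where E0: "submodule E0 R P" "\<iota> ` carrier M \<subseteq> E0" "P.essential_over (\<iota> ` carrier M) E0"
    and r: "r \<in> module_hom R P (P\<lparr>carrier := E0\<rparr>)" "\<And>x. x \<in> E0 \<Longrightarrow> r x = x"
    using maximal_essential_extension_retract[OF M.R.ring_axioms submodule_image[OF M P \<iota>(1), unfolded P_def]]
    unfolding P_def by blast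
  define E where "E = P\<lparr>carrier := E0\<rparr>"
  have E: "right_module R E" unfolding E_def by (rule P.right_module_submodule[OF E0(1)])
  interpret E: right_module R E by fact
  have incl: "f \<in> module_hom R A P" if "f \<in> module_hom R A E" for f and A :: "('a, 'x, 'd) module_scheme"
    using that P.submoduleD(1)[OF E0(1)] by (auto simp: module_hom_def E_def)
  have retr: "r \<circ> f \<in> module_hom R A E" if "f \<in> module_hom R A P" for f and A :: "('a, 'x, 'd) module_scheme"
    using module_homD[OF that] module_homD[OF r(1)] by (intro module_homI) (auto simp: E_def)
  have ext1: "\<exists>g\<in>module_hom R B E. \<forall>x\<in>carrier A. g (i x) = f x"
    if A: "right_module R A" "right_module R B" "i \<in> module_hom R A B" "inj_on i (carrier A)"
      and f: "f \<in> module_hom R A E"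
    for A B :: "('a, 'a + ('m \<Rightarrow> 'a \<Rightarrow> rat)) module" and i f
  proof -
    obtain g where "g \<in> module_hom R B P" "\<And>x. x \<in> carrier A \<Longrightarrow> g (i x) = f x"
      using character_module_injective[OF A incl[OF f, unfolded P_def]] unfolding P_def by blast
    then show ?thesis
      using module_homD(1)[OF f] r(2) by (intro bexI[of _ "r \<circ> g"] retr) (auto simp: E_def)
  qed
  have ext2: "\<exists>g\<in>module_hom R E E. \<forall>x\<in>N. g x = f x"
    if N: "submodule N R E" and f: "f \<in> module_hom R (E\<lparr>carrier := N\<rparr>) E" for N f
  proof -
    have id: "id \<in> module_hom R (E\<lparr>carrier := N\<rparr>) E"
      using E.submoduleD(1)[OF N] by (auto simp: module_hom_def)
    obtain g where "g \<in> module_hom R E P" "\<And>x. x \<in> carrier (E\<lparr>carrier := N\<rparr>) \<Longrightarrow> g (id x) = f x"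
      using character_module_injective[OF E.right_module_submodule[OF N] E id _ incl[OF f, unfolded P_def]]
      unfolding P_def by auto
    then show ?thesis
      using module_homD(1)[OF f] r(2) by (intro bexI[of _ "r \<circ> g"] retr) (auto simp: E_def)
  qed
  have "essential_submodule R (\<iota> ` carrier M) E"
    unfolding essential_submodule_iff[OF E]
  proof (intro conjI)
    note N = P.submoduleD[OF submodule_image[OF M P \<iota>(1)]]
    show "submodule (\<iota> ` carrier M) R E"
      using N(2-4) E0(2) by (intro E.submoduleI) (auto simp: E_def)
    show "\<forall>x\<in>carrier E. x \<noteq> \<zero>\<^bsub>E\<^esub> \<longrightarrow>
      (\<exists>a\<in>carrier R. a \<odot>\<^bsub>E\<^esub> x \<in> \<iota> ` carrier M \<and> a \<odot>\<^bsub>E\<^esub> x \<noteq> \<zero>\<^bsub>E\<^esub>)"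
      using E0(3) by (auto simp: E_def P.essential_over_def)
  qed
  moreover have "\<iota> \<in> module_hom R M E"
    using module_homD[OF \<iota>(1)] E0(2) by (intro module_homI) (auto simp: E_def)
  moreover have "injective_module R E" unfolding injective_module_def using E ext1 by blast
  ultimately have "injective_envelope R M E \<iota>"
    using \<iota>(2) by (simp add: injective_envelope_def)
  then show thesis using that ext2 by blast
qed

section \<open>Partial isomorphisms of a right a-ring\<close>

text \<open>
  An isomorphism between two essential right ideals of \<open>R\<close>, given by its graph. Graphs are easier
  to write down than functions when the domain is an internal direct sum.
\<close>

definition essential_partial_iso :: "('a, 'b) ring_scheme \<Rightarrow> ('a \<times> 'a) set \<Rightarrow> bool" where
  "essential_partial_iso R F \<longleftrightarrow>
    (\<forall>x y x' y'. (x, y) \<in> F \<longrightarrow> (x', y') \<in> F \<longrightarrow> (x \<oplus>\<^bsub>R\<^esub> x', y \<oplus>\<^bsub>R\<^esub> y') \<in> F) \<and>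
    (\<forall>x y a. (x, y) \<in> F \<longrightarrow> a \<in> carrier R \<longrightarrow> (x \<otimes>\<^bsub>R\<^esub> a, y \<otimes>\<^bsub>R\<^esub> a) \<in> F) \<and>
    (\<forall>x y. (x, y) \<in> F \<longrightarrow> (x = \<zero>\<^bsub>R\<^esub> \<longleftrightarrow> y = \<zero>\<^bsub>R\<^esub>)) \<and>
    essential_right_ideal R (Domain F) \<and> essential_right_ideal R (Range F)"

lemma essential_partial_isoD:
  assumes "essential_partial_iso R F"
  shows "\<And>x y x' y'. \<lbrakk>(x, y) \<in> F; (x', y') \<in> F\<rbrakk> \<Longrightarrow> (x \<oplus>\<^bsub>R\<^esub> x', y \<oplus>\<^bsub>R\<^esub> y') \<in> F"
    "\<And>x y a. \<lbrakk>(x, y) \<in> F; a \<in> carrier R\<rbrakk> \<Longrightarrow> (x \<otimes>\<^bsub>R\<^esub> a, y \<otimes>\<^bsub>R\<^esub> a) \<in> F"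
    "\<And>x y. (x, y) \<in> F \<Longrightarrow> x = \<zero>\<^bsub>R\<^esub> \<longleftrightarrow> y = \<zero>\<^bsub>R\<^esub>"
    "essential_right_ideal R (Domain F)" "essential_right_ideal R (Range F)"
  using assms unfolding essential_partial_iso_def by blast+

text \<open>
  The isomorphism extends to an automorphism of the injective envelope \<open>E\<close> of \<open>R\<close>, and \<open>E\<close> is also
  an injective envelope of every essential right ideal. So the automorphism maps \<open>R\<close> to \<open>R\<close>, which
  makes it left multiplication by the image \<open>c\<close> of \<open>1\<close>, and maps each essential right ideal to itself.
\<close>

lemma (in ring) right_a_ring_partial_iso:
  assumes a: "right_a_ring R" and F: "essential_partial_iso R F"
  obtains c where "c \<in> carrier R" "\<And>x y. (x, y) \<in> F \<Longrightarrow> c \<otimes> x = y"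
    "\<And>L x. \<lbrakk>essential_right_ideal R L; x \<in> L\<rbrakk> \<Longrightarrow> c \<otimes> x \<in> L"
proof -
  note FD = essential_partial_isoD[OF F]
  define M where "M = right_ideal_module R (carrier R)"
  have M: "right_module R M"
    unfolding M_def by (rule right_module_right_ideal_module[OF right_ideal_carrier])
  obtain E :: "('a, 'a \<Rightarrow> 'a \<Rightarrow> rat) module" and \<iota> where env: "injective_envelope R M E \<iota>"
    and ext: "\<And>N f. \<lbrakk>submodule N R E; f \<in> module_hom R (E\<lparr>carrier := N\<rparr>) E\<rbrakk> \<Longrightarrow>
      \<exists>g\<in>module_hom R E E. \<forall>x\<in>N. g x = f x"
    by (rule exists_injective_envelope[OF M]) (rule that)
  have E: "right_module R E" and inj: "injective_module R E"
    and \<iota>: "\<iota> \<in> module_hom R M E" and \<iota>inj: "inj_on \<iota> (carrier R)"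
    using env by (auto simp: injective_envelope_def injective_module_def M_def)
  interpret E: right_module R E by fact
  have \<iota>D: "\<iota> x \<in> carrier E" "y \<in> carrier R \<Longrightarrow> \<iota> (x \<oplus> y) = \<iota> x \<oplus>\<^bsub>E\<^esub> \<iota> y"
    "y \<in> carrier R \<Longrightarrow> \<iota> (x \<otimes> y) = y \<odot>\<^bsub>E\<^esub> \<iota> x" if "x \<in> carrier R" for x y
    using module_homD[OF \<iota>] that by (auto simp: M_def)
  have \<iota>0: "\<iota> x = \<zero>\<^bsub>E\<^esub> \<longleftrightarrow> x = \<zero>" if "x \<in> carrier R" for x
    using module_hom_zero[OF M E \<iota>] inj_onD[OF \<iota>inj _ that zero_closed] by (auto simp: M_def)
  have ess: "\<exists>a\<in>carrier R. \<exists>x\<in>L. a \<odot>\<^bsub>E\<^esub> e = \<iota> x \<and> x \<noteq> \<zero>"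
    if L: "essential_right_ideal R L" and e: "e \<in> carrier E" "e \<noteq> \<zero>\<^bsub>E\<^esub>" for L e
  proof -
    obtain a where a: "a \<in> carrier R" "a \<odot>\<^bsub>E\<^esub> e \<in> \<iota> ` carrier R" "a \<odot>\<^bsub>E\<^esub> e \<noteq> \<zero>\<^bsub>E\<^esub>"
      using env e by (auto simp: injective_envelope_def essential_submodule_iff[OF E] M_def)
    then obtain x where x: "x \<in> carrier R" "a \<odot>\<^bsub>E\<^esub> e = \<iota> x" "x \<noteq> \<zero>" using \<iota>0 by auto
    then obtain b where b: "b \<in> carrier R" "x \<otimes> b \<in> L" "x \<otimes> b \<noteq> \<zero>"
      using L by (meson essential_right_ideal_def)
    have "(a \<otimes> b) \<odot>\<^bsub>E\<^esub> e = \<iota> (x \<otimes> b)"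
      using a(1) b(1) x(1,2) e(1) \<iota>D(3) by (simp add: E.smult_assoc)
    then show ?thesis using a(1) b by blast
  qed
  have sub: "submodule (\<iota> ` L) R E" if "right_ideal L R" for L
  proof -
    have "\<iota> \<in> module_hom R (right_ideal_module R L) E"
      using right_idealD[OF that] \<iota>D by (intro module_homI) (auto simp: subset_iff)
    from submodule_image[OF right_module_right_ideal_module[OF that] E this] show ?thesis by simp
  qed
  have Dom: "right_ideal (Domain F) R" and Ran: "right_ideal (Range F) R"
    using FD(4,5) by (auto simp: essential_right_ideal_def)
  have Fcar: "x \<in> carrier R" "y \<in> carrier R" if "(x, y) \<in> F" for x y
    using right_idealD(1)[OF Dom] right_idealD(1)[OF Ran] that by auto
  have single: "y = y'" if "(x, y) \<in> F" "(x, y') \<in> F" for x y y'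
  proof -
    have "(x \<oplus> x \<otimes> \<ominus> \<one>, y \<oplus> y' \<otimes> \<ominus> \<one>) \<in> F" using FD(1)[OF that(1) FD(2)[OF that(2)]] by simp
    then have "y \<oplus> \<ominus> y' = \<zero>"
      using FD(3) Fcar[OF that(1)] Fcar[OF that(2)] by (fastforce simp: r_minus r_neg)
    then show ?thesis using minus_equality[of y "\<ominus> y'"] Fcar[OF that(1)] Fcar[OF that(2)] by simp
  qed
  define f where "f e = \<iota> (THE y. \<exists>x. (x, y) \<in> F \<and> \<iota> x = e)" for e
  have f: "f (\<iota> x) = \<iota> y" if "(x, y) \<in> F" for x y
  proof -
    have "(THE z. \<exists>w. (w, z) \<in> F \<and> \<iota> w = \<iota> x) = y"
      using that single Fcar inj_onD[OF \<iota>inj] by (intro the_equality) (blast, metis)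
    then show ?thesis by (simp add: f_def)
  qed
  have "f \<in> module_hom R (E\<lparr>carrier := \<iota> ` Domain F\<rparr>) E"
  proof (rule module_homI)
    fix u assume u: "u \<in> carrier (E\<lparr>carrier := \<iota> ` Domain F\<rparr>)"
    then obtain x y where xy: "u = \<iota> x" "(x, y) \<in> F" by auto
    show "f u \<in> carrier E" using xy f \<iota>D(1) Fcar by simp
    show "f (a \<odot>\<^bsub>E\<lparr>carrier := \<iota> ` Domain F\<rparr>\<^esub> u) = a \<odot>\<^bsub>E\<^esub> f u" if "a \<in> carrier R" for a
      using f[OF FD(2)[OF xy(2) that]] f[OF xy(2)] xy(1) that Fcar[OF xy(2)] by (simp add: \<iota>D(3))
    fix v assume "v \<in> carrier (E\<lparr>carrier := \<iota> ` Domain F\<rparr>)"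
    then obtain x' y' where xy': "v = \<iota> x'" "(x', y') \<in> F" by auto
    show "f (u \<oplus>\<^bsub>E\<lparr>carrier := \<iota> ` Domain F\<rparr>\<^esub> v) = f u \<oplus>\<^bsub>E\<^esub> f v"
      using f[OF FD(1)[OF xy(2) xy'(2)]] f[OF xy(2)] f[OF xy'(2)] xy(1) xy'(1)
        Fcar[OF xy(2)] Fcar[OF xy'(2)] by (simp add: \<iota>D(2))
  qed
  from ext[OF sub[OF Dom] this]
  obtain g where g: "g \<in> module_hom R E E" "\<forall>u\<in>\<iota> ` Domain F. g u = f u" by blast
  note gD = module_homD[OF g(1)]
  have gF: "g (\<iota> x) = \<iota> y" if "(x, y) \<in> F" for x y
    using g(2) f[OF that] DomainI[OF that] by simp
  \<comment> \<open>The kernel of \<open>g\<close> meets the image of the essential right ideal \<open>Domain F\<close> trivially.\<close>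
  have ginj: "inj_on g (carrier E)"
  proof (rule module_hom_inj_onI[OF E E g(1)], rule ccontr)
    fix e assume e: "e \<in> carrier E" "g e = \<zero>\<^bsub>E\<^esub>" "e \<noteq> \<zero>\<^bsub>E\<^esub>"
    then obtain a x where ax: "a \<in> carrier R" "x \<in> Domain F" "a \<odot>\<^bsub>E\<^esub> e = \<iota> x" "x \<noteq> \<zero>"
      using ess[OF FD(4)] by blast
    then obtain y where y: "(x, y) \<in> F" by auto
    have "\<iota> y = \<zero>\<^bsub>E\<^esub>" using gF[OF y] gD(3)[OF ax(1) e(1)] ax(1,3) e(2) E.smult_zero_right by simp
    then show False using \<iota>0 FD(3)[OF y] Fcar[OF y] ax(4) by simp
  qed
  \<comment> \<open>Extend the inverse of \<open>g\<close> to \<open>h : E \<rightarrow> E\<close>. This \<open>h\<close> is injective, as it is so on the image of \<open>Range F\<close>; then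
    \<open>h (g (h e)) = h e\<close> shows that \<open>g\<close> is surjective.\<close>
  have N': "submodule (g ` carrier E) R E" by (rule submodule_image[OF E E g(1)])
  have inv: "inv_into (carrier E) g (g e) = e" if "e \<in> carrier E" for e
    using ginj that by (rule inv_into_f_f)
  have "inv_into (carrier E) g \<in> module_hom R (E\<lparr>carrier := g ` carrier E\<rparr>) E"
  proof (rule module_homI)
    fix u assume u: "u \<in> carrier (E\<lparr>carrier := g ` carrier E\<rparr>)"
    then obtain e where e: "u = g e" "e \<in> carrier E" by auto
    show "inv_into (carrier E) g u \<in> carrier E" using e inv by simp
    show "inv_into (carrier E) g (a \<odot>\<^bsub>E\<lparr>carrier := g ` carrier E\<rparr>\<^esub> u) = a \<odot>\<^bsub>E\<^esub> inv_into (carrier E) g u"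
      if "a \<in> carrier R" for a
      using inv[of "a \<odot>\<^bsub>E\<^esub> e"] inv[of e] e that gD(3)[OF that e(2)] E.smult_closed by simp
    fix v assume "v \<in> carrier (E\<lparr>carrier := g ` carrier E\<rparr>)"
    then obtain e' where e': "v = g e'" "e' \<in> carrier E" by auto
    show "inv_into (carrier E) g (u \<oplus>\<^bsub>E\<lparr>carrier := g ` carrier E\<rparr>\<^esub> v) =
        inv_into (carrier E) g u \<oplus>\<^bsub>E\<^esub> inv_into (carrier E) g v"
      using inv[of "e \<oplus>\<^bsub>E\<^esub> e'"] inv[of e] inv[of e'] e e' gD(2)[OF e(2) e'(2)] by simp
  qed
  from ext[OF N' this] obtain h where h: "h \<in> module_hom R E E"
    "\<forall>u\<in>g ` carrier E. h u = inv_into (carrier E) g u" by blast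
  note hD = module_homD[OF h(1)]
  have hg: "h (g e) = e" if "e \<in> carrier E" for e using h(2) inv that by simp
  have hinj: "inj_on h (carrier E)"
  proof (rule module_hom_inj_onI[OF E E h(1)], rule ccontr)
    fix e assume e: "e \<in> carrier E" "h e = \<zero>\<^bsub>E\<^esub>" "e \<noteq> \<zero>\<^bsub>E\<^esub>"
    then obtain a y where ay: "a \<in> carrier R" "y \<in> Range F" "a \<odot>\<^bsub>E\<^esub> e = \<iota> y" "y \<noteq> \<zero>"
      using ess[OF FD(5)] by blast
    then obtain x where x: "(x, y) \<in> F" by auto
    have "\<iota> x = h (\<iota> y)" using gF[OF x] hg[of "\<iota> x"] \<iota>D(1) Fcar[OF x] by simp
    also have "\<dots> = \<zero>\<^bsub>E\<^esub>" using hD(3)[OF ay(1) e(1)] ay(1,3) e(2) E.smult_zero_right by simp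
    finally show False using \<iota>0 FD(3)[OF x] Fcar[OF x] ay(4) by simp
  qed
  have "e \<in> g ` carrier E" if e: "e \<in> carrier E" for e
  proof -
    have "g (h e) = e" using inj_onD[OF hinj, of "g (h e)" e] hg[OF hD(1)[OF e]] gD(1) hD(1) e by simp
    then show ?thesis using hD(1)[OF e] by (metis imageI)
  qed
  then have "bij_betw g (carrier E) (carrier E)"
    using ginj gD(1) by (auto simp: bij_betw_def)
  then have auto: "g \<in> module_auto R E" using g(1) by (simp add: module_auto_def)
  have stable: "g ` (\<iota> ` L) \<subseteq> \<iota> ` L" if L: "essential_right_ideal R L" for L
  proof -
    have Lr: "right_ideal L R" using L by (simp add: essential_right_ideal_def)
    have "essential_submodule R (\<iota> ` L) E"
      unfolding essential_submodule_iff[OF E]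
      using sub[OF Lr] ess[OF L] \<iota>0 right_idealD(1)[OF Lr] by (metis image_eqI subsetD)
    moreover have "\<iota> \<in> module_hom R (right_ideal_module R L) E"
      using right_idealD[OF Lr] \<iota>D by (intro module_homI) (auto simp: subset_iff)
    moreover have "inj_on \<iota> L" using \<iota>inj right_idealD(1)[OF Lr] by (rule inj_on_subset)
    ultimately have "injective_envelope R (right_ideal_module R L) E \<iota>"
      using inj by (simp add: injective_envelope_def)
    moreover have "automorphism_invariant R (right_ideal_module R L)"
      using a Lr by (simp add: right_a_ring_def)
    ultimately show ?thesis using auto by (simp add: automorphism_invariant_def)
  qed
  have "g (\<iota> \<one>) \<in> \<iota> ` carrier R"
    using stable[OF essential_right_ideal_carrier] by (rule subsetD) simp
  then obtain c where c: "c \<in> carrier R" "g (\<iota> \<one>) = \<iota> c" by auto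
  have mult: "g (\<iota> x) = \<iota> (c \<otimes> x)" if x: "x \<in> carrier R" for x
    using gD(3)[OF x \<iota>D(1)[OF one_closed]] \<iota>D(3)[OF one_closed x] \<iota>D(3)[OF c(1) x] c(2) x by simp
  show thesis
  proof (rule that[OF c(1)])
    show "c \<otimes> x = y" if "(x, y) \<in> F" for x y
      using inj_onD[OF \<iota>inj, of "c \<otimes> x" y] mult gF[OF that] Fcar[OF that] c(1) by simp
    show "c \<otimes> x \<in> L" if L: "essential_right_ideal R L" "x \<in> L" for L x
    proof -
      have "L \<subseteq> carrier R" using L right_idealD(1) by (auto simp: essential_right_ideal_def)
      then have x: "x \<in> carrier R" using L by auto
      have "\<iota> (c \<otimes> x) \<in> \<iota> ` L" using subsetD[OF stable[OF L(1)] imageI[OF imageI[OF L(2)]]] mult[OF x] by simp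
      then show ?thesis
        using \<iota>inj \<open>L \<subseteq> carrier R\<close> x c(1) by (metis inj_on_image_mem_iff m_closed)
    qed
  qed
qed

section \<open>Essential right ideals of prime and of simple artinian rings\<close>

context prime_ring
begin

text \<open>
  If \<open>x R y = 0\<close>, then \<open>y\<close> lies in the ideal \<open>J\<close> of all \<open>b\<close> with \<open>x R b = 0\<close>, and \<open>x\<close> lies in the left
  annihilator of \<open>J\<close>, which is an ideal as well.
\<close>

lemma prime_elements:
  assumes x: "x \<in> carrier R" "x \<noteq> \<zero>" and y: "y \<in> carrier R" "y \<noteq> \<zero>"
  shows "\<exists>r\<in>carrier R. x \<otimes> r \<otimes> y \<noteq> \<zero>"
proof (rule ccontr)
  assume "\<not> ?thesis"
  then have xy: "x \<otimes> r \<otimes> y = \<zero>" if "r \<in> carrier R" for r using that by blast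
  define J where "J = {b \<in> carrier R. \<forall>r\<in>carrier R. x \<otimes> r \<otimes> b = \<zero>}"
  define I where "I = {a \<in> carrier R. \<forall>b\<in>J. a \<otimes> b = \<zero>}"
  have J: "ideal J R"
  proof -
    have "right_ideal J R"
      using x by (intro right_idealI) (auto simp: J_def r_distr simp flip: m_assoc)
    moreover have "a \<otimes> b \<in> J" if "b \<in> J" "a \<in> carrier R" for a b
    proof -
      have "x \<otimes> r \<otimes> (a \<otimes> b) = x \<otimes> (r \<otimes> a) \<otimes> b" if "r \<in> carrier R" for r
        using that x \<open>b \<in> J\<close> \<open>a \<in> carrier R\<close> by (simp add: J_def m_assoc)
      then show ?thesis using that by (simp add: J_def)
    qed
    ultimately show ?thesis
      by (auto simp: ideal_def ideal_axioms_def right_ideal_def right_ideal_axioms_def)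
  qed
  then interpret J: ideal J R .
  have I: "ideal I R"
  proof -
    have "right_ideal I R"
      using J.I_l_closed J.Icarr by (intro right_idealI) (auto simp: I_def l_distr m_assoc)
    moreover have "r \<otimes> a \<in> I" if "a \<in> I" "r \<in> carrier R" for a r
      using that J.Icarr by (auto simp: I_def m_assoc)
    ultimately show ?thesis
      by (auto simp: ideal_def ideal_axioms_def right_ideal_def right_ideal_axioms_def)
  qed
  have "y \<in> J" unfolding J_def using xy y(1) by blast
  moreover have "x \<in> I"
  proof -
    have "x \<otimes> b = \<zero>" if b: "b \<in> J" for b
    proof -
      have "x \<otimes> \<one> \<otimes> b = \<zero>" using b unfolding J_def by blast
      then show ?thesis using x by simp
    qed
    then show ?thesis using x by (simp add: I_def)
  qed
  ultimately have "I \<cdot> J \<noteq> {\<zero>}" using prime[OF I J] x y by blast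
  moreover have "z = \<zero>" if "z \<in> I \<cdot> J" for z
    using that by induction (auto simp: I_def)
  moreover have "\<zero> \<in> I \<cdot> J"
    using ideal_prod.prod[of x I y J R] \<open>x \<in> I\<close> \<open>y \<in> J\<close> by (auto simp: I_def)
  ultimately show False by blast
qed

lemma essential_if_ideal:
  assumes T: "ideal T R" and "T \<noteq> {\<zero>}"
  shows "essential_right_ideal R T"
  unfolding essential_right_ideal_def
proof (intro conjI ballI impI)
  interpret T: ideal T R by fact
  show "right_ideal T R" by (rule right_ideal_if_ideal[OF T])
  obtain t where t: "t \<in> T" "t \<noteq> \<zero>" using assms T.zero_closed by blast
  fix x assume x: "x \<in> carrier R" "x \<noteq> \<zero>"
  obtain r where r: "r \<in> carrier R" "x \<otimes> r \<otimes> t \<noteq> \<zero>"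
    using prime_elements[OF x] t T.Icarr by blast
  then show "\<exists>a\<in>carrier R. x \<otimes> a \<in> T \<and> x \<otimes> a \<noteq> \<zero>"
    using x t T.Icarr T.I_l_closed by (intro bexI[of _ "r \<otimes> t"]) (auto simp: m_assoc)
qed

end

lemma (in ring) right_artinian_minimal:
  assumes art: "right_artinian R" and J: "right_ideal J R" "P J"
  shows "\<exists>I. right_ideal I R \<and> P I \<and> (\<forall>K. right_ideal K R \<longrightarrow> P K \<longrightarrow> K \<subseteq> I \<longrightarrow> K = I)"
proof (rule ccontr)
  assume "\<not> ?thesis"
  then have step: "\<exists>K. (right_ideal K R \<and> P K) \<and> K \<subset> I" if "right_ideal I R \<and> P I" for I
    using that by (metis psubsetI)
  have "\<exists>I. \<forall>n. (right_ideal (I n) R \<and> P (I n)) \<and> I (Suc n) \<subset> I n"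
  proof (rule dependent_nat_choice)
    show "\<exists>I. right_ideal I R \<and> P I" using J by blast
  qed (rule step)
  then obtain I :: "nat \<Rightarrow> 'a set" where I: "\<And>n. right_ideal (I n) R" "\<And>n. I (Suc n) \<subset> I n" by blast
  then have "\<forall>n. right_ideal (I n) R \<and> I (Suc n) \<subseteq> I n" by auto
  then have "\<exists>n. \<forall>m\<ge>n. I m = I n"
    using conjunct2[OF art[unfolded right_artinian_def]] by (elim allE[of _ I] impE)
  then obtain n where n: "\<forall>m\<ge>n. I m = I n" ..
  have "I (Suc n) = I n" using spec[OF n, of "Suc n"] by simp
  then show False using I(2)[of n] by simp
qed

text \<open>
  By the chain condition there is a smallest essential right ideal, namely the socle. It is a
  nonzero two-sided ideal, hence all of the simple ring \<open>R\<close>.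
\<close>

lemma (in simple_ring) essential_right_ideal_eq_carrier:
  assumes art: "right_artinian R" and L: "essential_right_ideal R L"
  shows "L = carrier R"
proof -
  obtain S where S: "right_ideal S R" "essential_right_ideal R S"
    and min: "\<And>K. \<lbrakk>right_ideal K R; essential_right_ideal R K; K \<subseteq> S\<rbrakk> \<Longrightarrow> K = S"
    using right_artinian_minimal[where P = "essential_right_ideal R",
        OF art right_ideal_carrier essential_right_ideal_carrier] by metis
  have sub: "S \<subseteq> K" if "essential_right_ideal R K" for K
  proof -
    have "essential_right_ideal R (K \<inter> S)" by (rule essential_right_ideal_Int[OF that S(2)])
    then have "K \<inter> S = S" using min[of "K \<inter> S"] by (auto simp: essential_right_ideal_def)
    then show ?thesis by auto
  qed
  then have "socle R = S" using S(2) by (auto simp: socle_def)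
  then have "S = {\<zero>} \<or> S = carrier R" using simple[OF ideal_socle] by simp
  moreover have "S \<noteq> {\<zero>}"
    using S(2) nontrivial unfolding essential_right_ideal_def by blast
  ultimately show ?thesis
    using sub[OF L] L right_idealD(1) by (auto simp: essential_right_ideal_def)
qed

text \<open>
  For \<open>x\<close> in an envelope \<open>E\<close> of \<open>M\<close>, the right ideal of all \<open>a\<close> with \<open>x a\<close> in \<open>M\<close> is essential.
  If \<open>R\<close> has no proper essential right ideal, it contains \<open>1\<close>, and so \<open>E = M\<close>.
\<close>

lemma automorphism_invariant_if_no_proper_essential:
  assumes M: "right_module R M" and no: "\<And>L. essential_right_ideal R L \<Longrightarrow> L = carrier R"
  shows "automorphism_invariant R M"
  unfolding automorphism_invariant_def
proof (intro conjI M allI impI ballI)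
  fix E \<iota> \<phi> assume env: "injective_envelope R M E \<iota>" and \<phi>: "\<phi> \<in> module_auto R E"
  have E: "right_module R E" and sub: "submodule (\<iota> ` carrier M) R E" and \<iota>: "\<iota> \<in> module_hom R M E"
    using env by (auto simp: injective_envelope_def injective_module_def essential_submodule_def)
  interpret E: right_module R E by fact
  note N = E.submoduleD[OF sub]
  have "x \<in> \<iota> ` carrier M" if x: "x \<in> carrier E" for x
  proof -
    let ?A = "{a \<in> carrier R. a \<odot>\<^bsub>E\<^esub> x \<in> \<iota> ` carrier M}"
    have "essential_right_ideal R ?A"
      unfolding essential_right_ideal_def
    proof (intro conjI ballI impI)
      show "right_ideal ?A R"
        using x N(2-4) by (intro E.R.right_idealI) (auto simp: E.smult_l_distr E.smult_assoc E.smult_zero_left simp del: image_iff)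
      fix r assume r: "r \<in> carrier R" "r \<noteq> \<zero>\<^bsub>R\<^esub>"
      show "\<exists>a\<in>carrier R. r \<otimes>\<^bsub>R\<^esub> a \<in> ?A \<and> r \<otimes>\<^bsub>R\<^esub> a \<noteq> \<zero>\<^bsub>R\<^esub>"
      proof (cases "r \<odot>\<^bsub>E\<^esub> x = \<zero>\<^bsub>E\<^esub>")
        case True
        then show ?thesis using r N(2) by (intro bexI[of _ "\<one>\<^bsub>R\<^esub>"]) auto
      next
        case False
        then obtain a where a: "a \<in> carrier R" "a \<odot>\<^bsub>E\<^esub> (r \<odot>\<^bsub>E\<^esub> x) \<in> \<iota> ` carrier M" "a \<odot>\<^bsub>E\<^esub> (r \<odot>\<^bsub>E\<^esub> x) \<noteq> \<zero>\<^bsub>E\<^esub>"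
          using env r x E.smult_closed by (auto simp: injective_envelope_def essential_submodule_iff[OF E])
        then have *: "(r \<otimes>\<^bsub>R\<^esub> a) \<odot>\<^bsub>E\<^esub> x = a \<odot>\<^bsub>E\<^esub> (r \<odot>\<^bsub>E\<^esub> x)" using r x by (simp add: E.smult_assoc)
        then have "r \<otimes>\<^bsub>R\<^esub> a \<noteq> \<zero>\<^bsub>R\<^esub>" using a(3) x E.smult_zero_left by metis
        then show ?thesis using a r * by (intro bexI[of _ a]) auto
      qed
    qed
    from no[OF this] have "\<one>\<^bsub>R\<^esub> \<in> ?A" by simp
    then show ?thesis using x E.smult_one by simp
  qed
  moreover have "\<phi> ` (\<iota> ` carrier M) \<subseteq> carrier E"
    using \<phi> N(1) by (auto simp: module_auto_def module_hom_def)
  ultimately show "\<phi> ` (\<iota> ` carrier M) \<subseteq> \<iota> ` carrier M" by (meson subsetD subsetI)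
qed

section \<open>Prime rings without proper essential right ideals\<close>

context ring
begin

lemma minus_eq_zero_iff:
  assumes "x \<in> carrier R" "y \<in> carrier R"
  shows "x \<ominus> y = \<zero> \<longleftrightarrow> x = y"
  using assms minus_equality[of x "\<ominus> y"] by (auto simp: minus_eq r_neg)

lemma right_ideal_Union_ascending:
  fixes X :: "nat \<Rightarrow> 'a set"
  assumes X: "\<And>n. right_ideal (X n) R" and mono: "\<And>n. X n \<subseteq> X (Suc n)"
  shows "right_ideal (\<Union>n. X n) R"
proof (rule right_idealI)
  note XD = right_idealD[OF X]
  have le: "X m \<subseteq> X n" if "m \<le> n" for m n
    using mono that by (rule lift_Suc_mono_le)
  show "(\<Union>n. X n) \<subseteq> carrier R" "\<zero> \<in> (\<Union>n. X n)"
    using XD(1,2) by auto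
  show "x \<otimes> a \<in> (\<Union>n. X n)" if "x \<in> (\<Union>n. X n)" "a \<in> carrier R" for x a
    using that XD(4) by blast
  show "x \<oplus> y \<in> (\<Union>n. X n)" if xy: "x \<in> (\<Union>n. X n)" "y \<in> (\<Union>n. X n)" for x y
  proof -
    obtain m n where "x \<in> X m" "y \<in> X n" using xy by auto
    then have "x \<in> X (max m n)" "y \<in> X (max m n)"
      using le[of m "max m n"] le[of n "max m n"] by auto
    then show ?thesis using XD(3) by blast
  qed
qed

lemma left_idealD:
  assumes "left_ideal L R"
  shows "\<And>x. x \<in> L \<Longrightarrow> x \<in> carrier R" "\<zero> \<in> L" "\<And>x y. \<lbrakk>x \<in> L; y \<in> L\<rbrakk> \<Longrightarrow> x \<oplus> y \<in> L"
    and "\<And>x a. \<lbrakk>x \<in> L; a \<in> carrier R\<rbrakk> \<Longrightarrow> a \<otimes> x \<in> L"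
    and "\<And>x y. \<lbrakk>x \<in> L; y \<in> L\<rbrakk> \<Longrightarrow> x \<ominus> y \<in> L"
proof -
  interpret L: left_ideal L R by fact
  show "\<And>x. x \<in> L \<Longrightarrow> x \<in> carrier R" "\<zero> \<in> L" "\<And>x y. \<lbrakk>x \<in> L; y \<in> L\<rbrakk> \<Longrightarrow> x \<oplus> y \<in> L"
    "\<And>x a. \<lbrakk>x \<in> L; a \<in> carrier R\<rbrakk> \<Longrightarrow> a \<otimes> x \<in> L"
    using L.a_subset L.I_l_closed by auto
  show "\<And>x y. \<lbrakk>x \<in> L; y \<in> L\<rbrakk> \<Longrightarrow> x \<ominus> y \<in> L"
    by (simp add: a_minus_def)
qed

end

text \<open>
  The rings without proper essential right ideals are the semisimple rings: complements turn every
  right ideal into a direct summand.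
\<close>

locale prime_semisimple_ring = prime_ring +
  assumes no_proper_essential: "essential_right_ideal R L \<Longrightarrow> L = carrier R"
begin

lemma is_simple_ring: "simple_ring R"
  using no_proper_essential essential_if_ideal nontrivial
  by (intro simple_ring.intro simple_ring_axioms.intro ring_axioms) blast+

lemma exists_direct_complement:
  assumes "right_ideal I R" "right_ideal C R" "C \<inter> I \<subseteq> {\<zero>}"
  shows "\<exists>K. right_ideal K R \<and> C \<subseteq> K \<and> K \<inter> I \<subseteq> {\<zero>} \<and> (\<forall>x\<in>carrier R. \<exists>i\<in>I. \<exists>k\<in>K. x = i \<oplus> k)"
proof -
  obtain K where K: "right_ideal K R" "C \<subseteq> K" "K \<inter> I \<subseteq> {\<zero>}"
    and ess: "essential_right_ideal R {x \<oplus> k | x k. x \<in> I \<and> k \<in> K}"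
    by (rule right_ideal_complement[OF assms])
  have "\<exists>i\<in>I. \<exists>k\<in>K. x = i \<oplus> k" if "x \<in> carrier R" for x
    using no_proper_essential[OF ess] that by blast
  then show ?thesis using K by blast
qed

lemma right_ideal_left_identity:
  assumes I: "right_ideal I R"
  obtains e where "e \<in> I" "\<And>x. x \<in> I \<Longrightarrow> e \<otimes> x = x"
proof -
  note ID = right_idealD[OF I]
  obtain K where K: "right_ideal K R" "K \<inter> I \<subseteq> {\<zero>}"
    and sum: "\<forall>x\<in>carrier R. \<exists>i\<in>I. \<exists>k\<in>K. x = i \<oplus> k"
    using exists_direct_complement[OF I right_ideal_zero] by blast
  then obtain e k where ek: "e \<in> I" "k \<in> K" "\<one> = e \<oplus> k" by blast
  note KD = right_idealD[OF K(1)]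
  have "e \<otimes> x = x" if x: "x \<in> I" for x
  proof -
    have c: "x \<in> carrier R" "e \<in> carrier R" "k \<in> carrier R" using x ek ID(5) KD(5) by auto
    have "x = e \<otimes> x \<oplus> k \<otimes> x" using c by (simp flip: l_distr ek(3))
    then have kx: "k \<otimes> x = x \<ominus> e \<otimes> x"
      using c by (metis a_comm add.inv_solve_right m_closed minus_eq)
    have "k \<otimes> x \<in> I" unfolding kx using ID(4)[OF ek(1) c(1)] x by (rule ID(6)[rotated])
    then have "k \<otimes> x = \<zero>" using KD(4)[OF ek(2) c(1)] K(2) by blast
    then show ?thesis using kx c minus_eq_zero_iff by simp
  qed
  then show thesis using that ek(1) by blast
qed

text \<open>
  Complements of a descending chain can be chosen ascending. The union of the complements is
  generated by a single element, so they become stationary, and then so does the chain.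
\<close>

lemma right_artinian: "right_artinian R"
  unfolding right_artinian_def
proof (intro conjI ring_axioms allI impI)
  fix I :: "nat \<Rightarrow> 'a set" assume "\<forall>n. right_ideal (I n) R \<and> I (Suc n) \<subseteq> I n"
  then have I: "right_ideal (I n) R" "I (Suc n) \<subseteq> I n" for n by auto
  define P where "P n X \<longleftrightarrow> right_ideal X R \<and> X \<inter> I n \<subseteq> {\<zero>} \<and> (\<forall>x\<in>carrier R. \<exists>i\<in>I n. \<exists>k\<in>X. x = i \<oplus> k)" for n X
  have "\<exists>X. \<forall>n. P n (X n) \<and> X n \<subseteq> X (Suc n)"
  proof (rule dependent_nat_choice)
    show "\<exists>X. P 0 X"
      using exists_direct_complement[OF I(1)[of 0] right_ideal_zero] unfolding P_def by blast
    fix X n assume "P n X"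
    then have "right_ideal X R" "X \<inter> I (Suc n) \<subseteq> {\<zero>}" using I(2)[of n] unfolding P_def by blast+
    from exists_direct_complement[OF I(1) this]
    show "\<exists>Y. P (Suc n) Y \<and> X \<subseteq> Y" unfolding P_def by blast
  qed
  then obtain X where PX: "\<And>n. P n (X n)" and X_mono: "\<And>n. X n \<subseteq> X (Suc n)" by metis
  have X: "right_ideal (X n) R" "X n \<inter> I n \<subseteq> {\<zero>}" "x \<in> carrier R \<Longrightarrow> \<exists>i\<in>I n. \<exists>k\<in>X n. x = i \<oplus> k" for n x
    using PX[of n] unfolding P_def by blast+
  obtain e where e: "e \<in> (\<Union>n. X n)" "\<And>x. x \<in> (\<Union>n. X n) \<Longrightarrow> e \<otimes> x = x"
    using right_ideal_left_identity[OF right_ideal_Union_ascending[where X = X, OF X(1) X_mono]] by blast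
  then obtain n where n: "e \<in> X n" by auto
  have Xm: "X m \<subseteq> X n" for m
  proof
    fix x assume x: "x \<in> X m"
    then have "e \<otimes> x = x" using e(2) by auto
    then show "x \<in> X n" using right_idealD(4)[OF X(1) n, of x] right_idealD(5)[OF X(1) x] by simp
  qed
  have "I m = I n" if "n \<le> m" for m
  proof
    show sub: "I m \<subseteq> I n" using I(2) that by (rule lift_Suc_antimono_le)
    show "I n \<subseteq> I m"
    proof
      fix x assume x: "x \<in> I n"
      then have xc: "x \<in> carrier R" by (rule right_idealD(5)[OF I(1)])
      then obtain i k where ik: "i \<in> I m" "k \<in> X m" "x = i \<oplus> k" using X(3) by blast
      have c: "i \<in> carrier R" "k \<in> carrier R" using ik right_idealD(5)[OF I(1)] right_idealD(5)[OF X(1)] by auto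
      have k: "k = x \<ominus> i" using c xc ik(3) by (metis a_comm add.inv_solve_right minus_eq)
      have "k \<in> I n" unfolding k using x sub ik(1) by (intro right_idealD(6)[OF I(1)]) auto
      then have "k = \<zero>" using X(2)[of n] Xm ik(2) by blast
      then show "x \<in> I m" using ik c by simp
    qed
  qed
  then show "\<exists>n. \<forall>m\<ge>n. I m = I n" by blast
qed

text \<open>
  Among the idempotents \<open>f\<close> of \<open>L\<close> choose one with minimal right annihilator. If \<open>y = x - x f\<close> is
  nonzero for some \<open>x\<close> in \<open>L\<close>, von Neumann regularity gives an idempotent \<open>g = z y\<close> of \<open>L\<close> with
  \<open>g f = 0\<close>, and \<open>f + g - f g\<close> is an idempotent of \<open>L\<close> with smaller annihilator, a contradiction.
\<close>

lemma left_ideal_right_identity: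
  assumes L: "left_ideal L R"
  obtains f where "f \<in> L" "\<And>x. x \<in> L \<Longrightarrow> x \<otimes> f = x"
proof -
  note LD = left_idealD[OF L]
  define ann where "ann f = {b \<in> carrier R. f \<otimes> b = \<zero>}" for f
  define P where "P A \<longleftrightarrow> (\<exists>f\<in>L. f \<otimes> f = f \<and> A = ann f)" for A
  have "right_ideal (ann \<zero>) R" unfolding ann_def by (rule right_ideal_annihilator) simp
  moreover have "P (ann \<zero>)" unfolding P_def using LD(2) by (intro bexI[of _ \<zero>]) auto
  ultimately have "\<exists>A. right_ideal A R \<and> P A \<and> (\<forall>K. right_ideal K R \<longrightarrow> P K \<longrightarrow> K \<subseteq> A \<longrightarrow> K = A)"
    by (rule right_artinian_minimal[OF right_artinian])
  then obtain f where f: "f \<in> L" "f \<otimes> f = f"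
    and min: "\<forall>K. right_ideal K R \<longrightarrow> P K \<longrightarrow> K \<subseteq> ann f \<longrightarrow> K = ann f"
    unfolding P_def by blast
  have fc: "f \<in> carrier R" using f LD(1) by auto
  have "x \<otimes> f = x" if x: "x \<in> L" for x
  proof (rule ccontr)
    assume ne: "x \<otimes> f \<noteq> x"
    define y where "y = x \<ominus> x \<otimes> f"
    have xc: "x \<in> carrier R" using x LD(1) by auto
    have y: "y \<in> L" unfolding y_def by (rule LD(5)[OF x LD(4)[OF f(1) xc]])
    have "y \<noteq> \<zero>" using ne minus_eq_zero_iff[of x "x \<otimes> f"] xc fc by (auto simp: y_def)
    moreover have "y \<otimes> f = \<zero>"
      using xc fc f(2) by (simp add: y_def minus_eq l_distr l_minus m_assoc r_neg)
    ultimately have y: "y \<in> L" "y \<noteq> \<zero>" "y \<otimes> f = \<zero>" using y by auto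
    then have yc: "y \<in> carrier R" using LD(1) by auto
    obtain e where e: "e \<in> {y \<otimes> a | a. a \<in> carrier R}"
      "\<And>x. x \<in> {y \<otimes> a | a. a \<in> carrier R} \<Longrightarrow> e \<otimes> x = x"
      using right_ideal_left_identity[OF right_ideal_principal[OF yc]] by blast
    then obtain z where z: "z \<in> carrier R" "e = y \<otimes> z" by auto
    have "y \<otimes> \<one> \<in> {y \<otimes> a | a. a \<in> carrier R}" by blast
    then have yzy: "y \<otimes> z \<otimes> y = y" using e(2) z(2) yc by simp
    define g where "g = z \<otimes> y"
    have g: "g \<in> L" "g \<in> carrier R" using LD(4)[OF y(1) z(1)] LD(1) by (auto simp: g_def)
    have gf: "g \<otimes> f = \<zero>" using y(3) z(1) yc fc by (simp add: g_def m_assoc)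
    have gg: "g \<otimes> g = g" using yzy z(1) yc by (simp add: g_def m_assoc)
    have g0: "g \<noteq> \<zero>" using yzy y(2) z(1) yc by (auto simp: g_def m_assoc)
    define h where "h = f \<oplus> (g \<ominus> f \<otimes> g)"
    have h: "h \<in> L" "h \<in> carrier R"
      using LD(3)[OF f(1) LD(5)[OF g(1) LD(4)[OF g(1) fc]]] LD(1) by (auto simp: h_def)
    have hf: "h \<otimes> f = f" and hg: "h \<otimes> g = g" and fh: "f \<otimes> h = f"
      using fc g(2) f(2) gf gg
      by (simp_all add: h_def minus_eq l_distr r_distr l_minus r_minus m_assoc r_neg r_neg2 m_assoc[symmetric, of f f g] a_lcomm[of "f \<otimes> g" f] a_lcomm[of "f \<otimes> g" g])
    have hh: "h \<otimes> h = h"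
    proof -
      have "h \<otimes> h = h \<otimes> (f \<oplus> (g \<ominus> f \<otimes> g))" by (simp only: h_def[symmetric])
      also have "\<dots> = h \<otimes> f \<oplus> (h \<otimes> g \<ominus> h \<otimes> f \<otimes> g)"
        using fc g(2) h(2) by (simp add: minus_eq r_distr r_minus m_assoc)
      also have "\<dots> = h" unfolding hf hg by (simp only: h_def)
      finally show ?thesis .
    qed
    have "ann h \<subseteq> ann f"
    proof
      fix b assume "b \<in> ann h"
      then have b: "b \<in> carrier R" "h \<otimes> b = \<zero>" by (auto simp: ann_def)
      then have "f \<otimes> h \<otimes> b = \<zero>" using fc h(2) by (simp add: m_assoc)
      then show "b \<in> ann f" using b by (simp add: ann_def fh)
    qed
    moreover have "right_ideal (ann h) R" unfolding ann_def by (rule right_ideal_annihilator[OF h(2)])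
    moreover have "P (ann h)" unfolding P_def using h(1) hh by blast
    ultimately have eq: "ann h = ann f" using min by blast
    have "\<one> \<ominus> f \<in> ann f" using fc f(2) by (simp add: ann_def minus_eq r_distr r_minus r_neg)
    then have "h \<otimes> (\<one> \<ominus> f) = \<zero>" using eq by (auto simp: ann_def)
    then have "h \<ominus> f = \<zero>" using fc h(2) hf by (simp add: minus_eq r_distr r_minus)
    then have "h = f" using minus_eq_zero_iff fc h(2) by simp
    then have "g \<otimes> (f \<otimes> g) = g" using hg gg by simp
    then show False using g0 gf g(2) fc by (simp flip: m_assoc)
  qed
  then show thesis using that f(1) by blast
qed

text \<open>
  A left ideal with right identity \<open>f\<close> is the left annihilator of its right annihilator
  \<open>(1 - f) R\<close>. The right annihilators of a descending chain ascend, so they become stationary.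
\<close>

lemma left_artinian: "left_artinian R"
  unfolding left_artinian_def
proof (intro conjI ring_axioms allI impI)
  fix L :: "nat \<Rightarrow> 'a set" assume "\<forall>n. left_ideal (L n) R \<and> L (Suc n) \<subseteq> L n"
  then have L: "left_ideal (L n) R" "L (Suc n) \<subseteq> L n" for n by auto
  note LD = left_idealD[OF L(1)]
  define X where "X n = {b \<in> carrier R. \<forall>x\<in>L n. x \<otimes> b = \<zero>}" for n
  have X: "right_ideal (X n) R" for n
    using LD(1) by (intro right_idealI) (auto simp: X_def r_distr simp flip: m_assoc)
  have X_mono: "X n \<subseteq> X (Suc n)" for n using L(2)[of n] by (auto simp: X_def)
  obtain e where e: "e \<in> (\<Union>n. X n)" "\<And>x. x \<in> (\<Union>n. X n) \<Longrightarrow> e \<otimes> x = x"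
    using right_ideal_left_identity[OF right_ideal_Union_ascending[where X = X, OF X X_mono]] by blast
  then obtain n where n: "e \<in> X n" by auto
  have "L m = L n" if "n \<le> m" for m
  proof
    show sub: "L m \<subseteq> L n" using L(2) that by (rule lift_Suc_antimono_le)
    obtain f where f: "f \<in> L m" "\<And>x. x \<in> L m \<Longrightarrow> x \<otimes> f = x"
      using left_ideal_right_identity[OF L(1)] by blast
    have fc: "f \<in> carrier R" using LD(1)[OF f(1)] .
    show "L n \<subseteq> L m"
    proof
      fix x assume x: "x \<in> L n"
      have xc: "x \<in> carrier R" using LD(1)[OF x] .
      have ec: "e \<in> carrier R" and xe: "x \<otimes> e = \<zero>" using n x by (auto simp: X_def)
      have "\<one> \<ominus> f \<in> X m"
        using f(2) fc LD(1) by (auto simp: X_def minus_eq r_distr r_minus r_neg)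
      then have "e \<otimes> (\<one> \<ominus> f) = \<one> \<ominus> f" using e(2) by auto
      then have "x \<otimes> (\<one> \<ominus> f) = x \<otimes> e \<otimes> (\<one> \<ominus> f)" using xc ec fc by (simp add: m_assoc)
      also have "\<dots> = \<zero>" using xe fc by simp
      finally have "x \<ominus> x \<otimes> f = \<zero>" using xc fc by (simp add: minus_eq r_distr r_minus)
      then have "x = x \<otimes> f" using xc fc minus_eq_zero_iff by simp
      then show "x \<in> L m" using LD(4)[OF f(1) xc] by simp
    qed
  qed
  then show "\<exists>n. \<forall>m\<ge>n. L m = L n" by blast
qed

lemma simple_artinian: "simple_artinian_ring R"
  by (simp add: simple_artinian_ring_def artinian_def is_simple_ring right_artinian left_artinian)

end

section \<open>Prime right a-rings\<close>

lemma (in ring) direct_sum_zero: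
  assumes I: "right_ideal I R" and J: "right_ideal J R" and IJ: "J \<inter> I \<subseteq> {\<zero>}"
    and ij: "i \<in> I" "j \<in> J" "i \<oplus> j = \<zero>"
  shows "i = \<zero>" "j = \<zero>"
proof -
  have c: "i \<in> carrier R" "j \<in> carrier R" using right_idealD(5)[OF I ij(1)] right_idealD(5)[OF J ij(2)] .
  then have "\<zero> \<ominus> j = i" using ij(3) minus_equality[of i j] by (simp add: minus_eq)
  then have "i \<in> J" using right_idealD(6)[OF J right_idealD(2)[OF J] ij(2)] by simp
  then show "i = \<zero>" using IJ ij(1) by auto
  then show "j = \<zero>" using ij(3) c by simp
qed

lemma (in ring) direct_sum_unique:
  assumes I: "right_ideal I R" and J: "right_ideal J R" and IJ: "J \<inter> I \<subseteq> {\<zero>}"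
    and ij: "i \<in> I" "j \<in> J" "i' \<in> I" "j' \<in> J" "i \<oplus> j = i' \<oplus> j'"
  shows "i = i'" "j = j'"
proof -
  have c: "i \<in> carrier R" "j \<in> carrier R" "i' \<in> carrier R" "j' \<in> carrier R"
    using right_idealD(5)[OF I] right_idealD(5)[OF J] ij by auto
  have "(i \<ominus> i') \<oplus> (j \<ominus> j') = (i \<oplus> j) \<ominus> (i' \<oplus> j')"
    using c by (simp add: minus_eq minus_add a_ac)
  also have "\<dots> = \<zero>" using ij(5) c by (simp add: minus_eq_zero_iff)
  finally have "i \<ominus> i' = \<zero>" "j \<ominus> j' = \<zero>"
    using direct_sum_zero[OF I J IJ right_idealD(6)[OF I ij(1,3)] right_idealD(6)[OF J ij(2,4)]] by auto
  then show "i = i'" "j = j'" using c minus_eq_zero_iff by auto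
qed

locale prime_right_a_ring = prime_ring +
  assumes right_a_ring: "right_a_ring R"
begin

text \<open>
  Let \<open>Y\<close> be a complement of \<open>I\<close> that contains \<open>C\<close>. Then \<open>i + y \<mapsto> i + (c i + y)\<close> is an automorphism of
  the essential right ideal \<open>I + Y\<close>, so it preserves the essential right ideal \<open>I + (Y \<inter> L)\<close>. The
  \<open>Y\<close>-component of the image of \<open>i\<close> is \<open>c i\<close>.
\<close>

lemma mult_in_essential_right_ideal:
  assumes I: "right_ideal I R" and C: "right_ideal C R" "C \<inter> I \<subseteq> {\<zero>}"
    and c: "c \<in> C" and i: "i \<in> I" and L: "essential_right_ideal R L"
  shows "c \<otimes> i \<in> L"
proof -
  obtain Y where Y: "right_ideal Y R" "C \<subseteq> Y" "Y \<inter> I \<subseteq> {\<zero>}"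
    and ess: "essential_right_ideal R {x \<oplus> k | x k. x \<in> I \<and> k \<in> Y}"
    by (rule right_ideal_complement[OF I C])
  note ID = right_idealD[OF I] and YD = right_idealD[OF Y(1)]
  have Lr: "right_ideal L R" using L by (simp add: essential_right_ideal_def)
  note LD = right_idealD[OF Lr]
  have cR: "c \<in> carrier R" using right_idealD(5)[OF C(1) c] .
  have cI: "c \<otimes> x \<in> Y" if "x \<in> I" for x
    using right_idealD(4)[OF C(1) c ID(5)[OF that]] Y(2) by auto
  define F where "F = {(x \<oplus> y, x \<oplus> (c \<otimes> x \<oplus> y)) | x y. x \<in> I \<and> y \<in> Y}"
  have "essential_partial_iso R F"
    unfolding essential_partial_iso_def
  proof (intro conjI allI impI)
    fix p q p' q' assume "(p, q) \<in> F" "(p', q') \<in> F"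
    then obtain x y x' y' where *: "p = x \<oplus> y" "q = x \<oplus> (c \<otimes> x \<oplus> y)" "x \<in> I" "y \<in> Y"
      "p' = x' \<oplus> y'" "q' = x' \<oplus> (c \<otimes> x' \<oplus> y')" "x' \<in> I" "y' \<in> Y" by (auto simp: F_def)
    then have car: "x \<in> carrier R" "y \<in> carrier R" "x' \<in> carrier R" "y' \<in> carrier R" using ID(5) YD(5) by auto
    have "p \<oplus> p' = (x \<oplus> x') \<oplus> (y \<oplus> y')" "q \<oplus> q' = (x \<oplus> x') \<oplus> (c \<otimes> (x \<oplus> x') \<oplus> (y \<oplus> y'))"
      using * car cR by (simp_all add: a_ac r_distr)
    then show "(p \<oplus> p', q \<oplus> q') \<in> F" unfolding F_def using ID(3)[OF *(3,7)] YD(3)[OF *(4,8)] by blast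
  next
    fix p q a assume pq: "(p, q) \<in> F" and a: "a \<in> carrier R"
    then obtain x y where *: "p = x \<oplus> y" "q = x \<oplus> (c \<otimes> x \<oplus> y)" "x \<in> I" "y \<in> Y" by (auto simp: F_def)
    then have car: "x \<in> carrier R" "y \<in> carrier R" using ID(5) YD(5) by auto
    have "p \<otimes> a = x \<otimes> a \<oplus> y \<otimes> a" "q \<otimes> a = x \<otimes> a \<oplus> (c \<otimes> (x \<otimes> a) \<oplus> y \<otimes> a)"
      using * car cR a by (simp_all add: l_distr m_assoc)
    then show "(p \<otimes> a, q \<otimes> a) \<in> F" unfolding F_def using ID(4)[OF *(3) a] YD(4)[OF *(4) a] by blast
  next
    fix p q assume "(p, q) \<in> F"
    then obtain x y where *: "p = x \<oplus> y" "q = x \<oplus> (c \<otimes> x \<oplus> y)" "x \<in> I" "y \<in> Y" by (auto simp: F_def)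
    then have car: "x \<in> carrier R" "y \<in> carrier R" using ID(5) YD(5) by auto
    show "p = \<zero> \<longleftrightarrow> q = \<zero>"
    proof
      assume "p = \<zero>"
      then have "x = \<zero>" "y = \<zero>" using direct_sum_zero[OF I Y(1,3) *(3,4)] *(1) by auto
      then show "q = \<zero>" using * cR by simp
    next
      assume "q = \<zero>"
      then have "x = \<zero>" "c \<otimes> x \<oplus> y = \<zero>"
        using direct_sum_zero[OF I Y(1,3) *(3) YD(3)[OF cI[OF *(3)] *(4)]] *(2) by auto
      then show "p = \<zero>" using * cR car by simp
    qed
  next
    have "Domain F = {x \<oplus> k | x k. x \<in> I \<and> k \<in> Y}" by (auto simp: F_def)
    then show "essential_right_ideal R (Domain F)" using ess by simp
    have "Range F = {x \<oplus> k | x k. x \<in> I \<and> k \<in> Y}"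
    proof (intro equalityI subsetI)
      fix q assume "q \<in> Range F"
      then obtain x y where "q = x \<oplus> (c \<otimes> x \<oplus> y)" "x \<in> I" "y \<in> Y" by (auto simp: F_def)
      then show "q \<in> {x \<oplus> k | x k. x \<in> I \<and> k \<in> Y}" using YD(3) cI by blast
    next
      fix q assume "q \<in> {x \<oplus> k | x k. x \<in> I \<and> k \<in> Y}"
      then obtain x y where *: "q = x \<oplus> y" "x \<in> I" "y \<in> Y" by auto
      then have car: "x \<in> carrier R" "y \<in> carrier R" using ID(5) YD(5) by auto
      have "c \<otimes> x \<oplus> (y \<ominus> c \<otimes> x) = y"
        using car cR by (simp add: minus_eq a_lcomm[of "c \<otimes> x" y] r_neg)
      then have "(x \<oplus> (y \<ominus> c \<otimes> x), q) \<in> F"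
        unfolding F_def using * YD(6)[OF *(3) cI[OF *(2)]] by force
      then show "q \<in> Range F" by auto
    qed
    then show "essential_right_ideal R (Range F)" using ess by simp
  qed
  then obtain d where d: "d \<in> carrier R" "\<And>x y. (x, y) \<in> F \<Longrightarrow> d \<otimes> x = y"
    and stable: "\<And>L x. \<lbrakk>essential_right_ideal R L; x \<in> L\<rbrakk> \<Longrightarrow> d \<otimes> x \<in> L"
    by (rule right_a_ring_partial_iso[OF right_a_ring]) (rule that)
  define L' where "L' = {x \<oplus> y | x y. x \<in> I \<and> y \<in> Y \<inter> L}"
  have L': "essential_right_ideal R L'"
    unfolding essential_right_ideal_def
  proof (intro conjI ballI impI)
    show "right_ideal L' R" unfolding L'_def by (rule right_ideal_sum[OF I right_ideal_Int[OF Y(1) Lr]])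
    fix x assume x: "x \<in> carrier R" "x \<noteq> \<zero>"
    then obtain a where a: "a \<in> carrier R" "x \<otimes> a \<in> {x \<oplus> k | x k. x \<in> I \<and> k \<in> Y}" "x \<otimes> a \<noteq> \<zero>"
      using ess unfolding essential_right_ideal_def by blast
    then obtain j y where jy: "x \<otimes> a = j \<oplus> y" "j \<in> I" "y \<in> Y" by auto
    then have car: "j \<in> carrier R" "y \<in> carrier R" using ID(5) YD(5) by auto
    show "\<exists>a\<in>carrier R. x \<otimes> a \<in> L' \<and> x \<otimes> a \<noteq> \<zero>"
    proof (cases "y = \<zero>")
      case True
      then have "x \<otimes> a \<in> L'" unfolding L'_def using jy LD(2) YD(2) by blast
      then show ?thesis using a by blast
    next
      case False
      then obtain b where b: "b \<in> carrier R" "y \<otimes> b \<in> L" "y \<otimes> b \<noteq> \<zero>"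
        using L car unfolding essential_right_ideal_def by blast
      have eq: "x \<otimes> (a \<otimes> b) = j \<otimes> b \<oplus> y \<otimes> b"
        using jy(1) x(1) a(1) b(1) car by (simp add: l_distr flip: m_assoc)
      have jb: "j \<otimes> b \<in> I" "y \<otimes> b \<in> Y" using ID(4)[OF jy(2) b(1)] YD(4)[OF jy(3) b(1)] .
      then have "x \<otimes> (a \<otimes> b) \<in> L'" unfolding L'_def eq using b(2) by blast
      moreover have "x \<otimes> (a \<otimes> b) \<noteq> \<zero>"
        using direct_sum_zero(2)[OF I Y(1,3) jb] eq b(3) by auto
      ultimately show ?thesis using a(1) b(1) by blast
    qed
  qed
  have ic: "i \<in> carrier R" using ID(5) i .
  have "(i, i \<oplus> c \<otimes> i) \<in> F"
  proof -
    have "(i \<oplus> \<zero>, i \<oplus> (c \<otimes> i \<oplus> \<zero>)) \<in> F" unfolding F_def using i YD(2) by blast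
    then show ?thesis using ic cR by simp
  qed
  then have di: "d \<otimes> i = i \<oplus> c \<otimes> i" by (rule d(2))
  have "i \<oplus> \<zero> \<in> L'" unfolding L'_def using i YD(2) LD(2) by blast
  then have "i \<in> L'" using ic by simp
  then have "i \<oplus> c \<otimes> i \<in> L'" using stable[OF L'] di by metis
  then obtain x y where xy: "i \<oplus> c \<otimes> i = x \<oplus> y" "x \<in> I" "y \<in> Y" "y \<in> L" unfolding L'_def by blast
  then have "c \<otimes> i = y" using direct_sum_unique(2)[OF I Y(1,3) i cI[OF i] xy(2,3)] by simp
  then show ?thesis using xy(4) by simp
qed

lemma one_neq_zero: "\<one> \<noteq> \<zero>"
  using nontrivial carrier_one_zero by blast

text \<open>
  If \<open>R\<close> is uniform, \<open>r\<close> or \<open>1 - r\<close> acts injectively from the left, hence is an isomorphism onto an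
  essential right ideal; so every right ideal is two-sided, and \<open>R\<close> is a domain. For \<open>a \<noteq> 0\<close> the
  isomorphism \<open>a x \<mapsto> x\<close> is left multiplication by some \<open>c\<close>, and \<open>1 = c a\<close> lies in \<open>a R\<close>.
\<close>

lemma essential_eq_carrier_if_uniform:
  assumes uniform: "\<And>I C. \<lbrakk>right_ideal I R; right_ideal C R; C \<inter> I \<subseteq> {\<zero>}\<rbrakk> \<Longrightarrow> I \<subseteq> {\<zero>} \<or> C \<subseteq> {\<zero>}"
    and L: "essential_right_ideal R L"
  shows "L = carrier R"
proof -
  have ess: "essential_right_ideal R I" if I: "right_ideal I R" and i: "i \<in> I" "i \<noteq> \<zero>" for I i
    unfolding essential_right_ideal_def
  proof (intro conjI I ballI impI)
    fix x assume x: "x \<in> carrier R" "x \<noteq> \<zero>"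
    have "x \<otimes> \<one> \<in> {x \<otimes> a | a. a \<in> carrier R}" by blast
    then have "\<not> {x \<otimes> a | a. a \<in> carrier R} \<subseteq> {\<zero>}" using x by auto
    then have "\<not> {x \<otimes> a | a. a \<in> carrier R} \<inter> I \<subseteq> {\<zero>}"
      using uniform[OF I right_ideal_principal[OF x(1)]] i by auto
    then show "\<exists>a\<in>carrier R. x \<otimes> a \<in> I \<and> x \<otimes> a \<noteq> \<zero>" by blast
  qed
  have principal: "x \<in> {x \<otimes> a | a. a \<in> carrier R}" if "x \<in> carrier R" for x
    using that by (auto intro!: exI[of _ \<one>])
  have injective: "r \<otimes> y \<in> K"
    if r: "r \<in> carrier R" "\<And>x. \<lbrakk>x \<in> carrier R; r \<otimes> x = \<zero>\<rbrakk> \<Longrightarrow> x = \<zero>"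
      and K: "essential_right_ideal R K" "y \<in> K" for r K y
  proof -
    define F where "F = {(x, r \<otimes> x) | x. x \<in> carrier R}"
    have "r \<noteq> \<zero>" using r(2)[of \<one>] one_neq_zero r(1) by auto
    have "essential_partial_iso R F"
      unfolding essential_partial_iso_def
    proof (intro conjI allI impI)
      have "Domain F = carrier R" "Range F = {r \<otimes> a | a. a \<in> carrier R}" by (auto simp: F_def)
      then show "essential_right_ideal R (Domain F)" "essential_right_ideal R (Range F)"
        using essential_right_ideal_carrier ess[OF right_ideal_principal[OF r(1)] principal[OF r(1)] \<open>r \<noteq> \<zero>\<close>]
        by auto
    qed (use r in \<open>auto simp: F_def r_distr m_assoc\<close>)
    then obtain c where c: "\<And>x y. (x, y) \<in> F \<Longrightarrow> c \<otimes> x = y"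
      "\<And>L x. \<lbrakk>essential_right_ideal R L; x \<in> L\<rbrakk> \<Longrightarrow> c \<otimes> x \<in> L"
      by (rule right_a_ring_partial_iso[OF right_a_ring]) (rule that)
    have "y \<in> carrier R" using K right_idealD(5) unfolding essential_right_ideal_def by blast
    then have "c \<otimes> y = r \<otimes> y" by (intro c(1)) (auto simp: F_def)
    then show ?thesis using c(2)[OF K] by simp
  qed
  \<comment> \<open>The right annihilators of \<open>r\<close> and \<open>1 - r\<close> meet trivially, so one of them is zero.\<close>
  have duo: "r \<otimes> y \<in> K" if r: "r \<in> carrier R" and K: "essential_right_ideal R K" "y \<in> K" for r K y
  proof (cases "\<forall>x\<in>carrier R. r \<otimes> x = \<zero> \<longrightarrow> x = \<zero>")
    case True
    then show ?thesis using injective[OF r _ K] by blast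
  next
    case False
    have r1: "\<one> \<ominus> r \<in> carrier R" using r by simp
    have Kr: "right_ideal K R" using K by (simp add: essential_right_ideal_def)
    have y: "y \<in> carrier R" using right_idealD(5)[OF Kr K(2)] .
    have "{a \<in> carrier R. r \<otimes> a = \<zero>} \<inter> {a \<in> carrier R. (\<one> \<ominus> r) \<otimes> a = \<zero>} \<subseteq> {\<zero>}"
    proof
      fix a assume "a \<in> {a \<in> carrier R. r \<otimes> a = \<zero>} \<inter> {a \<in> carrier R. (\<one> \<ominus> r) \<otimes> a = \<zero>}"
      then have a: "a \<in> carrier R" "r \<otimes> a = \<zero>" "(\<one> \<ominus> r) \<otimes> a = \<zero>" by auto
      then show "a \<in> {\<zero>}" using r by (simp add: minus_eq l_distr l_minus)
    qed
    then have "{a \<in> carrier R. (\<one> \<ominus> r) \<otimes> a = \<zero>} \<subseteq> {\<zero>}"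
      using uniform[OF right_ideal_annihilator[OF r1] right_ideal_annihilator[OF r]] False by blast
    then have "(\<one> \<ominus> r) \<otimes> y \<in> K" using injective[OF r1 _ K] by blast
    then have "y \<ominus> (\<one> \<ominus> r) \<otimes> y \<in> K" by (rule right_idealD(6)[OF Kr K(2)])
    moreover have "y \<ominus> (\<one> \<ominus> r) \<otimes> y = r \<otimes> y"
      using r y by (simp add: minus_eq l_distr l_minus minus_add a_assoc[symmetric] r_neg)
    ultimately show ?thesis by simp
  qed
  have domain: "a \<otimes> b \<noteq> \<zero>" if ab: "a \<in> carrier R" "b \<in> carrier R" "a \<noteq> \<zero>" "b \<noteq> \<zero>" for a b
  proof
    assume 0: "a \<otimes> b = \<zero>"
    obtain r where r: "r \<in> carrier R" "a \<otimes> r \<otimes> b \<noteq> \<zero>" using prime_elements ab by blast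
    have "r \<otimes> b \<in> {b \<otimes> s | s. s \<in> carrier R}"
      using duo[OF r(1) ess[OF right_ideal_principal[OF ab(2)] principal[OF ab(2)] ab(4)] principal[OF ab(2)]] .
    then obtain s where s: "s \<in> carrier R" "r \<otimes> b = b \<otimes> s" by auto
    have "a \<otimes> r \<otimes> b = a \<otimes> b \<otimes> s" using s r ab by (simp add: m_assoc)
    then show False using 0 r(2) s(1) by simp
  qed
  have unit: "\<one> \<in> {a \<otimes> s | s. s \<in> carrier R}" if a: "a \<in> carrier R" "a \<noteq> \<zero>" for a
  proof -
    define F where "F = {(a \<otimes> x, x) | x. x \<in> carrier R}"
    have essa: "essential_right_ideal R {a \<otimes> s | s. s \<in> carrier R}"
      by (rule ess[OF right_ideal_principal[OF a(1)] principal[OF a(1)] a(2)])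
    have "essential_partial_iso R F"
      unfolding essential_partial_iso_def
    proof (intro conjI allI impI)
      have "Domain F = {a \<otimes> s | s. s \<in> carrier R}" "Range F = carrier R" by (auto simp: F_def)
      then show "essential_right_ideal R (Domain F)" "essential_right_ideal R (Range F)"
        using essential_right_ideal_carrier essa by auto
      show "x = \<zero> \<longleftrightarrow> y = \<zero>" if "(x, y) \<in> F" for x y
        using that a domain[of a y] by (auto simp: F_def)
      show "(x \<oplus> x', y \<oplus> y') \<in> F" if "(x, y) \<in> F" "(x', y') \<in> F" for x y x' y'
        using that a by (auto simp: F_def r_distr)
      show "(x \<otimes> b, y \<otimes> b) \<in> F" if "(x, y) \<in> F" "b \<in> carrier R" for x y b
        using that a by (auto simp: F_def m_assoc)
    qed
    then obtain c where c: "\<And>x y. (x, y) \<in> F \<Longrightarrow> c \<otimes> x = y"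
      "\<And>L x. \<lbrakk>essential_right_ideal R L; x \<in> L\<rbrakk> \<Longrightarrow> c \<otimes> x \<in> L"
      by (rule right_a_ring_partial_iso[OF right_a_ring]) (rule that)
    have "(a \<otimes> \<one>, \<one>) \<in> F" unfolding F_def by blast
    then have "c \<otimes> a = \<one>" using c(1) a(1) by fastforce
    then show ?thesis using c(2)[OF essa principal[OF a(1)]] by simp
  qed
  have Lr: "right_ideal L R" using L by (simp add: essential_right_ideal_def)
  obtain a where a: "a \<in> carrier R" "\<one> \<otimes> a \<in> L" "\<one> \<otimes> a \<noteq> \<zero>"
    using L one_neq_zero unfolding essential_right_ideal_def by blast
  then have "\<one> \<in> {a \<otimes> s | s. s \<in> carrier R}" using unit by simp
  then have one: "\<one> \<in> L" using a right_idealD(4)[OF Lr, of a] by auto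
  then have "x \<in> L" if "x \<in> carrier R" for x
    using right_idealD(4)[OF Lr one that] that by simp
  then show ?thesis using right_idealD(1)[OF Lr] by auto
qed

end

section \<open>Disjoint isomorphic right ideals in the socle\<close>

context ring
begin

text \<open>
  This is the semisimplicity of the socle: a complement \<open>T\<close> of \<open>A\<close> in \<open>R\<close> gives an essential right ideal
  \<open>A + T\<close>, which contains the socle and hence \<open>B\<close>, and the modular law applies.
\<close>

lemma socle_relative_complement:
  assumes A: "right_ideal A R" and B: "right_ideal B R" and AB: "A \<subseteq> B" "B \<subseteq> socle R"
  shows "\<exists>T. right_ideal T R \<and> T \<subseteq> B \<and> T \<inter> A \<subseteq> {\<zero>} \<and> (\<forall>b\<in>B. \<exists>a\<in>A. \<exists>t\<in>T. b = a \<oplus> t)"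
proof -
  obtain T where T: "right_ideal T R" "T \<inter> A \<subseteq> {\<zero>}"
    and ess: "essential_right_ideal R {x \<oplus> k | x k. x \<in> A \<and> k \<in> T}"
    by (rule right_ideal_complement[OF A right_ideal_zero]) (simp, rule that)
  have "\<exists>a\<in>A. \<exists>t\<in>T \<inter> B. b = a \<oplus> t" if b: "b \<in> B" for b
  proof -
    have "b \<in> {x \<oplus> k | x k. x \<in> A \<and> k \<in> T}" using socle_subset[OF ess] AB(2) b by blast
    then obtain a t where at: "b = a \<oplus> t" "a \<in> A" "t \<in> T" by blast
    have c: "a \<in> carrier R" "t \<in> carrier R" using right_idealD(5)[OF A at(2)] right_idealD(5)[OF T(1) at(3)] .
    have "t = b \<ominus> a" using at(1) c by (metis a_closed a_comm add.inv_solve_right minus_eq)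
    then have "t \<in> B" using right_idealD(6)[OF B b, of a] AB(1) at(2) by auto
    then show ?thesis using at by blast
  qed
  then show ?thesis using T right_ideal_Int[OF T(1) B] by blast
qed

end

text \<open>
  The graph of an isomorphism between right ideals \<open>X\<close> and \<open>Y\<close> inside \<open>S\<close> with \<open>X \<inter> Y = 0\<close>. The last
  clause makes the graph and its converse single-valued and \<open>X\<close> and \<open>Y\<close> disjoint, all at once.
\<close>

definition disjoint_iso :: "('a, 'b) ring_scheme \<Rightarrow> 'a set \<Rightarrow> ('a \<times> 'a) set \<Rightarrow> bool" where
  "disjoint_iso R S G \<longleftrightarrow> G \<subseteq> S \<times> S \<and> (\<zero>\<^bsub>R\<^esub>, \<zero>\<^bsub>R\<^esub>) \<in> G \<and>
    (\<forall>x y x' y'. (x, y) \<in> G \<longrightarrow> (x', y') \<in> G \<longrightarrow> (x \<oplus>\<^bsub>R\<^esub> x', y \<oplus>\<^bsub>R\<^esub> y') \<in> G) \<and>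
    (\<forall>x y a. (x, y) \<in> G \<longrightarrow> a \<in> carrier R \<longrightarrow> (x \<otimes>\<^bsub>R\<^esub> a, y \<otimes>\<^bsub>R\<^esub> a) \<in> G) \<and>
    (\<forall>x y x' y'. (x, y) \<in> G \<longrightarrow> (x', y') \<in> G \<longrightarrow> x \<oplus>\<^bsub>R\<^esub> y' = \<zero>\<^bsub>R\<^esub> \<longrightarrow>
      x = \<zero>\<^bsub>R\<^esub> \<and> y = \<zero>\<^bsub>R\<^esub> \<and> x' = \<zero>\<^bsub>R\<^esub> \<and> y' = \<zero>\<^bsub>R\<^esub>)"

lemma disjoint_isoD:
  assumes "disjoint_iso R S G"
  shows "\<And>x y. (x, y) \<in> G \<Longrightarrow> x \<in> S" "\<And>x y. (x, y) \<in> G \<Longrightarrow> y \<in> S" "(\<zero>\<^bsub>R\<^esub>, \<zero>\<^bsub>R\<^esub>) \<in> G"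
    "\<And>x y x' y'. \<lbrakk>(x, y) \<in> G; (x', y') \<in> G\<rbrakk> \<Longrightarrow> (x \<oplus>\<^bsub>R\<^esub> x', y \<oplus>\<^bsub>R\<^esub> y') \<in> G"
    "\<And>x y a. \<lbrakk>(x, y) \<in> G; a \<in> carrier R\<rbrakk> \<Longrightarrow> (x \<otimes>\<^bsub>R\<^esub> a, y \<otimes>\<^bsub>R\<^esub> a) \<in> G"
    "\<And>x y x' y'. \<lbrakk>(x, y) \<in> G; (x', y') \<in> G; x \<oplus>\<^bsub>R\<^esub> y' = \<zero>\<^bsub>R\<^esub>\<rbrakk> \<Longrightarrow>
      x = \<zero>\<^bsub>R\<^esub> \<and> y = \<zero>\<^bsub>R\<^esub> \<and> x' = \<zero>\<^bsub>R\<^esub> \<and> y' = \<zero>\<^bsub>R\<^esub>"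
  using assms unfolding disjoint_iso_def by blast+

lemma (in ring) exists_maximal_disjoint_iso:
  assumes "\<zero> \<in> S"
  shows "\<exists>G. disjoint_iso R S G \<and> (\<forall>G'. disjoint_iso R S G' \<longrightarrow> G \<subseteq> G' \<longrightarrow> G' = G)"
proof -
  have "\<exists>G\<in>Collect (disjoint_iso R S). \<forall>G'\<in>Collect (disjoint_iso R S). G \<subseteq> G' \<longrightarrow> G' = G"
  proof (rule subset_Zorn_nonempty)
    have "disjoint_iso R S {(\<zero>, \<zero>)}" using assms by (simp add: disjoint_iso_def)
    then show "Collect (disjoint_iso R S) \<noteq> {}" by blast
    fix \<C> assume ne: "\<C> \<noteq> {}" and ch: "subset.chain (Collect (disjoint_iso R S)) \<C>"
    have mem: "disjoint_iso R S G" if "G \<in> \<C>" for G using ch that by (auto simp: subset_chain_def)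
    note D = disjoint_isoD[OF mem]
    have two: "\<exists>G\<in>\<C>. p \<in> G \<and> q \<in> G" if "p \<in> \<Union>\<C>" "q \<in> \<Union>\<C>" for p q
      using ch that unfolding subset_chain_def by blast
    have "disjoint_iso R S (\<Union>\<C>)"
      unfolding disjoint_iso_def
    proof (intro conjI allI impI)
      show "\<Union>\<C> \<subseteq> S \<times> S" using D(1,2) by auto
      show "(\<zero>, \<zero>) \<in> \<Union>\<C>" using ne D(3) by auto
      show "(x \<otimes> a, y \<otimes> a) \<in> \<Union>\<C>" if xy: "(x, y) \<in> \<Union>\<C>" and a: "a \<in> carrier R" for x y a
      proof -
        obtain G where "G \<in> \<C>" "(x, y) \<in> G" using xy by auto
        then show ?thesis using D(5)[of G x y a] a by auto
      qed
      fix x y x' y' assume xy: "(x, y) \<in> \<Union>\<C>" "(x', y') \<in> \<Union>\<C>"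
      then obtain G where G: "G \<in> \<C>" "(x, y) \<in> G" "(x', y') \<in> G" using two by blast
      show "(x \<oplus> x', y \<oplus> y') \<in> \<Union>\<C>" using D(4)[OF G] G(1) by blast
      assume "x \<oplus> y' = \<zero>"
      with D(6)[OF G] show "x = \<zero>" "y = \<zero>" "x' = \<zero>" "y' = \<zero>" by auto
    qed
    then show "\<Union>\<C> \<in> Collect (disjoint_iso R S)" by simp
  qed
  then show ?thesis by simp
qed

text \<open>
  The graph \<open>G\<close> belongs to an isomorphism \<open>f : X \<rightarrow> Y\<close>, and \<open>Z\<close> is a complement of \<open>X + Y\<close> in the
  socle. Elements of \<open>X + Y\<close> appear as \<open>x + y'\<close> with \<open>(x, y)\<close> and \<open>(x', y')\<close> in \<open>G\<close>.
\<close>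

locale socle_maximal_disjoint_iso = prime_right_a_ring +
  fixes G Z
  assumes socle_nonzero: "socle R \<noteq> {\<zero>}"
    and G: "disjoint_iso R (socle R) G"
    and G_max: "\<lbrakk>disjoint_iso R (socle R) G'; G \<subseteq> G'\<rbrakk> \<Longrightarrow> G' = G"
    and Z: "right_ideal Z R" "Z \<subseteq> socle R"
    and Z_disjoint: "\<lbrakk>(x, y) \<in> G; (x', y') \<in> G; x \<oplus> y' \<in> Z\<rbrakk> \<Longrightarrow> x \<oplus> y' = \<zero>"
    and decompose: "s \<in> socle R \<Longrightarrow> \<exists>x y x' y' z. (x, y) \<in> G \<and> (x', y') \<in> G \<and> z \<in> Z \<and> s = x \<oplus> y' \<oplus> z"
begin

abbreviation S where "S \<equiv> socle R"

lemma S_right_ideal: "right_ideal S R"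
  by (rule right_ideal_if_ideal[OF ideal_socle])

lemma S_essential: "essential_right_ideal R S"
  by (rule essential_if_ideal[OF ideal_socle socle_nonzero])

lemmas S_closed = right_idealD[OF S_right_ideal]

lemma S_l_closed: "\<lbrakk>a \<in> carrier R; s \<in> S\<rbrakk> \<Longrightarrow> a \<otimes> s \<in> S"
  using ideal.I_l_closed[OF ideal_socle] by blast

lemmas G_closed = disjoint_isoD[OF G]

lemmas Z_closed = right_idealD[OF Z(1)]

lemma G_carrier:
  assumes "(x, y) \<in> G"
  shows "x \<in> carrier R" "y \<in> carrier R"
  using G_closed(1,2)[OF assms] S_closed(5) by auto

lemma G_minus:
  assumes "(x, y) \<in> G" "(x', y') \<in> G"
  shows "(x \<ominus> x', y \<ominus> y') \<in> G"
  using G_closed(4)[OF assms(1) G_closed(5)[OF assms(2), of "\<ominus> \<one>"]] G_carrier[OF assms(2)]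
  by (simp add: minus_eq r_minus)

lemma sum_zero:
  assumes "(x, y) \<in> G" "(x', y') \<in> G" "z \<in> Z" "x \<oplus> y' \<oplus> z = \<zero>"
  shows "x = \<zero>" "y = \<zero>" "x' = \<zero>" "y' = \<zero>" "z = \<zero>"
proof -
  have c: "x \<in> carrier R" "y' \<in> carrier R" "z \<in> carrier R"
    using assms(1-3) G_carrier Z_closed(5) by auto
  have "x \<oplus> y' = \<zero> \<ominus> z" using assms(4) c minus_equality[of "x \<oplus> y'" z] by (simp add: minus_eq)
  then have "x \<oplus> y' \<in> Z" using Z_closed(6)[OF Z_closed(2) assms(3)] by simp
  then have 0: "x \<oplus> y' = \<zero>" by (rule Z_disjoint[OF assms(1,2)])
  then show "x = \<zero>" "y = \<zero>" "x' = \<zero>" "y' = \<zero>" using G_closed(6)[OF assms(1,2)] by auto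
  show "z = \<zero>" using 0 assms(4) c by simp
qed

text \<open>
  Only \<open>0\<close> annihilates the nonzero ideal \<open>S = X + Y + Z\<close> from the left, by primeness.
\<close>

lemma eq_if_eq_on_summands:
  assumes ab: "a \<in> carrier R" "b \<in> carrier R"
    and eqG: "\<And>x y. (x, y) \<in> G \<Longrightarrow> a \<otimes> x = b \<otimes> x" "\<And>x y. (x, y) \<in> G \<Longrightarrow> a \<otimes> y = b \<otimes> y"
    and eqZ: "\<And>z. z \<in> Z \<Longrightarrow> a \<otimes> z = b \<otimes> z"
  shows "a = b"
proof (rule ccontr)
  assume "a \<noteq> b"
  then have d: "a \<ominus> b \<in> carrier R" "a \<ominus> b \<noteq> \<zero>" using ab minus_eq_zero_iff by auto
  obtain s where s: "s \<in> S" "s \<noteq> \<zero>" using socle_nonzero S_closed(2) by blast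
  obtain r where r: "r \<in> carrier R" "(a \<ominus> b) \<otimes> r \<otimes> s \<noteq> \<zero>"
    using prime_elements[OF d S_closed(5)[OF s(1)] s(2)] by blast
  obtain x y x' y' z where *: "(x, y) \<in> G" "(x', y') \<in> G" "z \<in> Z" "r \<otimes> s = x \<oplus> y' \<oplus> z"
    using decompose[OF S_l_closed[OF r(1) s(1)]] by blast
  have c: "x \<in> carrier R" "y' \<in> carrier R" "z \<in> carrier R"
    using *(1-3) G_carrier Z_closed(5) by auto
  have "a \<otimes> (r \<otimes> s) = b \<otimes> (r \<otimes> s)"
    unfolding *(4) using c ab eqG(1)[OF *(1)] eqG(2)[OF *(2)] eqZ[OF *(3)] by (simp add: r_distr)
  then have "(a \<ominus> b) \<otimes> r \<otimes> s = \<zero>"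
    using ab r(1) S_closed(5)[OF s(1)] by (simp add: minus_eq l_distr l_minus m_assoc r_neg)
  then show False using r(2) by simp
qed

text \<open>
  Two nonzero right ideals \<open>A\<close> and \<open>B\<close> with \<open>A \<inter> B = 0\<close> inside \<open>Z\<close> contain nonzero isomorphic right ideals,
  because \<open>B A \<noteq> 0\<close> and \<open>S\<close> is semisimple. Adding these to \<open>X\<close> and \<open>Y\<close> contradicts maximality.
\<close>

lemma Z_minimal:
  assumes A: "right_ideal A R" "A \<subseteq> Z" "a \<in> A" "a \<noteq> \<zero>"
  shows "A = Z"
proof -
  obtain B where B: "right_ideal B R" "B \<subseteq> Z" "B \<inter> A \<subseteq> {\<zero>}"
    and sum: "\<forall>z\<in>Z. \<exists>a\<in>A. \<exists>b\<in>B. z = a \<oplus> b"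
    using socle_relative_complement[OF A(1) Z(1) A(2) Z(2)] by blast
  note AD = right_idealD[OF A(1)] and BD = right_idealD[OF B(1)]
  have "b = \<zero>" if b: "b \<in> B" for b
  proof (rule ccontr)
    assume "b \<noteq> \<zero>"
    then obtain r where r: "r \<in> carrier R" "b \<otimes> r \<otimes> a \<noteq> \<zero>"
      using prime_elements[OF BD(5)[OF b] _ AD(5)[OF A(3)] A(4)] by blast
    define t where "t = b \<otimes> r"
    have t: "t \<in> B" "t \<in> carrier R" "t \<otimes> a \<noteq> \<zero>" using BD(4)[OF b r(1)] BD(5) r(2) by (auto simp: t_def)
    have tB: "t \<otimes> \<tau> \<in> B" if "\<tau> \<in> A" for \<tau> using BD(4)[OF t(1) AD(5)[OF that]] .
    define K where "K = {x \<in> carrier R. t \<otimes> x = \<zero>} \<inter> A"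
    have K: "right_ideal K R" unfolding K_def
      by (rule right_ideal_Int[OF right_ideal_annihilator[OF t(2)] A(1)])
    have "K \<subseteq> A" "A \<subseteq> S" using A(2) Z(2) by (auto simp: K_def)
    then obtain T where T: "right_ideal T R" "T \<subseteq> A" "T \<inter> K \<subseteq> {\<zero>}"
      and sumA: "\<forall>a\<in>A. \<exists>k\<in>K. \<exists>\<tau>\<in>T. a = k \<oplus> \<tau>"
      using socle_relative_complement[OF K A(1)] by blast
    note TD = right_idealD[OF T(1)]
    have T0: "\<tau> = \<zero>" if "\<tau> \<in> T" "t \<otimes> \<tau> = \<zero>" for \<tau>
      using that T(2,3) AD(5) by (auto simp: K_def)
    define G' where "G' = {(x \<oplus> \<tau>, y \<oplus> t \<otimes> \<tau>) | x y \<tau>. (x, y) \<in> G \<and> \<tau> \<in> T}"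
    have G'I: "(x \<oplus> \<tau>, y \<oplus> t \<otimes> \<tau>) \<in> G'" if "(x, y) \<in> G" "\<tau> \<in> T" for x y \<tau>
      using that unfolding G'_def by blast
    have "disjoint_iso R S G'"
      unfolding disjoint_iso_def
    proof (intro conjI allI impI)
      show "G' \<subseteq> S \<times> S"
        using G_closed(1,2) S_closed(3) T(2) tB A(2) B(2) Z(2) unfolding G'_def by (auto simp: subset_iff)
      show "(\<zero>, \<zero>) \<in> G'" using G'I[OF G_closed(3) TD(2)] t(2) by simp
      show "(p \<otimes> a, q \<otimes> a) \<in> G'" if pq: "(p, q) \<in> G'" and a: "a \<in> carrier R" for p q a
      proof -
        obtain x y \<tau> where *: "p = x \<oplus> \<tau>" "q = y \<oplus> t \<otimes> \<tau>" "(x, y) \<in> G" "\<tau> \<in> T"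
          using pq unfolding G'_def by blast
        have "p \<otimes> a = x \<otimes> a \<oplus> \<tau> \<otimes> a" "q \<otimes> a = y \<otimes> a \<oplus> t \<otimes> (\<tau> \<otimes> a)"
          using * G_carrier[OF *(3)] TD(5)[OF *(4)] t(2) a by (simp_all add: l_distr m_assoc)
        then show ?thesis using G'I[OF G_closed(5)[OF *(3) a] TD(4)[OF *(4) a]] by simp
      qed
      fix p q p' q' assume "(p, q) \<in> G'" "(p', q') \<in> G'"
      then obtain x y \<tau> x' y' \<tau>' where *: "p = x \<oplus> \<tau>" "q = y \<oplus> t \<otimes> \<tau>" "(x, y) \<in> G" "\<tau> \<in> T"
        "p' = x' \<oplus> \<tau>'" "q' = y' \<oplus> t \<otimes> \<tau>'" "(x', y') \<in> G" "\<tau>' \<in> T"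
        unfolding G'_def by blast
      have c: "x \<in> carrier R" "y \<in> carrier R" "x' \<in> carrier R" "y' \<in> carrier R" "\<tau> \<in> carrier R" "\<tau>' \<in> carrier R"
        using * G_carrier TD(5) by blast+
      have "p \<oplus> p' = (x \<oplus> x') \<oplus> (\<tau> \<oplus> \<tau>')" "q \<oplus> q' = (y \<oplus> y') \<oplus> t \<otimes> (\<tau> \<oplus> \<tau>')"
        using c t(2) * by (simp_all add: r_distr a_ac)
      then show "(p \<oplus> p', q \<oplus> q') \<in> G'" using G'I[OF G_closed(4)[OF *(3,7)] TD(3)[OF *(4,8)]] by simp
      assume "p \<oplus> q' = \<zero>"
      then have 0: "x \<oplus> y' \<oplus> (\<tau> \<oplus> t \<otimes> \<tau>') = \<zero>" using c t(2) * by (simp add: a_ac)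
      have AB: "\<tau> \<in> A" "t \<otimes> \<tau>' \<in> B" using T(2) *(4,8) tB by auto
      then have "\<tau> \<oplus> t \<otimes> \<tau>' \<in> Z" using A(2) B(2) Z_closed(3) by blast
      note sz = sum_zero[OF *(3,7) this 0]
      have "\<tau> = \<zero>" "t \<otimes> \<tau>' = \<zero>" using direct_sum_zero[OF A(1) B(1,3) AB sz(5)] .
      moreover from this have "\<tau>' = \<zero>" using T0 *(8) by blast
      ultimately show "p = \<zero>" "q = \<zero>" "p' = \<zero>" "q' = \<zero>" using sz * t(2) by auto
    qed
    moreover have "G \<subseteq> G'"
    proof
      fix p assume p: "p \<in> G"
      obtain x y where xy: "p = (x, y)" by (cases p)
      show "p \<in> G'" using G'I[of x y \<zero>] p G_carrier[of x y] TD(2) t(2) unfolding xy by simp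
    qed
    ultimately have G'G: "G' = G" by (rule G_max)
    obtain k \<tau> where k\<tau>: "k \<in> K" "\<tau> \<in> T" "a = k \<oplus> \<tau>" using sumA A(3) by blast
    have "(\<zero> \<oplus> \<tau>, \<zero> \<oplus> t \<otimes> \<tau>) \<in> G" using G'I[OF G_closed(3) k\<tau>(2)] G'G by simp
    then have \<tau>G: "(\<tau>, t \<otimes> \<tau>) \<in> G" using TD(5)[OF k\<tau>(2)] t(2) by simp
    have "\<tau> \<oplus> \<zero> \<in> Z" using T(2) A(2) k\<tau>(2) TD(5)[OF k\<tau>(2)] by auto
    then have "\<tau> = \<zero>" using Z_disjoint[OF \<tau>G G_closed(3)] TD(5)[OF k\<tau>(2)] by simp
    then have "a \<in> K" using k\<tau> right_idealD(5)[OF K] by simp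
    then show False using t(3) by (simp add: K_def)
  qed
  then have "z \<in> A" if "z \<in> Z" for z
    using sum that AD(5) by fastforce
  then show ?thesis using A(2) by blast
qed

text \<open>
  Brauer's argument: choose \<open>w \<in> Z\<close> with \<open>w Z \<noteq> 0\<close>. As \<open>Z\<close> is minimal, left multiplication by \<open>w\<close> is a
  bijection of \<open>Z\<close>, and the \<open>h\<close> with \<open>w h = w\<close> is a left identity.
\<close>

lemma Z_left_identity: "\<exists>h\<in>Z. \<forall>z\<in>Z. h \<otimes> z = z"
proof (cases "Z \<subseteq> {\<zero>}")
  case True
  then have "\<zero> \<otimes> z = z" if "z \<in> Z" for z using that by auto
  then show ?thesis using Z_closed(2) by blast
next
  case False
  then obtain z where z: "z \<in> Z" "z \<noteq> \<zero>" by blast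
  obtain r where r: "r \<in> carrier R" "z \<otimes> r \<otimes> z \<noteq> \<zero>"
    using prime_elements[OF Z_closed(5)[OF z(1)] z(2) Z_closed(5)[OF z(1)] z(2)] by blast
  define w where "w = z \<otimes> r"
  have w: "w \<in> Z" "w \<in> carrier R" "w \<otimes> z \<noteq> \<zero>"
    using Z_closed(4)[OF z(1) r(1)] Z_closed(5) r(2) by (auto simp: w_def)
  have inj: "x = \<zero>" if x: "x \<in> Z" "w \<otimes> x = \<zero>" for x
  proof (rule ccontr)
    assume "x \<noteq> \<zero>"
    have "right_ideal ({x \<in> carrier R. w \<otimes> x = \<zero>} \<inter> Z) R"
      by (rule right_ideal_Int[OF right_ideal_annihilator[OF w(2)] Z(1)])
    from Z_minimal[OF this, of x] have "{x \<in> carrier R. w \<otimes> x = \<zero>} \<inter> Z = Z"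
      using x \<open>x \<noteq> \<zero>\<close> Z_closed(5) by auto
    then show False using z(1) w(3) by blast
  qed
  have "right_ideal {w \<otimes> x | x. x \<in> Z} R"
  proof (rule right_idealI)
    show "{w \<otimes> x | x. x \<in> Z} \<subseteq> carrier R" using w(2) Z_closed(5) by auto
    have "w \<otimes> \<zero> \<in> {w \<otimes> x | x. x \<in> Z}" using Z_closed(2) by blast
    then show "\<zero> \<in> {w \<otimes> x | x. x \<in> Z}" using w(2) by simp
    show "p \<oplus> q \<in> {w \<otimes> x | x. x \<in> Z}" if pq: "p \<in> {w \<otimes> x | x. x \<in> Z}" "q \<in> {w \<otimes> x | x. x \<in> Z}" for p q
    proof -
      obtain x y where "p = w \<otimes> x" "q = w \<otimes> y" "x \<in> Z" "y \<in> Z" using pq by blast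
      then have "p \<oplus> q = w \<otimes> (x \<oplus> y)" "x \<oplus> y \<in> Z" using w(2) Z_closed(3,5) by (auto simp: r_distr)
      then show ?thesis by blast
    qed
    show "p \<otimes> a \<in> {w \<otimes> x | x. x \<in> Z}" if pa: "p \<in> {w \<otimes> x | x. x \<in> Z}" "a \<in> carrier R" for p a
    proof -
      obtain x where "p = w \<otimes> x" "x \<in> Z" using pa by blast
      then have "p \<otimes> a = w \<otimes> (x \<otimes> a)" "x \<otimes> a \<in> Z" using w(2) Z_closed(4,5) pa(2) by (auto simp: m_assoc)
      then show ?thesis by blast
    qed
  qed
  moreover have "{w \<otimes> x | x. x \<in> Z} \<subseteq> Z" using Z_closed(4)[OF w(1)] Z_closed(5) by blast
  moreover have "w \<otimes> z \<in> {w \<otimes> x | x. x \<in> Z}" using z(1) by blast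
  ultimately have "{w \<otimes> x | x. x \<in> Z} = Z" using w(3) by (rule Z_minimal)
  then obtain h where h: "h \<in> Z" "w = w \<otimes> h" using w(1) by blast
  have hc: "h \<in> carrier R" using Z_closed(5)[OF h(1)] .
  have "h \<otimes> x = x" if x: "x \<in> Z" for x
  proof -
    have xc: "x \<in> carrier R" using Z_closed(5)[OF x] .
    have "w \<otimes> (h \<otimes> x) = w \<otimes> x" using h(2) w(2) hc xc by (metis m_assoc)
    then have "w \<otimes> (h \<otimes> x \<ominus> x) = \<zero>" using w(2) hc xc by (simp add: minus_eq r_distr r_minus r_neg)
    moreover have "h \<otimes> x \<ominus> x \<in> Z" using Z_closed(6)[OF Z_closed(4)[OF h(1) xc] x] .
    ultimately have "h \<otimes> x \<ominus> x = \<zero>" using inj by blast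
    then show ?thesis using hc xc minus_eq_zero_iff by simp
  qed
  then show ?thesis using h(1) by blast
qed

text \<open>
  The automorphisms of \<open>S\<close> that will be applied: for \<open>f : X \<rightarrow> Y\<close> the given isomorphism, the shear
  \<open>x + y + z \<mapsto> x + (f x + y) + z\<close> and the swap \<open>x + y + z \<mapsto> f\<^sup>-\<^sup>1 y + f x + z\<close>.
\<close>

definition shear where
  "shear = {(x \<oplus> y' \<oplus> z, x \<oplus> (y \<oplus> y') \<oplus> z) | x y x' y' z. (x, y) \<in> G \<and> (x', y') \<in> G \<and> z \<in> Z}"

definition swap where
  "swap = {(x \<oplus> y' \<oplus> z, x' \<oplus> y \<oplus> z) | x y x' y' z. (x, y) \<in> G \<and> (x', y') \<in> G \<and> z \<in> Z}"

lemma shearI: "\<lbrakk>(x, y) \<in> G; (x', y') \<in> G; z \<in> Z\<rbrakk> \<Longrightarrow> (x \<oplus> y' \<oplus> z, x \<oplus> (y \<oplus> y') \<oplus> z) \<in> shear"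
  unfolding shear_def by blast

lemma swapI: "\<lbrakk>(x, y) \<in> G; (x', y') \<in> G; z \<in> Z\<rbrakk> \<Longrightarrow> (x \<oplus> y' \<oplus> z, x' \<oplus> y \<oplus> z) \<in> swap"
  unfolding swap_def by blast

lemma sum_in_S: "\<lbrakk>(x, y) \<in> G; (x', y') \<in> G; z \<in> Z\<rbrakk> \<Longrightarrow> x \<oplus> y' \<oplus> z \<in> S"
  using G_closed(1,2) Z(2) S_closed(3) by (meson subsetD)

lemma shear_essential_partial_iso: "essential_partial_iso R shear"
  unfolding essential_partial_iso_def
proof (intro conjI allI impI)
  fix p q p' q' assume "(p, q) \<in> shear" "(p', q') \<in> shear"
  then obtain x1 y1 x1' y1' z1 x2 y2 x2' y2' z2 where
    1: "p = x1 \<oplus> y1' \<oplus> z1" "q = x1 \<oplus> (y1 \<oplus> y1') \<oplus> z1" "(x1, y1) \<in> G" "(x1', y1') \<in> G" "z1 \<in> Z" and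
    2: "p' = x2 \<oplus> y2' \<oplus> z2" "q' = x2 \<oplus> (y2 \<oplus> y2') \<oplus> z2" "(x2, y2) \<in> G" "(x2', y2') \<in> G" "z2 \<in> Z"
    unfolding shear_def by blast
  note c = G_carrier[OF 1(3)] G_carrier[OF 1(4)] Z_closed(5)[OF 1(5)] G_carrier[OF 2(3)] G_carrier[OF 2(4)] Z_closed(5)[OF 2(5)]
  have "p \<oplus> p' = (x1 \<oplus> x2) \<oplus> (y1' \<oplus> y2') \<oplus> (z1 \<oplus> z2)"
    "q \<oplus> q' = (x1 \<oplus> x2) \<oplus> ((y1 \<oplus> y2) \<oplus> (y1' \<oplus> y2')) \<oplus> (z1 \<oplus> z2)"
    unfolding 1(1,2) 2(1,2) using c by (simp_all add: a_ac)
  then show "(p \<oplus> p', q \<oplus> q') \<in> shear"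
    using shearI[OF G_closed(4)[OF 1(3) 2(3)] G_closed(4)[OF 1(4) 2(4)] Z_closed(3)[OF 1(5) 2(5)]] by simp
next
  fix p q a assume "(p, q) \<in> shear" and a: "a \<in> carrier R"
  then obtain x y x' y' z where
    1: "p = x \<oplus> y' \<oplus> z" "q = x \<oplus> (y \<oplus> y') \<oplus> z" "(x, y) \<in> G" "(x', y') \<in> G" "z \<in> Z"
    unfolding shear_def by blast
  note c = G_carrier[OF 1(3)] G_carrier[OF 1(4)] Z_closed(5)[OF 1(5)]
  have "p \<otimes> a = x \<otimes> a \<oplus> y' \<otimes> a \<oplus> z \<otimes> a" "q \<otimes> a = x \<otimes> a \<oplus> (y \<otimes> a \<oplus> y' \<otimes> a) \<oplus> z \<otimes> a"
    unfolding 1(1,2) using c a by (simp_all add: l_distr)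
  then show "(p \<otimes> a, q \<otimes> a) \<in> shear"
    using shearI[OF G_closed(5)[OF 1(3) a] G_closed(5)[OF 1(4) a] Z_closed(4)[OF 1(5) a]] by simp
next
  fix p q assume "(p, q) \<in> shear"
  then obtain x y x' y' z where
    1: "p = x \<oplus> y' \<oplus> z" "q = x \<oplus> (y \<oplus> y') \<oplus> z" "(x, y) \<in> G" "(x', y') \<in> G" "z \<in> Z"
    unfolding shear_def by blast
  note c = G_carrier[OF 1(3)] G_carrier[OF 1(4)] Z_closed(5)[OF 1(5)]
  show "p = \<zero> \<longleftrightarrow> q = \<zero>"
  proof
    assume "p = \<zero>"
    then show "q = \<zero>" using sum_zero[OF 1(3,4,5)] 1(1,2) by simp
  next
    assume "q = \<zero>"
    then have "x = \<zero>" "y = \<zero>" "y \<oplus> y' = \<zero>" "z = \<zero>"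
      using sum_zero[OF 1(3) G_closed(4)[OF 1(3,4)] 1(5)] 1(2) by auto
    then show "p = \<zero>" using 1(1) c by simp
  qed
next
  have "Domain shear = S"
  proof (intro equalityI subsetI)
    show "p \<in> S" if "p \<in> Domain shear" for p using that sum_in_S unfolding shear_def by auto
    show "p \<in> Domain shear" if "p \<in> S" for p using decompose[OF that] shearI by blast
  qed
  then show "essential_right_ideal R (Domain shear)" using S_essential by simp
  have "Range shear = S"
  proof (intro equalityI subsetI)
    fix q assume "q \<in> Range shear"
    then obtain x y x' y' z where
      1: "q = x \<oplus> (y \<oplus> y') \<oplus> z" "(x, y) \<in> G" "(x', y') \<in> G" "z \<in> Z"
      unfolding shear_def by blast
    show "q \<in> S" unfolding 1(1) by (rule sum_in_S[OF 1(2) G_closed(4)[OF 1(2,3)] 1(4)])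
  next
    fix q assume "q \<in> S"
    then obtain x y x' y' z where
      1: "q = x \<oplus> y' \<oplus> z" "(x, y) \<in> G" "(x', y') \<in> G" "z \<in> Z"
      using decompose by blast
    note c = G_carrier[OF 1(2)] G_carrier[OF 1(3)]
    have "y \<oplus> (y' \<ominus> y) = y'" using c by (simp add: minus_eq a_lcomm[of y y'] r_neg)
    then have "(x \<oplus> (y' \<ominus> y) \<oplus> z, q) \<in> shear"
      using shearI[OF 1(2) G_minus[OF 1(3,2)] 1(4)] 1(1) by simp
    then show "q \<in> Range shear" by blast
  qed
  then show "essential_right_ideal R (Range shear)" using S_essential by simp
qed

lemma swap_essential_partial_iso: "essential_partial_iso R swap"
  unfolding essential_partial_iso_def
proof (intro conjI allI impI)
  fix p q p' q' assume "(p, q) \<in> swap" "(p', q') \<in> swap"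
  then obtain x1 y1 x1' y1' z1 x2 y2 x2' y2' z2 where
    1: "p = x1 \<oplus> y1' \<oplus> z1" "q = x1' \<oplus> y1 \<oplus> z1" "(x1, y1) \<in> G" "(x1', y1') \<in> G" "z1 \<in> Z" and
    2: "p' = x2 \<oplus> y2' \<oplus> z2" "q' = x2' \<oplus> y2 \<oplus> z2" "(x2, y2) \<in> G" "(x2', y2') \<in> G" "z2 \<in> Z"
    unfolding swap_def by blast
  note c = G_carrier[OF 1(3)] G_carrier[OF 1(4)] Z_closed(5)[OF 1(5)] G_carrier[OF 2(3)] G_carrier[OF 2(4)] Z_closed(5)[OF 2(5)]
  have "p \<oplus> p' = (x1 \<oplus> x2) \<oplus> (y1' \<oplus> y2') \<oplus> (z1 \<oplus> z2)"
    "q \<oplus> q' = (x1' \<oplus> x2') \<oplus> (y1 \<oplus> y2) \<oplus> (z1 \<oplus> z2)"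
    unfolding 1(1,2) 2(1,2) using c by (simp_all add: a_ac)
  then show "(p \<oplus> p', q \<oplus> q') \<in> swap"
    using swapI[OF G_closed(4)[OF 1(3) 2(3)] G_closed(4)[OF 1(4) 2(4)] Z_closed(3)[OF 1(5) 2(5)]] by simp
next
  fix p q a assume "(p, q) \<in> swap" and a: "a \<in> carrier R"
  then obtain x y x' y' z where
    1: "p = x \<oplus> y' \<oplus> z" "q = x' \<oplus> y \<oplus> z" "(x, y) \<in> G" "(x', y') \<in> G" "z \<in> Z"
    unfolding swap_def by blast
  note c = G_carrier[OF 1(3)] G_carrier[OF 1(4)] Z_closed(5)[OF 1(5)]
  have "p \<otimes> a = x \<otimes> a \<oplus> y' \<otimes> a \<oplus> z \<otimes> a" "q \<otimes> a = x' \<otimes> a \<oplus> y \<otimes> a \<oplus> z \<otimes> a"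
    unfolding 1(1,2) using c a by (simp_all add: l_distr)
  then show "(p \<otimes> a, q \<otimes> a) \<in> swap"
    using swapI[OF G_closed(5)[OF 1(3) a] G_closed(5)[OF 1(4) a] Z_closed(4)[OF 1(5) a]] by simp
next
  fix p q assume "(p, q) \<in> swap"
  then obtain x y x' y' z where
    1: "p = x \<oplus> y' \<oplus> z" "q = x' \<oplus> y \<oplus> z" "(x, y) \<in> G" "(x', y') \<in> G" "z \<in> Z"
    unfolding swap_def by blast
  show "p = \<zero> \<longleftrightarrow> q = \<zero>"
  proof
    show "q = \<zero>" if "p = \<zero>" using sum_zero[OF 1(3,4,5)] 1(1,2) that by simp
    show "p = \<zero>" if "q = \<zero>" using sum_zero[OF 1(4,3,5)] 1(1,2) that by simp
  qed
next
  have "Domain swap = S"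
  proof (intro equalityI subsetI)
    show "p \<in> S" if "p \<in> Domain swap" for p using that sum_in_S unfolding swap_def by auto
    show "p \<in> Domain swap" if "p \<in> S" for p using decompose[OF that] swapI by blast
  qed
  then show "essential_right_ideal R (Domain swap)" using S_essential by simp
  have "Range swap = S"
  proof (intro equalityI subsetI)
    show "q \<in> S" if "q \<in> Range swap" for q using that sum_in_S unfolding swap_def by auto
    show "q \<in> Range swap" if "q \<in> S" for q using decompose[OF that] swapI by blast
  qed
  then show "essential_right_ideal R (Range swap)" using S_essential by simp
qed

text \<open>
  Both automorphisms are left multiplications, by \<open>u\<close> and \<open>\<sigma>\<close>. On \<open>S\<close>, \<open>c = u - 1\<close> is \<open>f\<close> composed with the
  projection to \<open>X\<close>, and \<open>e = \<sigma> c\<close> is that projection. As \<open>u\<close> preserves the essential right ideal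
  \<open>e R + S\<close>, we get \<open>c = c e = e r + s\<close> with \<open>s\<close> in \<open>S\<close>, and \<open>e c = 0\<close> leads to \<open>c = s - e s\<close>. So \<open>c\<close>, the
  projections \<open>e\<close> and \<open>e' = c \<sigma>\<close> to \<open>X\<close> and \<open>Y\<close>, and finally the projection to \<open>Z\<close> lie in \<open>S\<close>.
\<close>

lemma one_in_S: "\<one> \<in> S"
proof -
  obtain u where u: "u \<in> carrier R" "\<And>x y. (x, y) \<in> shear \<Longrightarrow> u \<otimes> x = y"
    and stable: "\<And>L x. \<lbrakk>essential_right_ideal R L; x \<in> L\<rbrakk> \<Longrightarrow> u \<otimes> x \<in> L"
    by (rule right_a_ring_partial_iso[OF right_a_ring shear_essential_partial_iso]) (rule that)
  obtain \<sigma> where \<sigma>: "\<sigma> \<in> carrier R" "\<And>x y. (x, y) \<in> swap \<Longrightarrow> \<sigma> \<otimes> x = y"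
    by (rule right_a_ring_partial_iso[OF right_a_ring swap_essential_partial_iso]) (rule that)
  note G0 = G_closed(3) and Z0 = Z_closed(2)
  define c where "c = u \<ominus> \<one>"
  have cR: "c \<in> carrier R" using u(1) by (simp add: c_def)
  have cmult: "c \<otimes> v = u \<otimes> v \<ominus> v" if "v \<in> carrier R" for v
    using that u(1) by (simp add: c_def minus_eq l_distr l_minus)
  have cX: "c \<otimes> x = y" if xy: "(x, y) \<in> G" for x y
  proof -
    note xc = G_carrier[OF xy]
    have "u \<otimes> x = x \<oplus> y" using u(2)[OF shearI[OF xy G0 Z0]] xc by simp
    then show ?thesis using xc by (simp add: cmult minus_eq a_assoc a_lcomm[of x y] r_neg)
  qed
  have cY: "c \<otimes> y = \<zero>" if xy: "(x, y) \<in> G" for x y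
  proof -
    note xc = G_carrier[OF xy]
    have "u \<otimes> y = y" using u(2)[OF shearI[OF G0 xy Z0]] xc by simp
    then show ?thesis using xc by (simp add: cmult minus_eq r_neg)
  qed
  have cZ: "c \<otimes> z = \<zero>" if z: "z \<in> Z" for z
  proof -
    note zc = Z_closed(5)[OF z]
    have "u \<otimes> z = z" using u(2)[OF shearI[OF G0 G0 z]] zc by simp
    then show ?thesis using zc by (simp add: cmult minus_eq r_neg)
  qed
  have \<sigma>X: "\<sigma> \<otimes> x = y" if xy: "(x, y) \<in> G" for x y
    using \<sigma>(2)[OF swapI[OF xy G0 Z0]] G_carrier[OF xy] by simp
  have \<sigma>Y: "\<sigma> \<otimes> y = x" if xy: "(x, y) \<in> G" for x y
    using \<sigma>(2)[OF swapI[OF G0 xy Z0]] G_carrier[OF xy] by simp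
  have \<sigma>Z: "\<sigma> \<otimes> z = z" if z: "z \<in> Z" for z
    using \<sigma>(2)[OF swapI[OF G0 G0 z]] Z_closed(5)[OF z] by simp
  define e where "e = \<sigma> \<otimes> c"
  define e' where "e' = c \<otimes> \<sigma>"
  have eR: "e \<in> carrier R" and e'R: "e' \<in> carrier R" using cR \<sigma>(1) by (auto simp: e_def e'_def)
  have eX: "e \<otimes> x = x" and eY: "e \<otimes> y = \<zero>" and e'X: "e' \<otimes> x = \<zero>" and e'Y: "e' \<otimes> y = y"
    if xy: "(x, y) \<in> G" for x y
    using cX[OF xy] cY[OF xy] \<sigma>X[OF xy] \<sigma>Y[OF xy] G_carrier[OF xy] cR \<sigma>(1)
    by (simp_all add: e_def e'_def m_assoc)
  have eZ: "e \<otimes> z = \<zero>" and e'Z: "e' \<otimes> z = \<zero>" if z: "z \<in> Z" for z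
    using cZ[OF z] \<sigma>Z[OF z] Z_closed(5)[OF z] cR \<sigma>(1) by (simp_all add: e_def e'_def m_assoc)
  have ee: "e \<otimes> e = e"
    by (rule eq_if_eq_on_summands) (simp_all add: eR m_assoc eX eY eZ G_carrier Z_closed(5))
  have ec: "e \<otimes> c = \<zero>"
    by (rule eq_if_eq_on_summands) (simp_all add: eR cR m_assoc cX cY cZ eY G_carrier Z_closed(5))
  have ce: "c \<otimes> e = c"
    by (rule eq_if_eq_on_summands) (simp_all add: eR cR m_assoc eX eY eZ cY cZ G_carrier Z_closed(5))
  define L where "L = {p \<oplus> s | p s. p \<in> {e \<otimes> r | r. r \<in> carrier R} \<and> s \<in> S}"
  have "right_ideal L R"
    unfolding L_def by (rule right_ideal_sum[OF right_ideal_principal[OF eR] S_right_ideal])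
  moreover have LI: "e \<otimes> r \<oplus> s \<in> L" if "r \<in> carrier R" "s \<in> S" for r s using that unfolding L_def by blast
  have "S \<subseteq> L"
  proof
    fix s assume "s \<in> S"
    then show "s \<in> L" using LI[of \<zero> s] S_closed(5)[of s] eR by simp
  qed
  ultimately have L: "essential_right_ideal R L" using essential_right_ideal_mono[OF S_essential] by blast
  have eL: "e \<in> L" using LI[OF one_closed S_closed(2)] eR by simp
  have Lr: "right_ideal L R" using L by (simp add: essential_right_ideal_def)
  have "c \<otimes> e \<in> L"
    unfolding cmult[OF eR] by (rule right_idealD(6)[OF Lr stable[OF L eL] eL])
  then obtain r s where rs: "r \<in> carrier R" "s \<in> S" "c = e \<otimes> r \<oplus> s"
    unfolding ce L_def by blast
  have sR: "s \<in> carrier R" using S_closed(5)[OF rs(2)] .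
  have "e \<otimes> c = e \<otimes> e \<otimes> r \<oplus> e \<otimes> s" using rs sR eR by (simp add: r_distr m_assoc)
  then have "e \<otimes> r \<oplus> e \<otimes> s = \<zero>" using ec ee by simp
  then have er: "e \<otimes> r = \<ominus> (e \<otimes> s)" using minus_equality[of "e \<otimes> r" "e \<otimes> s"] rs(1) sR eR by simp
  have "c = s \<ominus> e \<otimes> s"
    using rs(3) sR eR unfolding er by (simp add: minus_eq a_comm)
  then have cS: "c \<in> S" using S_closed(6)[OF rs(2) S_l_closed[OF eR rs(2)]] by simp
  have eS: "e \<in> S" unfolding e_def by (rule S_l_closed[OF \<sigma>(1) cS])
  have e'S: "e' \<in> S" unfolding e'_def by (rule S_closed(4)[OF cS \<sigma>(1)])
  define g where "g = \<one> \<ominus> e \<ominus> e'"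
  have gR: "g \<in> carrier R" using eR e'R by (simp add: g_def)
  have gmult: "g \<otimes> v = v \<ominus> e \<otimes> v \<ominus> e' \<otimes> v" if "v \<in> carrier R" for v
    using that eR e'R by (simp add: g_def minus_eq l_distr l_minus)
  have gX: "g \<otimes> x = \<zero>" and gY: "g \<otimes> y = \<zero>" if xy: "(x, y) \<in> G" for x y
    using G_carrier[OF xy] eX[OF xy] eY[OF xy] e'X[OF xy] e'Y[OF xy] by (simp_all add: gmult minus_eq r_neg)
  have gZ: "g \<otimes> z = z" if z: "z \<in> Z" for z
    using Z_closed(5)[OF z] eZ[OF z] e'Z[OF z] by (simp add: gmult minus_eq)
  obtain h where h: "h \<in> Z" "\<And>z. z \<in> Z \<Longrightarrow> h \<otimes> z = z" using Z_left_identity by blast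
  have hR: "h \<in> carrier R" using Z_closed(5)[OF h(1)] .
  have "h \<otimes> g = g"
    by (rule eq_if_eq_on_summands) (simp_all add: hR gR m_assoc gX gY gZ h(2) G_carrier Z_closed(5))
  moreover have "h \<otimes> g \<in> S" using S_closed(4)[OF _ gR] h(1) Z(2) by blast
  ultimately have gS: "g \<in> S" by simp
  have "\<one> = g \<oplus> e' \<oplus> e"
    using eR e'R by (simp add: g_def minus_eq a_assoc l_neg)
  then show ?thesis using S_closed(3)[OF S_closed(3)[OF gS e'S] eS] by simp
qed

end

section \<open>Prime right a-rings are simple artinian\<close>

context prime_right_a_ring
begin

lemma one_in_socle:
  assumes nonzero: "socle R \<noteq> {\<zero>}"
  shows "\<one> \<in> socle R"
proof -
  have S: "right_ideal (socle R) R" by (rule right_ideal_if_ideal[OF ideal_socle])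
  obtain G where G: "disjoint_iso R (socle R) G"
    and max: "\<And>G'. \<lbrakk>disjoint_iso R (socle R) G'; G \<subseteq> G'\<rbrakk> \<Longrightarrow> G' = G"
    using exists_maximal_disjoint_iso[OF right_idealD(2)[OF S]] by blast
  note GD = disjoint_isoD[OF G] and SD = right_idealD[OF S]
  have Dom: "right_ideal (Domain G) R"
  proof (rule right_idealI)
    show "Domain G \<subseteq> carrier R" using GD(1) SD(5) by blast
  qed (use GD(3-5) in blast)+
  have Ran: "right_ideal (Range G) R"
  proof (rule right_idealI)
    show "Range G \<subseteq> carrier R" using GD(2) SD(5) by blast
  qed (use GD(3-5) in blast)+
  define W where "W = {x \<oplus> y | x y. x \<in> Domain G \<and> y \<in> Range G}"
  have W: "right_ideal W R" unfolding W_def by (rule right_ideal_sum[OF Dom Ran])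
  have WS: "W \<subseteq> socle R" unfolding W_def using GD(1,2) SD(3) by blast
  obtain Z where Z: "right_ideal Z R" "Z \<subseteq> socle R" "Z \<inter> W \<subseteq> {\<zero>}"
    and sum: "\<forall>s\<in>socle R. \<exists>w\<in>W. \<exists>z\<in>Z. s = w \<oplus> z"
    using socle_relative_complement[OF W S WS] by blast
  interpret socle_maximal_disjoint_iso R G Z
  proof (intro socle_maximal_disjoint_iso.intro socle_maximal_disjoint_iso_axioms.intro prime_right_a_ring_axioms)
    show "x \<oplus> y' = \<zero>" if "(x, y) \<in> G" "(x', y') \<in> G" "x \<oplus> y' \<in> Z" for x y x' y'
    proof -
      have "x \<oplus> y' \<in> W" unfolding W_def using that(1,2) by blast
      then show ?thesis using that(3) Z(3) by blast
    qed
    show "\<exists>x y x' y' z. (x, y) \<in> G \<and> (x', y') \<in> G \<and> z \<in> Z \<and> s = x \<oplus> y' \<oplus> z" if s: "s \<in> socle R" for s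
    proof -
      obtain w z where "w \<in> W" "z \<in> Z" "s = w \<oplus> z" using sum s by blast
      then show ?thesis unfolding W_def by blast
    qed
  qed (fact nonzero G max Z)+
  show ?thesis by (rule one_in_S)
qed

lemma no_proper_essential_right_ideal:
  assumes L: "essential_right_ideal R L"
  shows "L = carrier R"
proof (cases "\<forall>I C. right_ideal I R \<longrightarrow> right_ideal C R \<longrightarrow> C \<inter> I \<subseteq> {\<zero>} \<longrightarrow> I \<subseteq> {\<zero>} \<or> C \<subseteq> {\<zero>}")
  case True
  then show ?thesis using L by (intro essential_eq_carrier_if_uniform) blast+
next
  case False
  then obtain I C i c where IC: "right_ideal I R" "right_ideal C R" "C \<inter> I \<subseteq> {\<zero>}"
    and i: "i \<in> I" "i \<noteq> \<zero>" and c: "c \<in> C" "c \<noteq> \<zero>" by blast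
  obtain r where r: "r \<in> carrier R" "c \<otimes> r \<otimes> i \<noteq> \<zero>"
    using prime_elements[OF right_idealD(5)[OF IC(2) c(1)] c(2) right_idealD(5)[OF IC(1) i(1)] i(2)] by blast
  have "c \<otimes> r \<otimes> i \<in> socle R"
    unfolding socle_def
    using mult_in_essential_right_ideal[OF IC right_idealD(4)[OF IC(2) c(1) r(1)] i(1)] by blast
  then have "socle R \<noteq> {\<zero>}" using r(2) by blast
  then have "\<one> \<in> socle R" by (rule one_in_socle)
  then have one: "\<one> \<in> L" using socle_subset[OF L] by blast
  have Lr: "right_ideal L R" using L by (simp add: essential_right_ideal_def)
  have "x \<in> L" if "x \<in> carrier R" for x
    using right_idealD(4)[OF Lr one that] that by simp
  then show ?thesis using right_idealD(1)[OF Lr] by blast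
qed

end

theorem theorem4p7:
  fixes R :: "('a, 'b) ring_scheme"
  assumes "prime_ring R"
  shows "right_a_ring R \<longleftrightarrow> simple_artinian_ring R"
proof
  interpret prime_ring R by fact
  show "simple_artinian_ring R" if "right_a_ring R"
  proof -
    interpret prime_right_a_ring R by unfold_locales (rule that)
    interpret prime_semisimple_ring R by unfold_locales (rule no_proper_essential_right_ideal)
    show ?thesis by (rule simple_artinian)
  qed
  show "right_a_ring R" if R: "simple_artinian_ring R"
  proof -
    interpret simple_ring R using R by (simp add: simple_artinian_ring_def)
    have "L = carrier R" if "essential_right_ideal R L" for L
      using essential_right_ideal_eq_carrier[OF _ that] R
      by (simp add: simple_artinian_ring_def artinian_def)
    then show ?thesis
      unfolding right_a_ring_def
      using automorphism_invariant_if_no_proper_essential[OF right_module_right_ideal_module] ring_axioms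
      by blast
  qed
qed

end
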